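(* Let $n,k\ge 2$ and let $\phi_k(y)=(y^{m_1},\ldots,y^{m_k})$ be a parameterized monomial curve in $\mathbb{C}^k$ with $1<m_1<m_2<\cdots<m_k$ and $\gcd(m_1,\ldots,m_k)=1$. Write $\underline{x}=(x_1,\ldots,x_{n-1})$. Let $f:(\mathbb{C}^n,0)\to(\mathbb{C}^{2n+k-2},0)$ be a singular monomial map-germ satisfying $f(\underline{0},y)=(0,\ldots,0,\phi_k(y))$. Then $f$ is $\mathcal{A}$-finite if and only if $f$ is $\mathcal{A}$-equivalent to $$(I*\phi_k)_H(\underline{x},y)=(\underline{x},\ y^{m_1},\ldots,y^{m_k},\ x_1^{\lambda_1}y,\ldots,x_{n-1}^{\lambda_{n-1}}y)$$ for some integers $\lambda_i\ge 1$, $i=1,\ldots,n-1$, where $I$ is the identity of $\mathbb{C}^{n-1}$.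
   Context: All germs are holomorphic. Two germs $f,g:(\mathbb{C}^n,0)\to(\mathbb{C}^p,0)$ are $\mathcal{A}$-equivalent if $g=\psi\circ f\circ\rho^{-1}$ for germs of biholomorphisms $\rho$ of $(\mathbb{C}^n,0)$ and $\psi$ of $(\mathbb{C}^p,0)$. A germ $f$ is $\mathcal{A}$-finite (finitely determined) if there is $r<\infty$ such that every germ $g:(\mathbb{C}^n,0)\to(\mathbb{C}^p,0)$ with the same $r$-jet at $0$ as $f$ is $\mathcal{A}$-equivalent to $f$. A germ $f:(\mathbb{C}^n,0)\to(\mathbb{C}^p,0)$, $p\ge n$, is singular if $\operatorname{rank} df_0<n$. A map-germ is monomial if each of its components is a monomial in the source coordinates (the zero component is allowed). *)

theory Defs
  imports "HOL-Analysis.Analysis"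
begin

subsection \<open>Numbered coordinates\<close>

text \<open>
  The space \<open>\<complex>\<^sup>d\<close> is \<^typ>\<open>complex^'i\<close> with \<open>CARD('i) = d\<close>. The linear order on the
  index type numbers the coordinates \<open>1, \<dots>, d\<close>, so that they can be addressed as in
  \<open>(z\<^sub>1, \<dots>, z\<^sub>d)\<close>.
\<close>

definition pos :: "'i::{finite,linorder} \<Rightarrow> nat" where
  "pos i = card {..i}"

lemma bij_betw_pos: "bij_betw pos (UNIV :: 'i::{finite,linorder} set) {1..CARD('i)}"
proof -
  have less: "pos i < pos j" if "i < j" for i j :: 'i
    unfolding pos_def using that by (intro psubset_card_mono) auto
  have inj: "inj (pos :: 'i \<Rightarrow> nat)"
    by (rule injI) (metis less less_irrefl linorder_less_linear)
  have "range (pos :: 'i \<Rightarrow> nat) \<subseteq> {1..CARD('i)}"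
    by (auto simp: pos_def Suc_le_eq card_gt_0_iff intro!: card_mono)
  moreover have "card (range (pos :: 'i \<Rightarrow> nat)) = card {1..CARD('i)}"
    using inj by (simp add: card_image)
  ultimately have "range (pos :: 'i \<Rightarrow> nat) = {1..CARD('i)}"
    by (intro card_subset_eq) auto
  with inj show ?thesis
    by (simp add: bij_betw_def)
qed

definition coord :: "complex^'i::{finite,linorder} \<Rightarrow> nat \<Rightarrow> complex" where
  "coord z j = z $ (inv pos j)"

definition of_coords :: "(nat \<Rightarrow> complex) \<Rightarrow> complex^'i::{finite,linorder}" where
  "of_coords c = (\<chi> i. c (pos i))"

lemma coord_of_coords:
  assumes "1 \<le> j" "j \<le> CARD('i)"
  shows "coord (of_coords c :: complex^'i::{finite,linorder}) j = c j"
proof -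
  have "j \<in> range (pos :: 'i \<Rightarrow> nat)"
    using assms bij_betw_pos[where 'i = 'i] by (auto simp: bij_betw_def)
  then show ?thesis
    by (simp add: coord_def of_coords_def f_inv_into_f)
qed


subsection \<open>Holomorphic map-germs and \<open>\<A>\<close>-equivalence\<close>

text \<open>
  A germ at the origin is represented by a total function of which only the behaviour
  near \<open>0\<close> matters. Holomorphy is complex Frechet differentiability on a neighbourhood
  of \<open>0\<close>: the real derivative exists and is linear over \<open>\<complex>\<close>.
\<close>

definition map_germ :: "(complex^'n \<Rightarrow> complex^'p) \<Rightarrow> bool" where
  "map_germ f \<longleftrightarrow> f 0 = 0 \<and>
     (\<forall>\<^sub>F z in nhds 0. \<exists>D. (f has_derivative D) (at z) \<and> Vector_Spaces.linear (*s) (*s) D)"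

definition inverse_germs ::
    "(complex^'n \<Rightarrow> complex^'n) \<Rightarrow> (complex^'n \<Rightarrow> complex^'n) \<Rightarrow> bool" where
  "inverse_germs \<rho> \<sigma> \<longleftrightarrow> map_germ \<rho> \<and> map_germ \<sigma> \<and>
     (\<forall>\<^sub>F z in nhds 0. \<sigma> (\<rho> z) = z) \<and> (\<forall>\<^sub>F z in nhds 0. \<rho> (\<sigma> z) = z)"

definition biholomorphism_germ :: "(complex^'n \<Rightarrow> complex^'n) \<Rightarrow> bool" where
  "biholomorphism_germ \<rho> \<longleftrightarrow> (\<exists>\<sigma>. inverse_germs \<rho> \<sigma>)"

text \<open>In the following definition \<open>\<sigma>\<close> is \<open>\<rho>\<^sup>-\<^sup>1\<close>.\<close>

definition A_equivalent ::
    "(complex^'n \<Rightarrow> complex^'p) \<Rightarrow> (complex^'n \<Rightarrow> complex^'p) \<Rightarrow> bool" where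
  "A_equivalent f g \<longleftrightarrow>
     (\<exists>\<rho> \<sigma> \<psi>. inverse_germs \<rho> \<sigma> \<and> biholomorphism_germ \<psi> \<and>
        (\<forall>\<^sub>F z in nhds 0. g z = \<psi> (f (\<sigma> z))))"

definition partial_deriv ::
    "'n \<Rightarrow> (complex^'n \<Rightarrow> complex) \<Rightarrow> complex^'n \<Rightarrow> complex" where
  "partial_deriv i h z = deriv (\<lambda>t. h (z + t *s axis i 1)) 0"

text \<open>
  Two germs have the same \<open>r\<close>-jet at \<open>0\<close> if all partial derivatives of order at most \<open>r\<close>
  of their components agree at \<open>0\<close>; the list \<open>is\<close> records the directions of
  differentiation.
\<close>

definition same_jet ::
    "nat \<Rightarrow> (complex^'n \<Rightarrow> complex^'p) \<Rightarrow> (complex^'n \<Rightarrow> complex^'p) \<Rightarrow> bool" where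
  "same_jet r f g \<longleftrightarrow>
     (\<forall>is j. length is \<le> r \<longrightarrow>
        foldr partial_deriv is (\<lambda>z. f z $ j) 0 = foldr partial_deriv is (\<lambda>z. g z $ j) 0)"

definition A_finite :: "(complex^'n \<Rightarrow> complex^'p) \<Rightarrow> bool" where
  "A_finite f \<longleftrightarrow> (\<exists>r. \<forall>g. map_germ g \<and> same_jet r f g \<longrightarrow> A_equivalent f g)"

definition singular_germ :: "(complex^'n \<Rightarrow> complex^'p) \<Rightarrow> bool" where
  "singular_germ f \<longleftrightarrow> rank (matrix (frechet_derivative f (at 0))) < CARD('n)"

text \<open>
  A component is a monomial \<open>c z\<^sub>1^a\<^sub>1 \<cdots> z\<^sub>n^a\<^sub>n\<close>; the zero component is the case \<open>c = 0\<close>.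
\<close>

definition monomial_germ :: "(complex^'n \<Rightarrow> complex^'p) \<Rightarrow> bool" where
  "monomial_germ f \<longleftrightarrow>
     (\<forall>j. \<exists>c a. \<forall>\<^sub>F z in nhds 0. f z $ j = c * (\<Prod>i\<in>UNIV. (z $ i) ^ a i))"


subsection \<open>The normal form\<close>

text \<open>
  The germ \<open>(I * \<phi>\<^sub>k)\<^sub>H (x, y) = (x, y^m\<^sub>1, \<dots>, y^m\<^sub>k, x\<^sub>1^\<lambda>\<^sub>1 y, \<dots>, x\<^sub>n\<^sub>-\<^sub>1^\<lambda>\<^sub>n\<^sub>-\<^sub>1 y)\<close>, where
  \<open>n = CARD('n)\<close>, and \<open>y\<close> is the last source coordinate. It is meant for
  \<open>CARD('p) = 2 * CARD('n) + k - 2\<close>.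
\<close>

definition I_phi_H ::
    "nat \<Rightarrow> (nat \<Rightarrow> nat) \<Rightarrow> (nat \<Rightarrow> nat) \<Rightarrow>
      complex^'n::{finite,linorder} \<Rightarrow> complex^'p::{finite,linorder}" where
  "I_phi_H k m l z =
     (let n = CARD('n); x = coord z; y = coord z n in
      of_coords (\<lambda>j.
        if j \<le> n - 1 then x j
        else if j \<le> n - 1 + k then y ^ m (j - (n - 1))
        else x (j - (n - 1 + k)) ^ l (j - (n - 1 + k)) * y))"

end

theory Submission
  imports Defs "HOL-Complex_Analysis.Cauchy_Integral_Formula"
begin

text \<open>
  Call the \<open>i\<close>-th axis bad for \<open>f\<close> if along it \<open>f\<close> identifies \<open>s\<close> with \<open>\<zeta> s\<close> for some
  \<open>\<zeta> \<noteq> 1\<close>, or \<open>df\<close> kills a fixed vector. If \<open>g\<close> is \<open>\<A>\<close>-equivalent to \<open>f\<close>, a bad axis of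
  \<open>f\<close> becomes a curve through \<open>0\<close> of double or non-immersive points of \<open>g\<close>. The normal form has
  no such points. Since \<open>p \<ge> 2 n\<close>, a generic perturbation of \<open>f\<close> of high order has none at points
  with a rational real coordinate, which every such curve meets. So a germ that is \<open>\<A>\<close>-finite or
  equivalent to the normal form has no bad axis. For a monomial germ this forces, for each
  \<open>i < n\<close>, a component \<open>x\<^sub>i\<^sup>\<lambda> y\<close> and pure powers of \<open>x\<^sub>i\<close> of coprime exponents; as only
  \<open>2 n - 2\<close> components are available, there is exactly one pure power, \<open>x\<^sub>i\<close> itself.

  Conversely, let \<open>f\<close> have components \<open>x\<^sub>i\<close>, \<open>x\<^sub>i\<^sup>\<lambda> y\<close> and \<open>y\<^sup>m\<close> with coprime exponents \<open>m\<close>. A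
  monomial \<open>x\<^sup>\<alpha> y\<^sup>b\<close> of high degree has \<open>b\<close> beyond the conductor of the numerical semigroup of the
  \<open>m\<close>, or some \<open>\<alpha>\<^sub>i\<close> that exceeds \<open>b \<lambda>\<close>, so it is a monomial in the components of \<open>f\<close>.
  Hence each component of \<open>g - f\<close>, where \<open>g\<close> has the same \<open>r\<close>-jet for large \<open>r\<close>, is
  \<open>\<Theta> \<circ> f\<close> with \<open>\<Theta>\<close> of order at least \<open>2\<close>, and \<open>g = (id + \<Theta>) \<circ> f\<close>.
\<close>


subsection \<open>Holomorphic function germs\<close>

text \<open>Pairs (z, w) form a space of real dimension 4n and g w = g z is a system of 2p >= 4n
  real equations, so a generic g may keep isolated double points; only curves of them can be
  excluded. Giving one real coordinate of z a rational value lowers the dimension below the number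
  of equations, and there are countably many rationals. So the bad parameters form a null set, and
  the structure of the double point locus never has to be studied. Pairs (z, u) with u in the kernel
  of dg are counted alike. The bound p >= 2n comes from k >= 2. In the other direction the obstacle
  is convergence: that monomials of high degree are products of components of f settles only formal
  series. Power series are therefore never rearranged. Cauchy integrals split a germ into finitely
  many terms, each an explicit monomial times a holomorphic function of x alone or of x and one
  power of y that is itself a component of f. Order at least 2 of the correction is secured by
  reserving the square of one component in every term.\<close>

definition cdiff_at :: "(complex^'n \<Rightarrow> complex) \<Rightarrow> complex^'n \<Rightarrow> bool" where
  "cdiff_at F z \<longleftrightarrow> (\<exists>D. (F has_derivative D) (at z) \<and> (\<forall>c v. D (c *s v) = c * D v))"

definition hol_germ :: "(complex^'n \<Rightarrow> complex) \<Rightarrow> bool" where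
  "hol_germ F \<longleftrightarrow> (\<forall>\<^sub>F z in nhds 0. cdiff_at F z)"

lemma cdiff_at_imp_isCont: "cdiff_at F z \<Longrightarrow> isCont F z"
  unfolding cdiff_at_def using has_derivative_continuous by blast

lemma cdiff_at_const [simp]: "cdiff_at (\<lambda>z. c) z"
  unfolding cdiff_at_def by (intro exI[of _ "\<lambda>_. 0"]) auto

lemma cdiff_at_coord [simp]: "cdiff_at (\<lambda>z. z $ i) z"
  unfolding cdiff_at_def
  by (intro exI[of _ "\<lambda>z. z $ i"]) (auto intro!: bounded_linear_imp_has_derivative bounded_linear_vec_nth)

lemma cdiff_at_add [intro]: "cdiff_at F z \<Longrightarrow> cdiff_at G z \<Longrightarrow> cdiff_at (\<lambda>z. F z + G z) z"
  unfolding cdiff_at_def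
  apply (elim exE conjE)
  subgoal for D E by (intro exI[of _ "\<lambda>v. D v + E v"]) (auto intro!: derivative_intros simp: algebra_simps)
  done

lemma cdiff_at_mult [intro]: "cdiff_at F z \<Longrightarrow> cdiff_at G z \<Longrightarrow> cdiff_at (\<lambda>z. F z * G z) z"
  unfolding cdiff_at_def
  apply (elim exE conjE)
  subgoal for D E by (intro exI[of _ "\<lambda>v. F z * E v + D v * G z"] conjI has_derivative_mult)
      (auto simp: algebra_simps)
  done

lemma cdiff_at_diff [intro]: "cdiff_at F z \<Longrightarrow> cdiff_at G z \<Longrightarrow> cdiff_at (\<lambda>z. F z - G z) z"
  using cdiff_at_add[of F z "\<lambda>z. (-1) * G z"] cdiff_at_mult[of "\<lambda>_. -1" z G] by simp

lemma cdiff_at_inverse [intro]: "cdiff_at F z \<Longrightarrow> F z \<noteq> 0 \<Longrightarrow> cdiff_at (\<lambda>z. inverse (F z)) z"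
  unfolding cdiff_at_def
  apply (elim exE conjE)
  subgoal for D
    by (intro exI[of _ "\<lambda>v. - (inverse (F z) * D v * inverse (F z))"] conjI Deriv.has_derivative_inverse)
      (auto simp: algebra_simps)
  done

lemma cdiff_at_divide [intro]:
  "cdiff_at F z \<Longrightarrow> cdiff_at G z \<Longrightarrow> G z \<noteq> 0 \<Longrightarrow> cdiff_at (\<lambda>z. F z / G z) z"
  by (simp add: divide_inverse cdiff_at_mult cdiff_at_inverse)

lemma has_derivative_vec_lambda:
  fixes f :: "'a::real_normed_vector \<Rightarrow> 'b::euclidean_space^'n"
  assumes "\<And>i. ((\<lambda>x. f x $ i) has_derivative (\<lambda>v. D v $ i)) (at x within S)"
  shows "(f has_derivative D) (at x within S)"
proof (subst has_derivative_componentwise_within, intro ballI)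
  fix b :: "'b^'n" assume "b \<in> Basis"
  then obtain i u where b: "b = axis i u" "u \<in> Basis"
    by (auto simp: Basis_vec_def)
  show "((\<lambda>x. f x \<bullet> b) has_derivative (\<lambda>x. D x \<bullet> b)) (at x within S)"
    using has_derivative_inner_left[OF assms[of i], of u] by (simp add: b inner_axis)
qed

lemma has_derivative_vec_nth:
  fixes f :: "'a::real_normed_vector \<Rightarrow> 'b::real_normed_vector^'n"
  shows "(f has_derivative D) F \<Longrightarrow> ((\<lambda>x. f x $ i) has_derivative (\<lambda>v. D v $ i)) F"
  by (rule bounded_linear.has_derivative[OF bounded_linear_vec_nth])

lemma complex_derivative_iff:
  fixes f :: "complex^'n \<Rightarrow> complex^'p"
  shows "(\<exists>D. (f has_derivative D) (at z) \<and> Vector_Spaces.linear (*s) (*s) D) \<longleftrightarrow>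
    (\<forall>j. cdiff_at (\<lambda>z. f z $ j) z)"
proof
  assume "\<exists>D. (f has_derivative D) (at z) \<and> Vector_Spaces.linear (*s) (*s) D"
  then obtain D where D: "(f has_derivative D) (at z)" "Vector_Spaces.linear (*s) (*s) D" by blast
  have "D (c *s v) $ j = c * D v $ j" for c v j
    using D(2) by (simp add: Vector_Spaces.linear_iff)
  then show "\<forall>j. cdiff_at (\<lambda>z. f z $ j) z"
    unfolding cdiff_at_def using has_derivative_vec_nth[OF D(1)] by blast
next
  assume "\<forall>j. cdiff_at (\<lambda>z. f z $ j) z"
  then obtain D where D: "\<And>j. ((\<lambda>z. f z $ j) has_derivative D j) (at z)"
      "\<And>j c v. D j (c *s v) = c * D j v"
    unfolding cdiff_at_def by metis
  show "\<exists>D. (f has_derivative D) (at z) \<and> Vector_Spaces.linear (*s) (*s) D"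
  proof (intro exI conjI)
    show "(f has_derivative (\<lambda>v. \<chi> j. D j v)) (at z)"
      using D(1) by (intro has_derivative_vec_lambda) auto
    have "D j (a + b) = D j a + D j b" for j a b
      using linear_add[OF has_derivative_linear[OF D(1)]] .
    then show "Vector_Spaces.linear (*s) (*s) (\<lambda>v. \<chi> j. D j v)"
      unfolding Vector_Spaces.linear_iff using D(2)
      by (auto simp: vec_eq_iff vector_space_def algebra_simps)
  qed
qed

lemma map_germ_iff: "map_germ f \<longleftrightarrow> f 0 = 0 \<and> (\<forall>j. hol_germ (\<lambda>z. f z $ j))"
  unfolding map_germ_def complex_derivative_iff hol_germ_def
  by (simp add: eventually_all_finite eventually_ball_finite_distrib
      eventually_ball_finite_distrib[of UNIV, simplified])

lemma cdiff_at_compose: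
  fixes G :: "complex^'p \<Rightarrow> complex^'n"
  assumes F: "cdiff_at F (G w)" and G: "\<And>j. cdiff_at (\<lambda>w. G w $ j) w"
  shows "cdiff_at (\<lambda>w. F (G w)) w"
proof -
  obtain E where E: "(G has_derivative E) (at w)" "Vector_Spaces.linear (*s) (*s) E"
    using complex_derivative_iff[of G w] G by blast
  obtain D where D: "(F has_derivative D) (at (G w))" "\<And>c v. D (c *s v) = c * D v"
    using F unfolding cdiff_at_def by blast
  show ?thesis
    unfolding cdiff_at_def
  proof (intro exI conjI)
    show "((\<lambda>w. F (G w)) has_derivative (\<lambda>v. D (E v))) (at w)"
      using has_derivative_compose[OF E(1) D(1)] .
    show "\<forall>c v. D (E (c *s v)) = c * D (E v)"
      using D(2) E(2) by (simp add: Vector_Spaces.linear_iff)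
  qed
qed

text \<open>Restriction to complex lines gives access to the one-variable theory:
  \<open>deriv\<close>, \<open>holomorphic_on\<close> and Cauchy integrals enter through it.\<close>

lemma has_field_derivative_line:
  fixes F :: "complex^'n \<Rightarrow> complex"
  assumes F: "(F has_derivative D) (at (z + t *s v))" and D: "\<And>c v. D (c *s v) = c * D v"
  shows "((\<lambda>t. F (z + t *s v)) has_field_derivative D v) (at t)"
proof -
  have "bounded_linear (\<lambda>t::complex. t *s v)"
    unfolding linear_conv_bounded_linear[symmetric]
    by (intro linearI) (auto simp: vec_eq_iff algebra_simps scaleR_conv_of_real[where 'a = complex])
  then have 1: "((\<lambda>t. z + t *s v) has_derivative (\<lambda>t. t *s v)) (at t)"
    by (auto intro!: derivative_eq_intros bounded_linear_imp_has_derivative)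
  have "((\<lambda>t. F (z + t *s v)) has_derivative (\<lambda>t. D (t *s v))) (at t)"
    by (rule has_derivative_compose[OF 1 F])
  then show ?thesis
    unfolding has_field_derivative_def by (simp add: D mult.commute[of _ "D v"] fun_eq_iff)
qed


subsection \<open>Cauchy integrals with parameters\<close>

definition circ :: "real \<Rightarrow> real \<Rightarrow> complex" where
  "circ r s = of_real r * exp (2 * of_real pi * \<i> * of_real s)"

text \<open>This is the contour integral of phi(zeta) / zeta, divided by 2 pi i. It is written as an
  integral over a real box so that the Leibniz rule for parameters applies.\<close>

definition circle_mean :: "real \<Rightarrow> (complex \<Rightarrow> complex) \<Rightarrow> complex" where
  "circle_mean r \<phi> = integral (cbox 0 1) (\<lambda>s. \<phi> (circ r s))"

lemma norm_circ [simp]: "norm (circ r s) = \<bar>r\<bar>"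
  by (simp add: circ_def norm_mult)

lemma circ_nonzero [simp]: "r > 0 \<Longrightarrow> circ r s \<noteq> 0"
  by (simp add: circ_def)

lemma continuous_on_circ [continuous_intros]:
  "continuous_on S f \<Longrightarrow> continuous_on S (\<lambda>x. circ r (f x))"
  unfolding circ_def by (intro continuous_intros)

lemma circle_mean_cong:
  "r > 0 \<Longrightarrow> (\<And>\<zeta>. norm \<zeta> = r \<Longrightarrow> \<phi> \<zeta> = \<psi> \<zeta>) \<Longrightarrow> circle_mean r \<phi> = circle_mean r \<psi>"
  unfolding circle_mean_def by (intro integral_cong) auto

lemma contour_integral_circlepath_mean:
  "contour_integral (circlepath 0 r) \<phi> = 2 * of_real pi * \<i> * circle_mean r (\<lambda>\<zeta>. \<phi> \<zeta> * \<zeta>)"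
proof -
  have "contour_integral (circlepath 0 r) \<phi> =
      integral {0..1} (\<lambda>s. 2 * of_real pi * \<i> * (\<phi> (circ r s) * circ r s))"
    unfolding contour_integral_integral vector_derivative_circlepath
    by (intro integral_cong) (simp add: circlepath circ_def)
  then show ?thesis
    by (simp add: circle_mean_def)
qed

lemma circle_mean_Cauchy:
  assumes "\<phi> holomorphic_on cball 0 r" "norm y < r"
  shows "circle_mean r (\<lambda>\<zeta>. \<phi> \<zeta> * (\<zeta> / (\<zeta> - y))) = \<phi> y"
proof -
  have "2 * of_real pi * \<i> * \<phi> y = contour_integral (circlepath 0 r) (\<lambda>u. \<phi> u / (u - y))"
    using Cauchy_integral_circlepath_simple[of \<phi> 0 r y] assms contour_integral_unique by force
  then show ?thesis
    by (simp add: contour_integral_circlepath_mean)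
qed

lemma circle_mean_deriv:
  assumes "\<phi> holomorphic_on cball 0 r" "r > 0"
  shows "circle_mean r (\<lambda>\<zeta>. \<phi> \<zeta> / \<zeta> ^ k) = (deriv ^^ k) \<phi> 0 / fact k"
proof -
  have "((\<lambda>u. \<phi> u / (u - 0) ^ (Suc k)) has_contour_integral
      ((2 * pi * \<i>) / (fact k) * (deriv ^^ k) \<phi> 0)) (circlepath 0 r)"
    using assms by (intro Cauchy_has_contour_integral_higher_derivative_circlepath
        holomorphic_on_imp_continuous_on) (auto intro: holomorphic_on_subset)
  then have "2 * of_real pi * \<i> * ((deriv ^^ k) \<phi> 0 / fact k) =
      contour_integral (circlepath 0 r) (\<lambda>u. \<phi> u / u ^ Suc k)"
    by (auto dest!: contour_integral_unique simp: field_simps)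
  also have "\<dots> = 2 * of_real pi * \<i> * circle_mean r (\<lambda>\<zeta>. \<phi> \<zeta> / \<zeta> ^ k)"
    unfolding contour_integral_circlepath_mean using assms(2)
    by (subst circle_mean_cong[of r _ "\<lambda>\<zeta>. \<phi> \<zeta> / \<zeta> ^ k"]) auto
  finally show ?thesis
    by (subst (asm) mult_cancel_left) simp
qed

lemma continuous_on_scalar_vec [continuous_intros]:
  fixes f :: "'a::topological_space \<Rightarrow> complex" and g :: "'a \<Rightarrow> complex^'n"
  shows "continuous_on S f \<Longrightarrow> continuous_on S g \<Longrightarrow> continuous_on S (\<lambda>x. f x *s g x)"
  unfolding vector_scalar_mult_def by (intro continuous_intros)

lemma norm_scalar_vec: "norm (c *s v) = norm c * norm (v :: complex^'n)"
  by (simp add: norm_vec_def L2_set_def norm_mult power_mult_distrib real_sqrt_mult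
      flip: sum_distrib_left)

text \<open>
  Cauchy's formula expresses the derivative in each direction as an integral of \<open>\<Phi>\<close>, so
  continuity of \<open>\<Phi>\<close> alone gives joint continuity of the derivative.
\<close>

lemma continuous_complex_derivative:
  fixes \<Phi> :: "complex^'n \<Rightarrow> real \<Rightarrow> complex"
  assumes U: "open U" and cont: "continuous_on (U \<times> cbox a b) (\<lambda>(w, t). \<Phi> w t)"
    and hol: "\<And>w t. w \<in> U \<Longrightarrow> t \<in> cbox a b \<Longrightarrow> cdiff_at (\<lambda>w. \<Phi> w t) w"
  obtains \<Phi>' :: "complex^'n \<Rightarrow> real \<Rightarrow> ((complex^'n) \<Rightarrow>\<^sub>L complex)"
  where "\<And>w t. w \<in> U \<Longrightarrow> t \<in> cbox a b \<Longrightarrow> ((\<lambda>w. \<Phi> w t) has_derivative \<Phi>' w t) (at w)"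
    and "\<And>w t c v. w \<in> U \<Longrightarrow> t \<in> cbox a b \<Longrightarrow> \<Phi>' w t (c *s v) = c * \<Phi>' w t v"
    and "continuous_on (U \<times> cbox a b) (\<lambda>(w, t). \<Phi>' w t)"
proof -
  let ?T = "cbox a b"
  obtain D where D: "\<And>w t. w \<in> U \<Longrightarrow> t \<in> ?T \<Longrightarrow> ((\<lambda>w. \<Phi> w t) has_derivative D w t) (at w)"
    and lin: "\<And>w t c v. w \<in> U \<Longrightarrow> t \<in> ?T \<Longrightarrow> D w t (c *s v) = c * D w t v"
    using hol unfolding cdiff_at_def by metis
  define \<Phi>' where "\<Phi>' w t = Blinfun (D w t)" for w t
  have app: "blinfun_apply (\<Phi>' w t) = D w t" if "w \<in> U" "t \<in> ?T" for w t
    unfolding \<Phi>'_def using D[OF that] has_derivative_bounded_linear bounded_linear_Blinfun_apply by blast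
  have cont_v: "continuous_on (U \<times> ?T) (\<lambda>x. D (fst x) (snd x) v)" if v: "norm v = 1" for v
    unfolding continuous_on_eq_continuous_within
  proof
    fix x assume x: "x \<in> U \<times> ?T"
    then obtain e where e: "e > 0" "ball (fst x) e \<subseteq> U"
      using U by (metis mem_Times_iff open_contains_ball)
    define d where "d = e / 2"
    let ?V = "ball (fst x) d"
    have d: "d > 0" "d < e" using e by (auto simp: d_def)
    have sub: "w + \<eta> *s v \<in> U" if "w \<in> ?V" "norm \<eta> \<le> d" for w \<eta>
    proof -
      have "dist (fst x) (w + \<eta> *s v) \<le> dist (fst x) w + norm (\<eta> *s v)"
        by norm
      also have "\<dots> < e"
        using that by (auto simp: norm_scalar_vec v d_def)
      finally show ?thesis using e by auto
    qed
    have eq: "D w t v = circle_mean d (\<lambda>\<eta>. \<Phi> (w + \<eta> *s v) t / \<eta>)" if "w \<in> ?V" "t \<in> ?T" for w t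
    proof -
      have der: "((\<lambda>\<eta>. \<Phi> (w + \<eta> *s v) t) has_field_derivative D (w + \<eta> *s v) t v) (at \<eta>)"
        if "norm \<eta> \<le> d" for \<eta>
        using that \<open>w \<in> ?V\<close> \<open>t \<in> ?T\<close> D lin sub by (intro has_field_derivative_line) auto
      then have "(\<lambda>\<eta>. \<Phi> (w + \<eta> *s v) t) holomorphic_on cball 0 d"
        by (force simp: holomorphic_on_def field_differentiable_def intro: DERIV_subset)
      then have "circle_mean d (\<lambda>\<eta>. \<Phi> (w + \<eta> *s v) t / \<eta> ^ 1) = deriv (\<lambda>\<eta>. \<Phi> (w + \<eta> *s v) t) 0"
        using circle_mean_deriv[of _ d 1] d by simp
      moreover have "deriv (\<lambda>\<eta>. \<Phi> (w + \<eta> *s v) t) 0 = D w t v"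
        using DERIV_imp_deriv[OF der[of 0]] d by simp
      ultimately show ?thesis by simp
    qed
    have "continuous_on (?V \<times> ?T)
       (\<lambda>x. integral (cbox 0 1) (\<lambda>s. \<Phi> (fst x + circ d s *s v) (snd x) / circ d s))"
    proof (rule integral_continuous_on_param)
      have "continuous_on ((?V \<times> ?T) \<times> cbox 0 1)
          (\<lambda>p. (\<lambda>(w, t). \<Phi> w t) (fst (fst p) + circ d (snd p) *s v, snd (fst p)))"
        using d by (intro continuous_on_compose2[OF cont] continuous_intros) (auto intro!: sub)
      then have "continuous_on ((?V \<times> ?T) \<times> cbox 0 1)
          (\<lambda>p. \<Phi> (fst (fst p) + circ d (snd p) *s v) (snd (fst p)) / circ d (snd p))"
        using d by (auto intro!: continuous_intros)
      then show "continuous_on ((?V \<times> ?T) \<times> cbox 0 1)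
          (\<lambda>(x, s). \<Phi> (fst x + circ d s *s v) (snd x) / circ d s)"
        by (simp add: case_prod_unfold)
    qed
    then have "continuous_on (?V \<times> ?T) (\<lambda>x. D (fst x) (snd x) v)"
      by (rule continuous_on_eq) (auto simp: eq circle_mean_def)
    then have "continuous (at x within ?V \<times> ?T) (\<lambda>x. D (fst x) (snd x) v)"
      unfolding continuous_on_eq_continuous_within using x d by (elim bspec) (auto simp: mem_Times_iff)
    moreover have "at x within ?V \<times> ?T = at x within U \<times> ?T"
      using x d e by (intro at_within_nhd[of _ "?V \<times> UNIV"]) (auto simp: mem_Times_iff open_Times)
    ultimately show "continuous (at x within U \<times> ?T) (\<lambda>x. D (fst x) (snd x) v)"
      by simp
  qed
  show thesis
  proof
    \<comment> \<open>Continuity into the finite-dimensional operator space is checked on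
      \<open>Basis\<close>, whose vectors have norm 1 as \<open>cont_v\<close> requires.\<close>
    have "continuous_on (U \<times> ?T) (\<lambda>x. \<Phi>' (fst x) (snd x) v)" if "v \<in> Basis" for v
      using that by (intro continuous_on_eq[OF cont_v]) (auto simp: app)
    then show "continuous_on (U \<times> ?T) (\<lambda>(w, t). \<Phi>' w t)"
      unfolding case_prod_unfold by (rule continuous_on_blinfun_componentwise)
  qed (use D lin app in auto)
qed

text \<open>Differentiation under the integral sign: the jointly continuous derivative comes from
  \<open>continuous_complex_derivative\<close>, and complex homogeneity passes through the
  integral.\<close>

lemma cdiff_at_integral:
  fixes \<Phi> :: "complex^'n \<Rightarrow> real \<Rightarrow> complex"
  assumes U: "open U" "convex U" and cont: "continuous_on (U \<times> cbox a b) (\<lambda>(w, t). \<Phi> w t)"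
    and hol: "\<And>w t. w \<in> U \<Longrightarrow> t \<in> cbox a b \<Longrightarrow> cdiff_at (\<lambda>w. \<Phi> w t) w" and w: "w \<in> U"
  shows "cdiff_at (\<lambda>w. integral (cbox a b) (\<Phi> w)) w"
proof -
  obtain \<Phi>' :: "complex^'n \<Rightarrow> real \<Rightarrow> ((complex^'n) \<Rightarrow>\<^sub>L complex)"
  where D: "\<And>w t. w \<in> U \<Longrightarrow> t \<in> cbox a b \<Longrightarrow> ((\<lambda>w. \<Phi> w t) has_derivative \<Phi>' w t) (at w)"
    and lin: "\<And>w t c v. w \<in> U \<Longrightarrow> t \<in> cbox a b \<Longrightarrow> \<Phi>' w t (c *s v) = c * \<Phi>' w t v"
    and cont': "continuous_on (U \<times> cbox a b) (\<lambda>(w, t). \<Phi>' w t)"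
    using continuous_complex_derivative[OF U(1) cont hol] by blast
  have Pair: "continuous_on (cbox a b) (Pair w)" for w :: "complex^'n"
    by (intro continuous_on_Pair[OF continuous_on_const continuous_on_id])
  have int: "\<Phi> w integrable_on cbox a b" if "w \<in> U" for w
    using continuous_on_compose2[OF cont, of "cbox a b" "\<lambda>t. (w, t)"] that Pair[of w]
    by (intro integrable_continuous) auto
  have int': "\<Phi>' w integrable_on cbox a b"
    using continuous_on_compose2[OF cont', of "cbox a b" "\<lambda>t. (w, t)"] w Pair[of w]
    by (intro integrable_continuous) auto
  have app: "blinfun_apply (integral (cbox a b) (\<Phi>' w)) v = integral (cbox a b) (\<lambda>t. \<Phi>' w t v)" for v
    using integral_linear[OF int' blinfun.bounded_linear_left[of v]] by (simp add: o_def)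
  have "((\<lambda>w. integral (cbox a b) (\<Phi> w)) has_derivative integral (cbox a b) (\<Phi>' w)) (at w within U)"
    using D by (intro leibniz_rule[OF _ int cont' w U(2)]) (auto intro: has_derivative_at_withinI)
  then have "((\<lambda>w. integral (cbox a b) (\<Phi> w)) has_derivative integral (cbox a b) (\<Phi>' w)) (at w)"
    using at_within_open[OF w U(1)] by simp
  moreover have "integral (cbox a b) (\<Phi>' w) (c *s v) = c * integral (cbox a b) (\<Phi>' w) v" for c v
    unfolding app by (subst integral_mult_right[symmetric], rule integral_cong) (use lin[OF w] in simp)
  ultimately show ?thesis
    unfolding cdiff_at_def by blast
qed

lemma cdiff_at_circle_mean:
  fixes \<Phi> :: "complex^'n \<Rightarrow> complex \<Rightarrow> complex"
  assumes U: "open U" "convex U" and r: "r > 0"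
    and cont: "continuous_on (U \<times> sphere 0 r) (\<lambda>(w, \<zeta>). \<Phi> w \<zeta>)"
    and hol: "\<And>w \<zeta>. w \<in> U \<Longrightarrow> norm \<zeta> = r \<Longrightarrow> cdiff_at (\<lambda>w. \<Phi> w \<zeta>) w" and w: "w \<in> U"
  shows "cdiff_at (\<lambda>w. circle_mean r (\<Phi> w)) w"
  unfolding circle_mean_def
proof (rule cdiff_at_integral[OF U _ _ w])
  have "continuous_on (U \<times> cbox 0 1) (\<lambda>p. (\<lambda>(w, \<zeta>). \<Phi> w \<zeta>) (fst p, circ r (snd p)))"
    using r by (intro continuous_on_compose2[OF cont] continuous_intros) auto
  then show "continuous_on (U \<times> cbox 0 1) (\<lambda>(w, t). \<Phi> w (circ r t))"
    by (simp add: case_prod_unfold)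
qed (use hol r in auto)

text \<open>Holomorphic maps are continuously differentiable, here in the operator-valued form that
  the inverse function theorem takes as input.\<close>

lemma continuous_blinfun_derivative:
  fixes f :: "complex^'n \<Rightarrow> complex^'p"
  assumes U: "open U" and hol: "\<And>w j. w \<in> U \<Longrightarrow> cdiff_at (\<lambda>w. f w $ j) w"
  obtains f' :: "complex^'n \<Rightarrow> ((complex^'n) \<Rightarrow>\<^sub>L (complex^'p))"
  where "\<And>w. w \<in> U \<Longrightarrow> (f has_derivative f' w) (at w)"
    and "\<And>w. w \<in> U \<Longrightarrow> Vector_Spaces.linear (*s) (*s) (f' w)"
    and "continuous_on U f'"
proof -
  have "\<exists>F' :: complex^'n \<Rightarrow> ((complex^'n) \<Rightarrow>\<^sub>L complex). continuous_on U F' \<and>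
      (\<forall>w\<in>U. ((\<lambda>w. f w $ j) has_derivative blinfun_apply (F' w)) (at w) \<and>
        (\<forall>c v. blinfun_apply (F' w) (c *s v) = c * blinfun_apply (F' w) v))" for j
  proof -
    have "continuous_on U (\<lambda>w. f w $ j)"
      using hol cdiff_at_imp_isCont by (intro continuous_at_imp_continuous_on) blast
    \<comment> \<open>The parametric result is reused with the one-point parameter box
      \<open>cbox 0 0\<close>.\<close>
    then have c0: "continuous_on (U \<times> cbox 0 0) (\<lambda>(w, t::real). f w $ j)"
      unfolding case_prod_unfold
      by (rule continuous_on_compose2[of U _ _ fst]) (auto intro!: continuous_intros)
    obtain \<Phi>' :: "complex^'n \<Rightarrow> real \<Rightarrow> ((complex^'n) \<Rightarrow>\<^sub>L complex)"
    where *: "\<And>w t. w \<in> U \<Longrightarrow> t \<in> cbox 0 0 \<Longrightarrow> ((\<lambda>w. f w $ j) has_derivative \<Phi>' w t) (at w)"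
      "\<And>w t c v. w \<in> U \<Longrightarrow> t \<in> cbox 0 0 \<Longrightarrow> \<Phi>' w t (c *s v) = c * \<Phi>' w t v"
      "continuous_on (U \<times> cbox 0 0) (\<lambda>(w, t). \<Phi>' w t)"
      using continuous_complex_derivative[OF U c0] hol by blast
    have "continuous_on U (\<lambda>w. (w, 0::real))"
      by (intro continuous_on_Pair continuous_on_id continuous_on_const)
    then have "continuous_on U (\<lambda>w. \<Phi>' w 0)"
      using continuous_on_compose2[OF *(3), of U "\<lambda>w. (w, 0)"] by auto
    then show ?thesis
      using *(1,2) by (intro exI[of _ "\<lambda>w. \<Phi>' w 0"]) auto
  qed
  then obtain F' :: "'p \<Rightarrow> complex^'n \<Rightarrow> ((complex^'n) \<Rightarrow>\<^sub>L complex)"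
    where F': "\<And>j. continuous_on U (F' j)"
    "\<And>j w. w \<in> U \<Longrightarrow> ((\<lambda>w. f w $ j) has_derivative blinfun_apply (F' j w)) (at w)"
    "\<And>j w c v. w \<in> U \<Longrightarrow> blinfun_apply (F' j w) (c *s v) = c * blinfun_apply (F' j w) v"
    by metis
  define D where "D w v = (\<chi> j. F' j w v)" for w v
  have D: "(f has_derivative D w) (at w)" if "w \<in> U" for w
    using F'(2)[OF that] by (intro has_derivative_vec_lambda) (auto simp: D_def)
  define f' where "f' w = Blinfun (D w)" for w
  have app: "blinfun_apply (f' w) = D w" if "w \<in> U" for w
    unfolding f'_def using D[OF that] has_derivative_bounded_linear bounded_linear_Blinfun_apply by blast
  show thesis
  proof
    show "(f has_derivative f' w) (at w)" if "w \<in> U" for w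
      using D that by (simp add: app)
    show "Vector_Spaces.linear (*s) (*s) (f' w)" if "w \<in> U" for w
      unfolding app[OF that] Vector_Spaces.linear_iff D_def using F'(3)[OF that]
      by (auto simp: vec_eq_iff vector_space_def algebra_simps blinfun.add_right)
    have "continuous_on U (\<lambda>w. D w v)" for v
      unfolding D_def using F'(1) by (intro continuous_intros) auto
    then have "continuous_on U (\<lambda>w. f' w v)" for v
      by (rule continuous_on_eq) (auto simp: app)
    then show "continuous_on U f'"
      by (intro continuous_on_blinfun_componentwise)
  qed
qed

section \<open>Substituting a value for one coordinate\<close>

definition upd :: "complex^'n \<Rightarrow> 'n \<Rightarrow> complex \<Rightarrow> complex^'n" where
  "upd z i t = (\<chi> j. if j = i then t else z $ j)"

lemma upd_nth [simp]: "upd z i t $ j = (if j = i then t else z $ j)"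
  by (simp add: upd_def)

lemma upd_same [simp]: "upd z i (z $ i) = z"
  by (simp add: vec_eq_iff)

lemma upd_upd [simp]: "upd (upd z i s) i t = upd z i t"
  by (simp add: vec_eq_iff)

lemma axis_eq_scalar: "axis i t = t *s axis i (1::complex)"
  by (simp add: vec_eq_iff axis_def)

lemma norm_upd: "norm (upd z i t) \<le> norm z + norm t"
proof -
  have "upd z i t = upd z i 0 + axis i t"
    by (simp add: vec_eq_iff axis_def)
  moreover have "norm (upd z i 0) \<le> norm z"
    by (rule norm_le_componentwise_cart) simp
  moreover have "norm (axis i t) = norm t"
    by (subst axis_eq_scalar) (simp add: norm_scalar_vec)
  ultimately show ?thesis
    using norm_triangle_ineq[of "upd z i 0" "axis i t"] by simp
qed

lemma continuous_on_upd [continuous_intros]: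
  fixes f :: "'a::topological_space \<Rightarrow> complex^'n"
  assumes "continuous_on S f" "continuous_on S g"
  shows "continuous_on S (\<lambda>x. upd (f x) i (g x))"
  unfolding upd_def
proof (intro continuous_on_vec_lambda)
  show "continuous_on S (\<lambda>x. if j = i then g x else f x $ j)" for j
    using assms by (cases "j = i") (auto intro!: continuous_intros)
qed

lemma upd_plus_axis: "upd z i s + t *s axis i 1 = upd z i (s + t)"
  by (auto simp: vec_eq_iff axis_def)

section \<open>Closure properties of holomorphic germs\<close>

lemma hol_germ_ball:
  assumes "hol_germ F"
  obtains e where "e > 0" "\<And>z. norm z < e \<Longrightarrow> cdiff_at F z"
proof -
  obtain e where "e > 0" "\<forall>z. dist z 0 < e \<longrightarrow> cdiff_at F z"
    using assms unfolding hol_germ_def eventually_nhds_metric by blast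
  then show thesis
    by (intro that[of e]) (auto simp: dist_norm)
qed

lemma hol_germI: "e > 0 \<Longrightarrow> (\<And>z. norm z < e \<Longrightarrow> cdiff_at F z) \<Longrightarrow> hol_germ F"
  unfolding hol_germ_def eventually_nhds_metric by (auto simp: dist_norm)

lemma eventually_nhds_0I:
  "e > 0 \<Longrightarrow> (\<And>z. norm z < e \<Longrightarrow> P z) \<Longrightarrow> \<forall>\<^sub>F z in nhds (0::'a::real_normed_vector). P z"
  unfolding eventually_nhds_metric by (auto simp: dist_norm)

lemma cdiff_at_cong:
  assumes "\<forall>\<^sub>F w in nhds z. F w = G w"
  shows "cdiff_at F z \<longleftrightarrow> cdiff_at G z"
proof -
  have "cdiff_at G z" if "cdiff_at F z" "\<forall>\<^sub>F w in nhds z. F w = G w" for F G :: "complex^'a \<Rightarrow> complex"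
  proof -
    obtain D where D: "(F has_derivative D) (at z)" "\<forall>c v. D (c *s v) = c * D v"
      using \<open>cdiff_at F z\<close> unfolding cdiff_at_def by blast
    have "(G has_derivative D) (at z)"
      using that(2) by (intro has_derivative_transform_eventually[OF D(1)])
        (auto simp: eventually_at_filter elim: eventually_mono dest: eventually_nhds_x_imp_x)
    with D(2) show ?thesis unfolding cdiff_at_def by blast
  qed
  from this[of F G] this[of G F] show ?thesis
    using assms by (auto simp: eq_commute)
qed

lemma hol_germ_const [simp]: "hol_germ (\<lambda>z. c)"
  and hol_germ_coord [simp]: "hol_germ (\<lambda>z. z $ i)"
  by (simp_all add: hol_germ_def)

lemma
  assumes "hol_germ F" "hol_germ G"
  shows hol_germ_add [intro]: "hol_germ (\<lambda>z. F z + G z)"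
    and hol_germ_diff [intro]: "hol_germ (\<lambda>z. F z - G z)"
    and hol_germ_mult [intro]: "hol_germ (\<lambda>z. F z * G z)"
proof -
  have "\<forall>\<^sub>F z in nhds 0. cdiff_at F z \<and> cdiff_at G z"
    using assms unfolding hol_germ_def by (rule eventually_conj)
  then show "hol_germ (\<lambda>z. F z + G z)" "hol_germ (\<lambda>z. F z - G z)" "hol_germ (\<lambda>z. F z * G z)"
    unfolding hol_germ_def by (auto elim!: eventually_mono)
qed

lemma hol_germ_power [intro]: "hol_germ F \<Longrightarrow> hol_germ (\<lambda>z. F z ^ k)"
  by (induction k) auto

lemma hol_germ_sum [intro]: "(\<And>i. i \<in> I \<Longrightarrow> hol_germ (F i)) \<Longrightarrow> hol_germ (\<lambda>z. \<Sum>i\<in>I. F i z)"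
  by (induction I rule: infinite_finite_induct) auto

lemma hol_germ_isCont: "hol_germ F \<Longrightarrow> isCont F 0"
  unfolding hol_germ_def by (auto dest: eventually_nhds_x_imp_x cdiff_at_imp_isCont)

lemma map_germ_filterlim:
  assumes "map_germ f" shows "filterlim f (nhds 0) (nhds 0)"
proof -
  have "((\<lambda>z. f z $ j) \<longlongrightarrow> f 0 $ j) (at 0)" for j
    using hol_germ_isCont[of "\<lambda>z. f z $ j"] assms unfolding map_germ_iff isCont_def by blast
  then have "(f \<longlongrightarrow> f 0) (at 0)"
    by (rule vec_tendstoI)
  then show ?thesis
    using assms by (simp add: tendsto_at_iff_tendsto_nhds map_germ_def)
qed

lemma hol_germ_compose:
  assumes "hol_germ F" "map_germ G"
  shows "hol_germ (\<lambda>w. F (G w))"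
proof -
  have 1: "\<forall>\<^sub>F w in nhds 0. cdiff_at F (G w)"
    using assms(1) map_germ_filterlim[OF assms(2)] unfolding hol_germ_def filterlim_iff by blast
  have "\<forall>\<^sub>F w in nhds 0. \<forall>j. cdiff_at (\<lambda>w. G w $ j) w"
    using assms(2) unfolding map_germ_def complex_derivative_iff by blast
  with 1 show ?thesis
    unfolding hol_germ_def by eventually_elim (auto intro: cdiff_at_compose[where F = F])
qed

text \<open>A partial derivative is a Cauchy mean over a circle of fixed radius, hence an integral
  whose integrand depends holomorphically on the centre.\<close>

lemma cdiff_at_partial_deriv:
  assumes "\<forall>\<^sub>F w in nhds z. cdiff_at F w"
  shows "cdiff_at (partial_deriv i F) z"
proof -
  obtain e where e: "e > 0" "\<And>w. dist w z < e \<Longrightarrow> cdiff_at F w"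
    using assms unfolding eventually_nhds_metric by blast
  define d where "d = e / 2"
  have d: "d > 0" using e by (simp add: d_def)
  have sub: "dist (w + \<zeta> *s axis i 1) z < e" if "w \<in> ball z d" "norm \<zeta> \<le> d" for w \<zeta>
  proof -
    have "dist (w + \<zeta> *s axis i 1) z \<le> dist z w + norm (\<zeta> *s axis i (1::complex))"
      by norm
    also have "\<dots> < e"
      using that by (auto simp: norm_scalar_vec d_def)
    finally show ?thesis .
  qed
  have eq: "partial_deriv i F w = circle_mean d (\<lambda>\<zeta>. F (w + \<zeta> *s axis i 1) / \<zeta>)" if w: "w \<in> ball z d" for w
  proof -
    have "\<exists>D. ((\<lambda>\<zeta>. F (w + \<zeta> *s axis i 1)) has_field_derivative D) (at \<zeta>)" if "norm \<zeta> \<le> d" for \<zeta>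
      using e(2)[OF sub[OF w that]] has_field_derivative_line unfolding cdiff_at_def by blast
    then have "(\<lambda>\<zeta>. F (w + \<zeta> *s axis i 1)) holomorphic_on cball 0 d"
      by (force simp: holomorphic_on_def field_differentiable_def intro: DERIV_subset)
    from circle_mean_deriv[OF this d, of 1] show ?thesis
      by (simp add: partial_deriv_def)
  qed
  have contF: "continuous_on (ball z e) F"
    using e by (intro continuous_at_imp_continuous_on) (auto simp: dist_commute intro: cdiff_at_imp_isCont)
  have "cdiff_at (\<lambda>w. circle_mean d (\<lambda>\<zeta>. F (w + \<zeta> *s axis i 1) / \<zeta>)) z"
  proof (rule cdiff_at_circle_mean[of "ball z d"])
    show "continuous_on (ball z d \<times> sphere 0 d) (\<lambda>(w, \<zeta>). F (w + \<zeta> *s axis i 1) / \<zeta>)"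
      using d sub by (auto simp: case_prod_unfold dist_commute
          intro!: continuous_intros continuous_on_compose2[OF contF])
    fix w :: "complex^'a" and \<zeta> :: complex assume w: "w \<in> ball z d" and \<zeta>: "norm \<zeta> = d"
    have "cdiff_at (\<lambda>w. F (w + \<zeta> *s axis i 1)) w"
      using e(2)[OF sub[OF w]] \<zeta>
      by (intro cdiff_at_compose[where F = F and G = "\<lambda>w. w + \<zeta> *s axis i 1"]) auto
    moreover have "\<zeta> \<noteq> 0" using d \<zeta> by auto
    ultimately show "cdiff_at (\<lambda>w. F (w + \<zeta> *s axis i 1) / \<zeta>) w" by auto
  qed (use d in auto)
  moreover have "\<forall>\<^sub>F w in nhds z. partial_deriv i F w = circle_mean d (\<lambda>\<zeta>. F (w + \<zeta> *s axis i 1) / \<zeta>)"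
    using d eq unfolding eventually_nhds_metric by (auto simp: dist_commute)
  ultimately show ?thesis
    by (rule cdiff_at_cong[THEN iffD2, rotated])
qed

lemma hol_germ_partial_deriv: "hol_germ F \<Longrightarrow> hol_germ (partial_deriv i F)"
  unfolding hol_germ_def by (subst (asm) eventually_eventually[symmetric])
    (auto elim!: eventually_mono intro: cdiff_at_partial_deriv)

lemma hol_germ_foldr_partial_deriv: "hol_germ F \<Longrightarrow> hol_germ (foldr partial_deriv is F)"
  by (induction "is") (auto intro: hol_germ_partial_deriv)

lemma hol_germ_funpow_partial_deriv: "hol_germ F \<Longrightarrow> hol_germ ((partial_deriv i ^^ b) F)"
  by (induction b) (auto intro: hol_germ_partial_deriv)

text \<open>Both sides iterate \<open>deriv\<close> on the same restriction to a coordinate line, up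
  to a translation of the parameter. This identifies the coefficients delivered by Cauchy's formula
  as iterated partial derivatives.\<close>

lemma deriv_funpow_upd:
  "(deriv ^^ b) (\<lambda>t. F (upd z i t)) = (\<lambda>t. (partial_deriv i ^^ b) F (upd z i t))"
proof (induction b)
  case (Suc b)
  have "deriv (\<lambda>t. G (upd z i t)) s = partial_deriv i G (upd z i s)" for G s
    using deriv_shift_0[of "\<lambda>t. G (upd z i t)" s]
    by (simp add: partial_deriv_def upd_plus_axis o_def)
  with Suc show ?case by auto
qed auto

lemma holomorphic_on_upd:
  assumes "\<And>t. t \<in> S \<Longrightarrow> cdiff_at F (upd z i t)"
  shows "(\<lambda>t. F (upd z i t)) holomorphic_on S"
proof -
  have "\<exists>D. ((\<lambda>t. F (upd z i t)) has_field_derivative D) (at s)" if "s \<in> S" for s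
  proof -
    have "cdiff_at F (upd z i 0 + s *s axis i 1)"
      using assms[OF that] by (simp add: upd_plus_axis)
    then obtain D where "(F has_derivative D) (at (upd z i 0 + s *s axis i 1))" "\<And>c v. D (c *s v) = c * D v"
      unfolding cdiff_at_def by blast
    from has_field_derivative_line[OF this] show ?thesis
      by (auto simp: upd_plus_axis)
  qed
  then show ?thesis
    by (force simp: holomorphic_on_def field_differentiable_def intro: DERIV_subset)
qed

lemma cdiff_at_upd:
  assumes "cdiff_at F (upd w i t)"
  shows "cdiff_at (\<lambda>w. F (upd w i t)) w"
  using assms
proof (rule cdiff_at_compose)
  show "cdiff_at (\<lambda>w. upd w i t $ j) w" for j
    by (cases "j = i") auto
qed

text \<open>Common core of the two division lemmas, which differ only in the kernel
  \<open>K\<close>. As \<open>upd w i \<zeta>\<close> overwrites the i-th coordinate, that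
  coordinate of \<open>w\<close> enters through \<open>K\<close> alone; \<open>r + d \<le> e\<close>
  keeps the overwritten points where \<open>F\<close> is holomorphic.\<close>

lemma cdiff_at_kernel_mean:
  fixes F :: "complex^'n \<Rightarrow> complex"
  assumes F: "\<And>z. norm z < e \<Longrightarrow> cdiff_at F z" and r: "r > 0" "d > 0" "r + d \<le> e"
    and cont: "continuous_on (ball 0 d \<times> sphere 0 r) (\<lambda>(w, \<zeta>). K w \<zeta>)"
    and hol: "\<And>w \<zeta>. norm w < d \<Longrightarrow> norm \<zeta> = r \<Longrightarrow> cdiff_at (\<lambda>w. K w \<zeta>) w"
  shows "hol_germ (\<lambda>w. circle_mean r (\<lambda>\<zeta>. F (upd w i \<zeta>) * K w \<zeta>))"
proof (rule hol_germI[OF r(2)])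
  have ball: "norm (upd w i \<zeta>) < e" if "norm w < d" "norm \<zeta> = r" for w \<zeta>
    using norm_upd[of w i \<zeta>] that r by simp
  have contF: "continuous_on (ball 0 e) F"
    using F by (intro continuous_at_imp_continuous_on) (auto intro: cdiff_at_imp_isCont)
  fix z :: "complex^'n" assume z: "norm z < d"
  show "cdiff_at (\<lambda>w. circle_mean r (\<lambda>\<zeta>. F (upd w i \<zeta>) * K w \<zeta>)) z"
  proof (rule cdiff_at_circle_mean[of "ball 0 d"])
    show "continuous_on (ball 0 d \<times> sphere 0 r) (\<lambda>(w, \<zeta>). F (upd w i \<zeta>) * K w \<zeta>)"
      using ball cont by (auto simp: case_prod_unfold intro!: continuous_intros continuous_on_compose2[OF contF])
    show "cdiff_at (\<lambda>w. F (upd w i \<zeta>) * K w \<zeta>) w" if "w \<in> ball 0 d" "norm \<zeta> = r" for w \<zeta>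
      using that ball F hol by (intro cdiff_at_mult cdiff_at_upd[where F = F]) auto
  qed (use z r in auto)
qed

text \<open>The Cauchy kernel as a finite geometric sum with its exact remainder; integrated against
  a holomorphic function it yields Taylor's formula.\<close>

lemma geometric_kernel:
  fixes \<zeta> y :: "'a::field"
  assumes "\<zeta> \<noteq> 0" "\<zeta> \<noteq> y"
  shows "\<zeta> / (\<zeta> - y) = (\<Sum>b<L. y ^ b / \<zeta> ^ b) + y ^ L * (\<zeta> / (\<zeta> ^ L * (\<zeta> - y)))"
proof (induction L)
  case (Suc L)
  have "y ^ L * (\<zeta> / (\<zeta> ^ L * (\<zeta> - y))) = y ^ L / \<zeta> ^ L + y ^ Suc L * (\<zeta> / (\<zeta> ^ Suc L * (\<zeta> - y)))"
    using assms by (simp add: field_simps)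
  with Suc show ?case by simp
qed simp

text \<open>Divide \<open>\<zeta> ^ m - y ^ m\<close> by \<open>\<zeta> - y\<close>. Apart from the
  factor \<open>y ^ q\<close>, each summand depends on y through \<open>y ^ m\<close> only.\<close>

lemma residue_kernel:
  fixes \<zeta> y :: "'a::field"
  assumes "\<zeta> ^ m \<noteq> y ^ m"
  shows "\<zeta> / (\<zeta> - y) = (\<Sum>q<m. y ^ q * (\<zeta> ^ (m - q) / (\<zeta> ^ m - y ^ m)))"
proof -
  have "\<zeta> \<noteq> y" using assms by auto
  have "(\<Sum>q<m. y ^ q * \<zeta> ^ (m - q)) = (\<Sum>q<m. \<zeta> * (y ^ q * \<zeta> ^ (m - Suc q)))"
  proof (rule sum.cong)
    fix q assume "q \<in> {..<m}"
    then have "m - q = Suc (m - Suc q)" by auto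
    then show "y ^ q * \<zeta> ^ (m - q) = \<zeta> * (y ^ q * \<zeta> ^ (m - Suc q))" by simp
  qed auto
  then have "(\<zeta> - y) * (\<Sum>q<m. y ^ q * \<zeta> ^ (m - q)) = \<zeta> * ((\<zeta> - y) * (\<Sum>q<m. y ^ q * \<zeta> ^ (m - Suc q)))"
    by (simp add: sum_distrib_left[symmetric])
  also have "(\<zeta> - y) * (\<Sum>q<m. y ^ q * \<zeta> ^ (m - Suc q)) = \<zeta> ^ m - y ^ m"
    using power_diff_sumr2[of \<zeta> m y] sum.nat_diff_reindex[of "\<lambda>q. \<zeta> ^ q * y ^ (m - Suc q)" m]
    by (simp add: mult.commute)
  finally have "(\<Sum>q<m. y ^ q * \<zeta> ^ (m - q)) / (\<zeta> ^ m - y ^ m) = \<zeta> / (\<zeta> - y)"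
    using assms \<open>\<zeta> \<noteq> y\<close> by (simp add: field_simps)
  then show ?thesis
    by (simp add: sum_divide_distrib)
qed

lemma circle_mean_sum:
  assumes "r > 0" "\<And>q. q \<in> I \<Longrightarrow> continuous_on (sphere 0 r) (\<phi> q)"
  shows "circle_mean r (\<lambda>\<zeta>. \<Sum>q\<in>I. c q * \<phi> q \<zeta>) = (\<Sum>q\<in>I. c q * circle_mean r (\<phi> q))"
proof -
  have "(\<lambda>s. \<phi> q (circ r s)) integrable_on cbox 0 1" if "q \<in> I" for q
    using assms by (intro integrable_continuous continuous_on_compose2[OF assms(2)[OF that]]
        continuous_intros) auto
  then have "(\<lambda>s. c q * \<phi> q (circ r s)) integrable_on cbox 0 1" if "q \<in> I" for q
    using that integrable_on_mult_right by blast
  then show ?thesis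
    unfolding circle_mean_def by (cases "finite I") (auto simp: integral_sum)
qed


subsection \<open>Division of holomorphic germs\<close>

lemma circle_kernel_continuous:
  fixes K :: "complex^'n \<Rightarrow> complex \<Rightarrow> complex"
  assumes "\<And>w \<zeta>. norm w < d \<Longrightarrow> norm \<zeta> = r \<Longrightarrow> isCont (\<lambda>p. K (fst p) (snd p)) (w, \<zeta>)"
  shows "continuous_on (ball 0 d \<times> sphere 0 r) (\<lambda>(w, \<zeta>). K w \<zeta>)"
  using assms by (auto simp: case_prod_unfold intro!: continuous_at_imp_continuous_on)

text \<open>Cauchy's formula in the i-th variable, with the kernel expanded by
  \<open>geometric_kernel\<close>. The Taylor coefficients are taken at \<open>z $ i = 0\<close> and
  so depend on the other coordinates only; the integral remainder stays holomorphic in all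
  coordinates.\<close>

lemma taylor_coordinate:
  fixes F :: "complex^'n \<Rightarrow> complex"
  assumes "hol_germ F"
  obtains G where "hol_germ G"
    and "\<forall>\<^sub>F z in nhds 0. F z =
      (\<Sum>b<L. (z $ i) ^ b * ((partial_deriv i ^^ b) F (upd z i 0) / fact b)) + (z $ i) ^ L * G z"
proof -
  obtain e where e: "e > 0" "\<And>z. norm z < e \<Longrightarrow> cdiff_at F z"
    using hol_germ_ball[OF assms] by blast
  define r where "r = e / 2"
  have r: "r > 0" "r + r \<le> e" using e by (auto simp: r_def)
  define K where "K w \<zeta> = \<zeta> / (\<zeta> ^ L * (\<zeta> - w $ i))" for w :: "complex^'n" and \<zeta>
  have ne: "\<zeta> \<noteq> 0 \<and> \<zeta> \<noteq> w $ i" if "norm w < r" "norm \<zeta> = r" for w :: "complex^'n" and \<zeta>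
    using le_less_trans[OF Finite_Cartesian_Product.norm_nth_le[of w i] that(1)] that r by auto
  define G where "G w = circle_mean r (\<lambda>\<zeta>. F (upd w i \<zeta>) * K w \<zeta>)" for w
  show thesis
  proof
    show "hol_germ G"
      unfolding G_def
    proof (rule cdiff_at_kernel_mean[OF e(2) r(1) r(1) r(2)])
      show "continuous_on (ball 0 r \<times> sphere 0 r) (\<lambda>(w, \<zeta>). K w \<zeta>)"
        unfolding K_def
      proof (rule circle_kernel_continuous)
        fix w :: "complex^'n" and \<zeta> :: complex assume "norm w < r" "norm \<zeta> = r"
        from ne[OF this] show "isCont (\<lambda>p. snd p / (snd p ^ L * (snd p - fst p $ i))) (w, \<zeta>)"
          by (auto intro!: continuous_intros)
      qed
      show "cdiff_at (\<lambda>w. K w \<zeta>) w" if "norm w < r" "norm \<zeta> = r" for w \<zeta>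
        unfolding K_def using ne[OF that] by (intro cdiff_at_divide cdiff_at_mult cdiff_at_diff) auto
    qed
    show "\<forall>\<^sub>F z in nhds 0. F z =
      (\<Sum>b<L. (z $ i) ^ b * ((partial_deriv i ^^ b) F (upd z i 0) / fact b)) + (z $ i) ^ L * G z"
    proof (rule eventually_nhds_0I[OF r(1)])
      fix z :: "complex^'n" assume z: "norm z < r"
      define \<phi> where "\<phi> t = F (upd z i t)" for t
      have "norm (upd z i t) < e" if "norm t \<le> r" for t
        using norm_upd[of z i t] z that r by linarith
      then have \<phi>: "\<phi> holomorphic_on cball 0 r"
        unfolding \<phi>_def using e(2) by (intro holomorphic_on_upd) auto
      have cont\<phi>: "continuous_on (sphere 0 r) \<phi>"
        using holomorphic_on_imp_continuous_on[OF \<phi>] by (rule continuous_on_subset) auto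
      \<comment> \<open>Indices below \<open>L\<close> carry the Taylor terms and the index
        \<open>L\<close> the remainder, so that a single sum is integrated termwise.\<close>
      define \<psi> where "\<psi> b \<zeta> = (if b < L then \<phi> \<zeta> / \<zeta> ^ b else \<phi> \<zeta> * K z \<zeta>)" for b \<zeta>
      have cont: "continuous_on (sphere 0 r) (\<psi> b)" for b
        unfolding \<psi>_def K_def using cont\<phi> ne[OF z] by (cases "b < L") (auto intro!: continuous_intros)
      have "F z = \<phi> (z $ i)" by (simp add: \<phi>_def)
      also have "\<dots> = circle_mean r (\<lambda>\<zeta>. \<phi> \<zeta> * (\<zeta> / (\<zeta> - z $ i)))"
        using z Finite_Cartesian_Product.norm_nth_le[of z i] by (intro circle_mean_Cauchy[OF \<phi>, symmetric]) auto
      also have "\<dots> = circle_mean r (\<lambda>\<zeta>. \<Sum>b<Suc L. (z $ i) ^ b * \<psi> b \<zeta>)"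
      proof (rule circle_mean_cong[OF r(1)])
        fix \<zeta> :: complex assume "norm \<zeta> = r"
        then have "\<zeta> \<noteq> 0" "\<zeta> \<noteq> z $ i" using ne[OF z] by auto
        then show "\<phi> \<zeta> * (\<zeta> / (\<zeta> - z $ i)) = (\<Sum>b<Suc L. (z $ i) ^ b * \<psi> b \<zeta>)"
          by (subst geometric_kernel[of _ _ L])
            (auto simp: \<psi>_def K_def distrib_left sum_distrib_left mult_ac intro!: sum.cong)
      qed
      also have "\<dots> = (\<Sum>b<Suc L. (z $ i) ^ b * circle_mean r (\<psi> b))"
        by (rule circle_mean_sum[OF r(1) cont])
      also have "\<dots> = (\<Sum>b<L. (z $ i) ^ b * circle_mean r (\<lambda>\<zeta>. \<phi> \<zeta> / \<zeta> ^ b)) + (z $ i) ^ L * G z"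
        by (auto simp: \<psi>_def[abs_def] G_def \<phi>_def intro!: sum.cong)
      also have "\<dots> = (\<Sum>b<L. (z $ i) ^ b * ((partial_deriv i ^^ b) F (upd z i 0) / fact b)) + (z $ i) ^ L * G z"
        by (simp add: circle_mean_deriv[OF \<phi> r(1)]) (simp add: \<phi>_def[abs_def] deriv_funpow_upd)
      finally show "F z = \<dots>" .
    qed
  qed
qed

text \<open>Sorts a power series in \<open>z $ i\<close> by exponents modulo m without touching the
  series: \<open>residue_kernel\<close> does it under the Cauchy integral.\<close>

lemma residue_class_splitting:
  fixes F :: "complex^'n \<Rightarrow> complex"
  assumes "hol_germ F" "m \<ge> 1"
  obtains G where "\<And>q. hol_germ (G q)"
    and "\<forall>\<^sub>F z in nhds 0. F z = (\<Sum>q<m. (z $ i) ^ q * G q (upd z i ((z $ i) ^ m)))"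
proof -
  obtain e where e: "e > 0" "\<And>z. norm z < e \<Longrightarrow> cdiff_at F z"
    using hol_germ_ball[OF assms(1)] by blast
  define r where "r = e / 2"
  \<comment> \<open>In \<open>K\<close> the coordinate \<open>w $ i\<close> stands for the m-th
    power of the variable, hence it has to stay inside the circle of radius \<open>r ^ m\<close>;
    the other bound keeps \<open>upd w i \<zeta>\<close> in the domain of \<open>F\<close>.\<close>
  define d where "d = min r (r ^ m)"
  have r: "r > 0" "d > 0" "r + d \<le> e" using e by (auto simp: r_def d_def min_def)
  define K where "K q w \<zeta> = \<zeta> ^ (m - q) / (\<zeta> ^ m - w $ i)" for q and w :: "complex^'n" and \<zeta>
  have ne: "\<zeta> ^ m \<noteq> w $ i" if "norm w < d" "norm \<zeta> = r" for w :: "complex^'n" and \<zeta>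
  proof
    assume "\<zeta> ^ m = w $ i"
    then have "r ^ m = norm (w $ i)" using that by (metis norm_power)
    then show False
      using le_less_trans[OF Finite_Cartesian_Product.norm_nth_le[of w i] that(1)] by (simp add: d_def)
  qed
  define G where "G q w = circle_mean r (\<lambda>\<zeta>. F (upd w i \<zeta>) * K q w \<zeta>)" for q w
  show thesis
  proof
    show "hol_germ (G q)" for q
      unfolding G_def
    proof (rule cdiff_at_kernel_mean[OF e(2) r])
      show "continuous_on (ball 0 d \<times> sphere 0 r) (\<lambda>(w, \<zeta>). K q w \<zeta>)"
        unfolding K_def
      proof (rule circle_kernel_continuous)
        fix w :: "complex^'n" and \<zeta> :: complex assume "norm w < d" "norm \<zeta> = r"
        from ne[OF this] show "isCont (\<lambda>p. snd p ^ (m - q) / (snd p ^ m - fst p $ i)) (w, \<zeta>)"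
          by (auto intro!: continuous_intros)
      qed
      show "cdiff_at (\<lambda>w. K q w \<zeta>) w" if "norm w < d" "norm \<zeta> = r" for w \<zeta>
        unfolding K_def using ne[OF that] by (intro cdiff_at_divide cdiff_at_diff) auto
    qed
    show "\<forall>\<^sub>F z in nhds 0. F z = (\<Sum>q<m. (z $ i) ^ q * G q (upd z i ((z $ i) ^ m)))"
    proof (rule eventually_nhds_0I[OF r(1)])
      fix z :: "complex^'n" assume z: "norm z < r"
      define \<phi> where "\<phi> t = F (upd z i t)" for t
      have "norm (upd z i t) < e" if "norm t \<le> r" for t
        using norm_upd[of z i t] z that by (simp add: r_def)
      then have \<phi>: "\<phi> holomorphic_on cball 0 r"
        unfolding \<phi>_def using e(2) by (intro holomorphic_on_upd) auto
      have cont\<phi>: "continuous_on (sphere 0 r) \<phi>"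
        using holomorphic_on_imp_continuous_on[OF \<phi>] by (rule continuous_on_subset) auto
      have zi: "norm (z $ i) < r" using Finite_Cartesian_Product.norm_nth_le[of z i] z by simp
      have ne': "\<zeta> ^ m \<noteq> (z $ i) ^ m" if "norm \<zeta> = r" for \<zeta>
      proof
        assume "\<zeta> ^ m = (z $ i) ^ m"
        then have "norm \<zeta> ^ m = norm (z $ i) ^ m" by (metis norm_power)
        then show False
          using zi that power_strict_mono[OF zi, of m] assms(2) by auto
      qed
      define \<psi> where "\<psi> q \<zeta> = \<phi> \<zeta> * (\<zeta> ^ (m - q) / (\<zeta> ^ m - (z $ i) ^ m))" for q \<zeta>
      have cont: "continuous_on (sphere 0 r) (\<psi> q)" for q
        unfolding \<psi>_def using cont\<phi> ne' by (auto intro!: continuous_intros)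
      have "F z = \<phi> (z $ i)" by (simp add: \<phi>_def)
      also have "\<dots> = circle_mean r (\<lambda>\<zeta>. \<phi> \<zeta> * (\<zeta> / (\<zeta> - z $ i)))"
        using zi by (intro circle_mean_Cauchy[OF \<phi>, symmetric]) auto
      also have "\<dots> = circle_mean r (\<lambda>\<zeta>. \<Sum>q<m. (z $ i) ^ q * \<psi> q \<zeta>)"
        using ne' by (intro circle_mean_cong[OF r(1)])
          (subst residue_kernel[of _ m], auto simp: \<psi>_def sum_distrib_left mult_ac)
      also have "\<dots> = (\<Sum>q<m. (z $ i) ^ q * circle_mean r (\<psi> q))"
        by (rule circle_mean_sum[OF r(1) cont])
      also have "\<dots> = (\<Sum>q<m. (z $ i) ^ q * G q (upd z i ((z $ i) ^ m)))"
        by (auto simp: \<psi>_def[abs_def] G_def \<phi>_def K_def)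
      finally show "F z = \<dots>" .
    qed
  qed
qed

definition restrict_coords :: "'n set \<Rightarrow> complex^'n \<Rightarrow> complex^'n" where
  "restrict_coords J z = (\<chi> j. if j \<in> J then z $ j else 0)"

lemma restrict_coords_nth [simp]: "restrict_coords J z $ j = (if j \<in> J then z $ j else 0)"
  by (simp add: restrict_coords_def)

lemma map_germ_restrict_coords: "map_germ (restrict_coords J)"
proof -
  have "hol_germ (\<lambda>z. restrict_coords J z $ j)" for j
    by (cases "j \<in> J") auto
  then show ?thesis
    by (simp add: map_germ_iff vec_eq_iff)
qed

text \<open>A monomial in the coordinates of \<open>J\<close> of degree above the sum of the
  \<open>L j\<close> contains some \<open>(z $ j) ^ L j\<close>. To obtain holomorphic cofactors,
  one coordinate at a time is expanded to order \<open>L i\<close>: the remainder is divisible by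
  \<open>(z $ i) ^ L i\<close>, and the coefficients of lower order live on the smaller coordinate
  subspace recorded by \<open>restrict_coords\<close>. Enough of their jets vanishes because
  \<open>b < L i\<close>.\<close>

lemma vanishing_jet_ideal:
  fixes F :: "complex^'n \<Rightarrow> complex"
  assumes "hol_germ F" "(\<Sum>j\<in>J. L j) \<le> R"
    and "\<And>is. set is \<subseteq> J \<Longrightarrow> length is \<le> R \<Longrightarrow> foldr partial_deriv is F 0 = 0"
  shows "\<exists>G. (\<forall>j\<in>J. hol_germ (G j)) \<and>
    (\<forall>\<^sub>F z in nhds 0. F (restrict_coords J z) = (\<Sum>j\<in>J. (z $ j) ^ L j * G j z))"
  using finite[of J] assms
proof (induction J arbitrary: F R rule: finite_induct)
  case empty
  have "restrict_coords {} z = 0" for z :: "complex^'n" by (simp add: vec_eq_iff)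
  then show ?case using empty(3)[of "[]"] by simp
next
  case (insert i J)
  obtain G0 where G0: "hol_germ G0" "\<forall>\<^sub>F z in nhds 0. F z =
      (\<Sum>b<L i. (z $ i) ^ b * ((partial_deriv i ^^ b) F (upd z i 0) / fact b)) + (z $ i) ^ L i * G0 z"
    using taylor_coordinate[OF insert.prems(1)] by blast
  let ?r = "restrict_coords (insert i J)"
  have upd: "upd (?r z) i 0 = restrict_coords J z" for z
    using insert.hyps by (auto simp: vec_eq_iff)
  have "\<forall>\<^sub>F z in nhds 0. F (?r z) = (\<Sum>b<L i. (?r z $ i) ^ b *
      ((partial_deriv i ^^ b) F (upd (?r z) i 0) / fact b)) + (?r z $ i) ^ L i * G0 (?r z)"
    using map_germ_filterlim[OF map_germ_restrict_coords] G0(2) unfolding filterlim_iff by blast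
  then have ev0: "\<forall>\<^sub>F z in nhds 0. F (?r z) = (\<Sum>b<L i. (z $ i) ^ b *
      ((partial_deriv i ^^ b) F (restrict_coords J z) / fact b)) + (z $ i) ^ L i * G0 (?r z)"
    unfolding upd by simp
  have "\<exists>G. (\<forall>j\<in>J. hol_germ (G j)) \<and> (\<forall>\<^sub>F z in nhds 0.
      (partial_deriv i ^^ b) F (restrict_coords J z) = (\<Sum>j\<in>J. (z $ j) ^ L j * G j z))" if "b < L i" for b
  proof (rule insert.IH)
    show "hol_germ ((partial_deriv i ^^ b) F)"
      by (rule hol_germ_funpow_partial_deriv[OF insert.prems(1)])
    show "(\<Sum>j\<in>J. L j) \<le> R - b"
      using insert.prems(2) insert.hyps that by simp
    show "foldr partial_deriv is ((partial_deriv i ^^ b) F) 0 = 0" if "set is \<subseteq> J" "length is \<le> R - b" for "is"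
    proof -
      \<comment> \<open>\<open>foldr\<close> applies the end of the list first, so the b derivatives
        along i are appended.\<close>
      have "foldr partial_deriv (is @ replicate b i) F 0 = 0"
        using that \<open>b < L i\<close> insert.prems(2) insert.hyps by (intro insert.prems(3)) auto
      then show ?thesis by (simp only: foldr_append foldr_replicate comp_apply)
    qed
  qed
  then have "\<forall>b\<in>{..<L i}. \<exists>G. (\<forall>j\<in>J. hol_germ (G j)) \<and> (\<forall>\<^sub>F z in nhds 0.
      (partial_deriv i ^^ b) F (restrict_coords J z) = (\<Sum>j\<in>J. (z $ j) ^ L j * G j z))"
    by blast
  from bchoice[OF this] obtain G where G: "\<And>b j. b < L i \<Longrightarrow> j \<in> J \<Longrightarrow> hol_germ (G b j)"
    "\<And>b. b < L i \<Longrightarrow> \<forall>\<^sub>F z in nhds 0.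
      (partial_deriv i ^^ b) F (restrict_coords J z) = (\<Sum>j\<in>J. (z $ j) ^ L j * G b j z)"
    by (auto simp del: upd_nth)
  have ev1: "\<forall>\<^sub>F z in nhds 0. \<forall>b<L i.
      (partial_deriv i ^^ b) F (restrict_coords J z) = (\<Sum>j\<in>J. (z $ j) ^ L j * G b j z)"
  proof -
    have "\<forall>\<^sub>F z in nhds 0. \<forall>b\<in>{..<L i}.
        (partial_deriv i ^^ b) F (restrict_coords J z) = (\<Sum>j\<in>J. (z $ j) ^ L j * G b j z)"
      by (rule eventually_ball_finite) (auto intro!: G(2))
    then show ?thesis by (rule eventually_mono) blast
  qed
  \<comment> \<open>The cofactor of i is the Taylor remainder; that of j in \<open>J\<close>
    collects the contributions of all orders b.\<close>
  define H where "H j z = (if j = i then G0 (?r z) else \<Sum>b<L i. (z $ i) ^ b * (G b j z * (1 / fact b)))" for j z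
  show ?case
  proof (intro exI[of _ H] conjI ballI)
    show "hol_germ (H j)" if "j \<in> insert i J" for j
    proof (cases "j = i")
      case True
      then show ?thesis
        using hol_germ_compose[OF G0(1) map_germ_restrict_coords] by (simp add: H_def[abs_def])
    next
      case False
      have "hol_germ (\<lambda>z. \<Sum>b<L i. (z $ i) ^ b * (G b j z * (1 / fact b)))"
        using that False G(1) by (intro hol_germ_sum hol_germ_mult hol_germ_power) auto
      with False show ?thesis by (simp add: H_def[abs_def])
    qed
    show "\<forall>\<^sub>F z in nhds 0. F (?r z) = (\<Sum>j\<in>insert i J. (z $ j) ^ L j * H j z)"
      using ev0 ev1
    proof eventually_elim
      case (elim z)
      have "(\<Sum>b<L i. (z $ i) ^ b * ((partial_deriv i ^^ b) F (restrict_coords J z) / fact b)) =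
          (\<Sum>b<L i. \<Sum>j\<in>J. (z $ j) ^ L j * ((z $ i) ^ b * (G b j z * (1 / fact b))))"
      proof (rule sum.cong)
        fix b assume "b \<in> {..<L i}"
        then have "(partial_deriv i ^^ b) F (restrict_coords J z) = (\<Sum>j\<in>J. (z $ j) ^ L j * G b j z)"
          using elim(2) by blast
        then show "(z $ i) ^ b * ((partial_deriv i ^^ b) F (restrict_coords J z) / fact b) =
            (\<Sum>j\<in>J. (z $ j) ^ L j * ((z $ i) ^ b * (G b j z * (1 / fact b))))"
          unfolding sum_divide_distrib by (simp only: sum_divide_distrib sum_distrib_left) (simp add: mult_ac)
      qed simp
      also have "\<dots> = (\<Sum>j\<in>J. \<Sum>b<L i. (z $ j) ^ L j * ((z $ i) ^ b * (G b j z * (1 / fact b))))"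
        by (rule sum.swap)
      also have "\<dots> = (\<Sum>j\<in>J. (z $ j) ^ L j * H j z)"
        using insert.hyps by (intro sum.cong) (auto simp: H_def sum_distrib_left)
      finally show ?case
        using elim(1) insert.hyps by (simp add: H_def)
    qed
  qed
qed


subsection \<open>Jets, flat germs and pullbacks\<close>

lemma filterlim_line: "filterlim (\<lambda>t. z + t *s (v :: complex^'n)) (nhds z) (nhds 0)"
proof -
  have "continuous_on UNIV (\<lambda>t. z + t *s v)"
    by (intro continuous_intros)
  then have "isCont (\<lambda>t. z + t *s v) 0"
    by (simp add: continuous_on_eq_continuous_at)
  then show ?thesis
    using tendsto_at_iff_tendsto_nhds[of "\<lambda>t. z + t *s v" 0] by (simp add: isCont_def)
qed

lemma partial_deriv_cong:
  assumes "\<forall>\<^sub>F w in nhds z. F w = G w"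
  shows "partial_deriv i F z = partial_deriv i G z"
proof -
  have "\<forall>\<^sub>F t in nhds 0. F (z + t *s axis i 1) = G (z + t *s axis i 1)"
    using filterlim_line assms unfolding filterlim_iff by blast
  then show ?thesis
    unfolding partial_deriv_def by (intro deriv_cong_ev) auto
qed

lemma field_differentiable_line:
  assumes "cdiff_at F z"
  shows "(\<lambda>t. F (z + t *s v)) field_differentiable at 0"
proof -
  obtain D where "(F has_derivative D) (at (z + 0 *s v))" "\<And>c v. D (c *s v) = c * D v"
    using assms unfolding cdiff_at_def by auto
  from has_field_derivative_line[OF this] show ?thesis
    unfolding field_differentiable_def by blast
qed

lemma partial_deriv_diff:
  assumes "cdiff_at F z" "cdiff_at G z"
  shows "partial_deriv i (\<lambda>z. F z - G z) z = partial_deriv i F z - partial_deriv i G z"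
  unfolding partial_deriv_def using assms by (intro deriv_diff field_differentiable_line)

text \<open>Stated near 0 rather than at 0, since the induction differentiates the identity;
  \<open>eventually_eventually\<close> makes it hold near every nearby point.\<close>

lemma foldr_partial_deriv_diff:
  assumes "hol_germ F" "hol_germ G"
  shows "\<forall>\<^sub>F z in nhds 0. foldr partial_deriv is (\<lambda>z. F z - G z) z =
    foldr partial_deriv is F z - foldr partial_deriv is G z"
proof (induction "is")
  case (Cons i "is")
  let ?F = "foldr partial_deriv is F" and ?G = "foldr partial_deriv is G"
  have "\<forall>\<^sub>F w in nhds 0. \<forall>\<^sub>F z in nhds w. foldr partial_deriv is (\<lambda>z. F z - G z) z = ?F z - ?G z"
    using Cons by (simp add: eventually_eventually)
  moreover have "\<forall>\<^sub>F w in nhds 0. cdiff_at ?F w" "\<forall>\<^sub>F w in nhds 0. cdiff_at ?G w"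
    using hol_germ_foldr_partial_deriv assms unfolding hol_germ_def by blast+
  ultimately show ?case
  proof eventually_elim
    case (elim w)
    have "partial_deriv i (foldr partial_deriv is (\<lambda>z. F z - G z)) w = partial_deriv i (\<lambda>z. ?F z - ?G z) w"
      using elim(1) by (rule partial_deriv_cong)
    also have "\<dots> = partial_deriv i ?F w - partial_deriv i ?G w"
      using elim(2,3) by (rule partial_deriv_diff)
    finally show ?case by simp
  qed
qed simp

lemma same_jet_diff_vanishes:
  assumes "same_jet r f g" "map_germ f" "map_germ g" "length is \<le> r"
  shows "foldr partial_deriv is (\<lambda>z. g z $ j - f z $ j) 0 = 0"
proof -
  have "foldr partial_deriv is (\<lambda>z. g z $ j - f z $ j) 0 =
      foldr partial_deriv is (\<lambda>z. g z $ j) 0 - foldr partial_deriv is (\<lambda>z. f z $ j) 0"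
    using assms(2,3) unfolding map_germ_iff
    by (intro eventually_nhds_x_imp_x[OF foldr_partial_deriv_diff]) auto
  then show ?thesis
    using assms(1,4) unfolding same_jet_def by simp
qed

section \<open>Biholomorphisms tangent to the identity\<close>

lemma map_germ_id: "map_germ (\<lambda>z. z)"
  by (simp add: map_germ_iff)

lemma inverse_germs_id: "inverse_germs (\<lambda>z. z) (\<lambda>z. z)"
  by (simp add: inverse_germs_def map_germ_id)

text \<open>The inverse function theorem is real. Complex linearity of the inverse derivative is
  what makes the local inverse holomorphic.\<close>

lemma linear_inv:
  fixes h :: "complex^'n \<Rightarrow> complex^'n"
  assumes h: "Vector_Spaces.linear (*s) (*s) h" and bij: "bij h"
  shows "Vector_Spaces.linear (*s) (*s) (inv h)"
proof -
  have "inv h (a + b) = inv h a + inv h b" "inv h (c *s a) = c *s inv h a" for a b c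
    using h bij unfolding Vector_Spaces.linear_iff
    by (auto intro!: inv_f_eq simp: bij_is_inj surj_f_inv_f bij_is_surj)
  then show ?thesis
    using h by (simp add: Vector_Spaces.linear_iff)
qed

text \<open>This is the square of the maximal ideal in the ring of germs at 0.\<close>

definition flat_germ :: "(complex^'n \<Rightarrow> complex) \<Rightarrow> bool" where
  "flat_germ F \<longleftrightarrow> hol_germ F \<and> F 0 = 0 \<and> (F has_derivative (\<lambda>_. 0)) (at 0)"

text \<open>At 0 the derivative of the map is the identity, so the inverse function theorem
  applies.\<close>

lemma biholomorphism_germ_add_flat:
  fixes \<Theta> :: "'p \<Rightarrow> complex^'p \<Rightarrow> complex"
  assumes flat: "\<And>j. flat_germ (\<Theta> j)"
  shows "biholomorphism_germ (\<lambda>z. \<chi> j. z $ j + \<Theta> j z)"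
proof -
  define \<psi> where "\<psi> z = (\<chi> j. z $ j + \<Theta> j z)" for z
  have \<psi>: "map_germ \<psi>"
    using flat unfolding map_germ_iff flat_germ_def by (auto simp: \<psi>_def vec_eq_iff)
  then have "\<forall>\<^sub>F z in nhds 0. \<forall>j. cdiff_at (\<lambda>z. \<psi> z $ j) z"
    unfolding map_germ_def complex_derivative_iff by blast
  then obtain e where e: "e > 0" "\<And>z j. z \<in> ball 0 e \<Longrightarrow> cdiff_at (\<lambda>z. \<psi> z $ j) z"
    unfolding eventually_nhds_metric by (auto simp: dist_commute)
  obtain \<psi>' where \<psi>': "\<And>w. w \<in> ball 0 e \<Longrightarrow> (\<psi> has_derivative blinfun_apply (\<psi>' w)) (at w)"
      "\<And>w. w \<in> ball 0 e \<Longrightarrow> Vector_Spaces.linear (*s) (*s) (blinfun_apply (\<psi>' w))"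
      "continuous_on (ball 0 e) \<psi>'"
    using continuous_blinfun_derivative[OF open_ball e(2)] by blast
  have "((\<lambda>z. z $ j + \<Theta> j z) has_derivative (\<lambda>v. v $ j + 0)) (at 0)" for j
    using flat[of j] unfolding flat_germ_def
    by (intro has_derivative_add) (auto intro: bounded_linear_imp_has_derivative bounded_linear_vec_nth)
  then have "(\<psi> has_derivative (\<lambda>v. v)) (at 0)"
    by (intro has_derivative_vec_lambda) (simp add: \<psi>_def)
  then have "blinfun_apply (\<psi>' 0) = (\<lambda>v. v)"
    using has_derivative_unique[OF \<psi>'(1)[of 0]] e(1) by simp
  then have id: "id_blinfun o\<^sub>L \<psi>' 0 = id_blinfun"
    by (intro blinfun_eqI) simp
  have zero: "0 \<in> ball (0 :: complex^'p) e"
    using e(1) by simp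
  have "\<exists>U' V \<sigma> \<sigma>'. open U' \<and> 0 \<in> U' \<and> U' \<subseteq> ball 0 e \<and> open V \<and> \<psi> 0 \<in> V \<and>
      homeomorphism U' V \<psi> \<sigma> \<and> (\<forall>y\<in>V. (\<sigma> has_derivative (\<sigma>' y)) (at y) \<and>
        \<sigma>' y = inv (blinfun_apply (\<psi>' (\<sigma> y))) \<and> bij (blinfun_apply (\<psi>' (\<sigma> y))))"
  proof (rule inverse_function_theorem[OF open_ball \<psi>'(1) \<psi>'(3) zero id])
    fix U' V \<sigma> \<sigma>'
    assume *: "open U'" "U' \<subseteq> ball 0 e" "0 \<in> U'" "open V" "\<psi> 0 \<in> V" "homeomorphism U' V \<psi> \<sigma>"
      and **: "\<And>y. y \<in> V \<Longrightarrow> (\<sigma> has_derivative (\<sigma>' y)) (at y)"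
        "\<And>y. y \<in> V \<Longrightarrow> \<sigma>' y = inv (blinfun_apply (\<psi>' (\<sigma> y)))"
        "\<And>y. y \<in> V \<Longrightarrow> bij (blinfun_apply (\<psi>' (\<sigma> y)))"
    show ?thesis
      by (intro exI conjI ballI; (rule * **)) 
  qed assumption
  then obtain U' V \<sigma> \<sigma>' where U': "open U'" "U' \<subseteq> ball 0 e" "0 \<in> U'" "open V" "\<psi> 0 \<in> V"
      and hom: "homeomorphism U' V \<psi> \<sigma>"
      and \<sigma>': "\<And>y. y \<in> V \<Longrightarrow> (\<sigma> has_derivative (\<sigma>' y)) (at y)"
        "\<And>y. y \<in> V \<Longrightarrow> \<sigma>' y = inv (blinfun_apply (\<psi>' (\<sigma> y)))"
        "\<And>y. y \<in> V \<Longrightarrow> bij (blinfun_apply (\<psi>' (\<sigma> y)))"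
    by metis
  have \<psi>0: "\<psi> 0 = 0" using \<psi> by (simp add: map_germ_def)
  have V: "\<forall>\<^sub>F z in nhds 0. z \<in> V"
    using U'(4,5) \<psi>0 by (intro eventually_nhds_in_open) auto
  have "map_germ \<sigma>"
    unfolding map_germ_def
  proof
    show "\<sigma> 0 = 0"
      using homeomorphism_apply1[OF hom U'(3)] \<psi>0 by simp
    show "\<forall>\<^sub>F z in nhds 0. \<exists>D. (\<sigma> has_derivative D) (at z) \<and> Vector_Spaces.linear (*s) (*s) D"
      using V
    proof eventually_elim
      case (elim y)
      have "\<sigma> y \<in> ball 0 e"
        using elim hom U'(2) homeomorphism_image2 by blast
      then have "Vector_Spaces.linear (*s) (*s) (\<sigma>' y)"
        unfolding \<sigma>'(2)[OF elim] using \<psi>'(2) \<sigma>'(3)[OF elim] by (intro linear_inv)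
      with \<sigma>'(1)[OF elim] show ?case by blast
    qed
  qed
  moreover have "\<forall>\<^sub>F z in nhds 0. \<sigma> (\<psi> z) = z"
    using eventually_nhds_in_open[OF U'(1,3)] by (rule eventually_mono) (rule homeomorphism_apply1[OF hom])
  moreover have "\<forall>\<^sub>F z in nhds 0. \<psi> (\<sigma> z) = z"
    using V homeomorphism_apply2[OF hom] by (auto elim: eventually_mono)
  ultimately have "inverse_germs \<psi> \<sigma>"
    using \<psi> by (simp add: inverse_germs_def)
  then show ?thesis
    unfolding biholomorphism_germ_def \<psi>_def by blast
qed

text \<open>The image of the ring homomorphism that sends \<open>H\<close> to its composite with f;
  \<open>flat_pullback\<close> is the image of the square of the maximal ideal.\<close>

definition pullback :: "(complex^'n \<Rightarrow> complex^'p) \<Rightarrow> (complex^'n \<Rightarrow> complex) \<Rightarrow> bool" where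
  "pullback f \<phi> \<longleftrightarrow> (\<exists>H. hol_germ H \<and> (\<forall>\<^sub>F z in nhds 0. \<phi> z = H (f z)))"

definition flat_pullback :: "(complex^'n \<Rightarrow> complex^'p) \<Rightarrow> (complex^'n \<Rightarrow> complex) \<Rightarrow> bool" where
  "flat_pullback f \<phi> \<longleftrightarrow> (\<exists>H. flat_germ H \<and> (\<forall>\<^sub>F z in nhds 0. \<phi> z = H (f z)))"

lemma pullback_const [simp]: "pullback f (\<lambda>z. c)"
  unfolding pullback_def by (intro exI[of _ "\<lambda>_. c"]) auto

lemma pullback_mult [intro]:
  assumes "pullback f \<phi>" "pullback f \<psi>" shows "pullback f (\<lambda>z. \<phi> z * \<psi> z)"
proof -
  obtain H K where *: "hol_germ H" "hol_germ K" "\<forall>\<^sub>F z in nhds 0. \<phi> z = H (f z)" "\<forall>\<^sub>F z in nhds 0. \<psi> z = K (f z)"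
    using assms unfolding pullback_def by blast
  have "\<forall>\<^sub>F z in nhds 0. \<phi> z * \<psi> z = H (f z) * K (f z)"
    using *(3,4) by eventually_elim simp
  moreover have "hol_germ (\<lambda>w. H w * K w)"
    using *(1,2) by (rule hol_germ_mult)
  ultimately show ?thesis
    unfolding pullback_def by (intro exI[of _ "\<lambda>w. H w * K w"] conjI)
qed

lemma pullback_power [intro]: "pullback f \<phi> \<Longrightarrow> pullback f (\<lambda>z. \<phi> z ^ k)"
  by (induction k) auto

lemma pullback_prod [intro]:
  "(\<And>i. i \<in> I \<Longrightarrow> pullback f (\<phi> i)) \<Longrightarrow> pullback f (\<lambda>z. \<Prod>i\<in>I. \<phi> i z)"
  by (induction I rule: infinite_finite_induct) auto

lemma pullback_component:
  assumes "\<forall>\<^sub>F z in nhds 0. f z $ j = c * \<phi> z" "c \<noteq> 0"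
  shows "pullback f \<phi>"
  unfolding pullback_def
proof (intro exI conjI)
  show "hol_germ (\<lambda>w. inverse c * w $ j)" by auto
  show "\<forall>\<^sub>F z in nhds 0. \<phi> z = inverse c * f z $ j"
    using assms by (auto elim!: eventually_mono)
qed

text \<open>Closure under holomorphic substitution, not just under ring operations: the coefficient
  functions produced by the division lemmas become pullbacks once their arguments are. The values at
  0 make the inner map a germ fixing the origin.\<close>

lemma pullback_compose:
  assumes G: "hol_germ G" and \<iota>: "\<And>k. pullback f (\<lambda>z. \<iota> z $ k)" "\<iota> 0 = 0" and f: "f 0 = 0"
  shows "pullback f (\<lambda>z. G (\<iota> z))"
proof -
  have "\<forall>k. \<exists>H. hol_germ H \<and> (\<forall>\<^sub>F z in nhds 0. \<iota> z $ k = H (f z))"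
    using \<iota>(1) unfolding pullback_def by blast
  from choice[OF this] obtain H
    where H: "\<And>k. hol_germ (H k)" "\<And>k. \<forall>\<^sub>F z in nhds 0. \<iota> z $ k = H k (f z)"
    by blast
  have "H k 0 = 0" for k
    using eventually_nhds_x_imp_x[OF H(2)[of k]] \<iota>(2) f by simp
  then have "map_germ (\<lambda>w. \<chi> k. H k w)"
    using H(1) by (simp add: map_germ_iff vec_eq_iff)
  then have "hol_germ (\<lambda>w. G (\<chi> k. H k w))"
    by (rule hol_germ_compose[OF G])
  moreover have "\<forall>\<^sub>F z in nhds 0. \<forall>k. \<iota> z $ k = H k (f z)"
    using H(2) by (simp add: eventually_all_finite)
  then have "\<forall>\<^sub>F z in nhds 0. G (\<iota> z) = G (\<chi> k. H k (f z))"
    by (rule eventually_mono) (auto intro!: arg_cong[of _ _ G] simp: vec_eq_iff)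
  ultimately show ?thesis
    unfolding pullback_def by (intro exI[of _ "\<lambda>w. G (\<chi> k. H k w)"] conjI)
qed

lemma flat_pullback_cong:
  "flat_pullback f \<phi> \<Longrightarrow> \<forall>\<^sub>F z in nhds 0. \<psi> z = \<phi> z \<Longrightarrow> flat_pullback f \<psi>"
  unfolding flat_pullback_def
proof (elim exE conjE)
  fix H assume ev: "\<forall>\<^sub>F z in nhds 0. \<psi> z = \<phi> z" "\<forall>\<^sub>F z in nhds 0. \<phi> z = H (f z)" and H: "flat_germ H"
  from ev have "\<forall>\<^sub>F z in nhds 0. \<psi> z = H (f z)" by eventually_elim simp
  with H show "\<exists>H. flat_germ H \<and> (\<forall>\<^sub>F z in nhds 0. \<psi> z = H (f z))" by (intro exI[of _ H] conjI)
qed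

lemma flat_pullback_add:
  assumes "flat_pullback f \<phi>" "flat_pullback f \<psi>" shows "flat_pullback f (\<lambda>z. \<phi> z + \<psi> z)"
proof -
  obtain H K where *: "flat_germ H" "flat_germ K" "\<forall>\<^sub>F z in nhds 0. \<phi> z = H (f z)" "\<forall>\<^sub>F z in nhds 0. \<psi> z = K (f z)"
    using assms unfolding flat_pullback_def by blast
  have "((\<lambda>w. H w + K w) has_derivative (\<lambda>v. 0 + 0)) (at 0)"
    using *(1,2) unfolding flat_germ_def by (intro has_derivative_add) blast+
  then have "flat_germ (\<lambda>w. H w + K w)"
    using *(1,2) unfolding flat_germ_def by (simp add: hol_germ_add)
  moreover have "\<forall>\<^sub>F z in nhds 0. \<phi> z + \<psi> z = H (f z) + K (f z)"
    using *(3,4) by eventually_elim simp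
  ultimately show ?thesis
    unfolding flat_pullback_def by (intro exI[of _ "\<lambda>w. H w + K w"] conjI)
qed

lemma flat_pullback_sum:
  assumes "\<And>i. i \<in> I \<Longrightarrow> flat_pullback f (\<phi> i)"
  shows "flat_pullback f (\<lambda>z. \<Sum>i\<in>I. \<phi> i z)"
  using assms
proof (induction I rule: infinite_finite_induct)
  case (insert i I)
  then show ?case
    using flat_pullback_add[of f "\<phi> i" "\<lambda>z. \<Sum>i\<in>I. \<phi> i z"] by simp
qed (auto simp: flat_pullback_def flat_germ_def intro!: exI[of _ "\<lambda>_. 0"])

text \<open>With \<open>H 0 = 0\<close> the derivative of \<open>H ^ 2 * K\<close> vanishes at 0. So
  order 2 in the target is reached by splitting off the square of one pullback that vanishes at
  0.\<close>

lemma flat_pullback_square: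
  assumes "pullback f \<phi>" "\<phi> 0 = 0" "pullback f \<psi>" "f 0 = 0"
  shows "flat_pullback f (\<lambda>z. \<phi> z ^ 2 * \<psi> z)"
proof -
  obtain H K where *: "hol_germ H" "hol_germ K" "\<forall>\<^sub>F z in nhds 0. \<phi> z = H (f z)" "\<forall>\<^sub>F z in nhds 0. \<psi> z = K (f z)"
    using assms unfolding pullback_def by blast
  have H0: "H 0 = 0"
    using eventually_nhds_x_imp_x[OF *(3)] assms by simp
  have "cdiff_at H 0" "cdiff_at K 0"
    using *(1,2) unfolding hol_germ_def by (auto dest: eventually_nhds_x_imp_x)
  then obtain D E where D: "(H has_derivative D) (at 0)" "(K has_derivative E) (at 0)"
    unfolding cdiff_at_def by blast
  have "((\<lambda>w. H w ^ 2 * K w) has_derivative (\<lambda>v. 0)) (at 0)"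
    using D by (auto intro!: derivative_eq_intros simp: H0)
  then have "flat_germ (\<lambda>w. H w ^ 2 * K w)"
    using *(1,2) H0 unfolding flat_germ_def by (simp add: hol_germ_mult hol_germ_power)
  moreover have "\<forall>\<^sub>F z in nhds 0. \<phi> z ^ 2 * \<psi> z = H (f z) ^ 2 * K (f z)"
    using *(3,4) by eventually_elim simp
  ultimately show ?thesis
    unfolding flat_pullback_def by (intro exI[of _ "\<lambda>w. H w ^ 2 * K w"] conjI)
qed

text \<open>The least positive difference d of two elements of the semigroup divides every
  generator, so d = 1 and some a and a + 1 both lie in it. If a > 0 and b >= a^2, let q and t be
  quotient and remainder of b by a; then t < a <= q and b = (q - t) a + t (a + 1).\<close>

lemma numerical_semigroup_conductor:
  fixes M :: "nat set"
  assumes "finite M" "Gcd M = 1"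
  obtains c where "\<And>b. b \<ge> c \<Longrightarrow> \<exists>e. b = (\<Sum>m\<in>M. e m * m)"
proof -
  define S where "S = {b. \<exists>e. b = (\<Sum>m\<in>M. e m * m)}"
  have zero: "0 \<in> S" unfolding S_def by (auto intro!: exI[of _ "\<lambda>_. 0"])
  have add: "a + b \<in> S" if ab: "a \<in> S" "b \<in> S" for a b
  proof -
    obtain e e' where "a = (\<Sum>m\<in>M. e m * m)" "b = (\<Sum>m\<in>M. e' m * m)"
      using ab unfolding S_def by blast
    then have "a + b = (\<Sum>m\<in>M. (e m + e' m) * m)"
      by (simp add: sum.distrib distrib_right)
    then show ?thesis unfolding S_def by (intro CollectI exI)
  qed
  have mult: "k * a \<in> S" if "a \<in> S" for k a
    by (induction k) (use zero add that in auto)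
  have gen: "m \<in> S" if "m \<in> M" for m
    unfolding S_def using assms(1) that
    by (intro CollectI exI[of _ "\<lambda>i. if i = m then 1 else 0"]) (simp add: if_distrib[of "\<lambda>x. x * _"] cong: if_cong)
  define P where "P d \<longleftrightarrow> d > 0 \<and> (\<exists>a. a \<in> S \<and> a + d \<in> S)" for d
  have "\<exists>m\<in>M. m > 0"
    using assms(2) by (metis Gcd_0_iff gr0I singletonI subsetI zero_neq_one)
  then have "\<exists>d. P d"
    unfolding P_def using zero gen by (metis add_0)
  define d where "d = (LEAST d. P d)"
  have "P d" unfolding d_def using \<open>\<exists>d. P d\<close> by (rule LeastI_ex)
  then obtain a where a: "d > 0" "a \<in> S" "a + d \<in> S" unfolding P_def by blast
  have "d dvd m" if "m \<in> M" for m
  proof (rule ccontr)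
    assume "\<not> d dvd m"
    then have r: "m mod d > 0" by (simp add: dvd_eq_mod_eq_0)
    let ?q = "m div d"
    \<comment> \<open>Two elements of \<open>S\<close> would differ by \<open>m mod d\<close>, which
      is positive and smaller than d.\<close>
    have "?q * (a + d) + m mod d = ?q * a + m"
      using div_mult_mod_eq[of m d] by (simp add: algebra_simps)
    then have "P (m mod d)"
      unfolding P_def using r mult a(3) add[OF mult[OF a(2)] gen[OF that], of ?q] by metis
    then have "d \<le> m mod d" unfolding d_def by (rule Least_le)
    then show False using mod_less_divisor[OF a(1), of m] by linarith
  qed
  then have "d dvd Gcd M" by (rule Gcd_greatest)
  then have "d = 1" using assms(2) by simp
  with a have a: "a \<in> S" "a + 1 \<in> S" by auto
  show thesis
  proof
    fix b assume b: "b \<ge> a * a"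
    have "b \<in> S"
    proof (cases "a = 0")
      case True
      then show ?thesis using mult[OF a(2), of b] by simp
    next
      case False
      let ?q = "b div a" and ?t = "b mod a"
      have "a \<le> ?q" using b False by (simp add: less_eq_div_iff_mult_less_eq)
      moreover have "?t < a" using False by simp
      ultimately have t: "?t \<le> ?q" by simp
      have "b = (?q - ?t) * a + ?t * (a + 1)"
        using t div_mult_mod_eq[of b a] by (simp add: algebra_simps diff_mult_distrib)
      then show ?thesis
        using add mult a by metis
    qed
    then show "\<exists>e. b = (\<Sum>m\<in>M. e m * m)" unfolding S_def by blast
  qed
qed


subsection \<open>Finite determinacy\<close>

lemma nat_semigroup_power_sum:
  fixes y :: complex
  shows "y ^ (\<Sum>m\<in>M. e m * m) = (\<Prod>m\<in>M. (y ^ m) ^ e m)"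
  by (simp add: power_sum power_mult[symmetric] mult.commute)

lemma A_finite_of_monomial_components:
  fixes f :: "complex^'n \<Rightarrow> complex^'p" and y :: 'n
  assumes f: "map_germ f"
    and M: "finite M" "Gcd M = 1"
    and X: "\<And>i. i \<noteq> y \<Longrightarrow> \<exists>j c. c \<noteq> 0 \<and> (\<forall>\<^sub>F z in nhds 0. f z $ j = c * z $ i)"
    and W: "\<And>i. i \<noteq> y \<Longrightarrow> \<exists>j c l. c \<noteq> 0 \<and> (\<forall>\<^sub>F z in nhds 0. f z $ j = c * ((z $ i) ^ l * z $ y))"
    and Y: "\<And>m. m \<in> M \<Longrightarrow> \<exists>j c. c \<noteq> 0 \<and> (\<forall>\<^sub>F z in nhds 0. f z $ j = c * (z $ y) ^ m)"
  shows "A_finite f"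
proof -
  have f0: "f 0 = 0" using f by (simp add: map_germ_def)
  have pX: "pullback f (\<lambda>z. z $ i)" if "i \<noteq> y" for i
    using X[OF that] by (elim exE conjE) (rule pullback_component)
  have "\<exists>l. pullback f (\<lambda>z. (z $ i) ^ l * z $ y)" if "i \<noteq> y" for i
    using W[OF that] by (elim exE conjE) (rule exI, rule pullback_component)
  then have "\<forall>i\<in>{i. i \<noteq> y}. \<exists>l. pullback f (\<lambda>z. (z $ i) ^ l * z $ y)"
    by blast
  from bchoice[OF this] obtain l where pW: "\<And>i. i \<noteq> y \<Longrightarrow> pullback f (\<lambda>z. (z $ i) ^ l i * z $ y)"
    by blast
  have pY: "pullback f (\<lambda>z. (z $ y) ^ m)" if "m \<in> M" for m
    using Y[OF that] by (elim exE conjE) (rule pullback_component)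
  obtain c0 where c0: "\<And>b. b \<ge> c0 \<Longrightarrow> \<exists>e. b = (\<Sum>m\<in>M. e m * m)"
    using numerical_semigroup_conductor[OF M] by blast
  have pYb: "pullback f (\<lambda>z. (z $ y) ^ b)" if b: "b \<ge> c0" for b
  proof -
    obtain e where "b = (\<Sum>m\<in>M. e m * m)" using c0[OF b] by blast
    then show ?thesis
      using pY by (simp add: nat_semigroup_power_sum pullback_prod pullback_power)
  qed
  \<comment> \<open>A positive exponent: its monomial vanishes at 0, and it serves as the modulus of
    the residue classes.\<close>
  obtain \<mu> where \<mu>: "\<mu> \<in> M" "\<mu> > 0"
  proof -
    have "\<not> M \<subseteq> {0}" using M(2) Gcd_0_iff[of M] by linarith
    then show thesis using that by auto
  qed
  \<comment> \<open>Beyond the conductor \<open>c0\<close>, the summand \<open>2 * \<mu>\<close>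
    reserves the square of \<open>y ^ \<mu>\<close> that makes the tail flat.\<close>
  define c where "c = c0 + 2 * \<mu>"
  \<comment> \<open>Chosen so that for \<open>b < c\<close> the power
    \<open>x_i ^ L i * y ^ b\<close> is the square of x_i, times the b-th power of
    \<open>x_i ^ l i * y\<close>, times a further power of x_i.\<close>
  define L where "L i = l i * c + 2" for i
  define J where "J = {i. i \<noteq> y}"
  \<comment> \<open>Room for fewer than c derivatives along y, followed by those that
    \<open>vanishing_jet_ideal\<close> consumes.\<close>
  define R where "R = c + (\<Sum>j\<in>J. L j)"
  let ?r = "restrict_coords J"
  have upd0: "upd z y 0 = ?r z" for z by (auto simp: vec_eq_iff J_def)
  have r_idem: "?r (?r z) = ?r z" for z by (simp add: vec_eq_iff)
  have pr: "pullback f (\<lambda>z. G (?r z))" if "hol_germ G" for G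
  proof (rule pullback_compose[OF that])
    show "pullback f (\<lambda>z. ?r z $ k)" for k
      using pX by (cases "k = y") (auto simp: J_def)
  qed (auto simp: f0 vec_eq_iff)
  \<comment> \<open>Every coordinate of the argument is a function of f: the x_i and
    \<open>y ^ \<mu>\<close> are components up to a constant.\<close>
  have pu: "pullback f (\<lambda>z. G (upd z y ((z $ y) ^ \<mu>)))" if "hol_germ G" for G
  proof (rule pullback_compose[OF that])
    show "pullback f (\<lambda>z. upd z y ((z $ y) ^ \<mu>) $ k)" for k
      using pX pY[OF \<mu>(1)] by (cases "k = y") auto
  qed (use \<mu> in \<open>auto simp: f0 vec_eq_iff\<close>)
  have key: "flat_pullback f \<theta>"
    if \<theta>: "hol_germ \<theta>" and van: "\<And>is. length is \<le> R \<Longrightarrow> foldr partial_deriv is \<theta> 0 = 0" for \<theta>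
  proof -
    obtain G where G: "hol_germ G" "\<forall>\<^sub>F z in nhds 0. \<theta> z =
        (\<Sum>b<c. (z $ y) ^ b * ((partial_deriv y ^^ b) \<theta> (upd z y 0) / fact b)) + (z $ y) ^ c * G z"
      using taylor_coordinate[OF \<theta>] by blast
    obtain H where H: "\<And>q. hol_germ (H q)"
      "\<forall>\<^sub>F z in nhds 0. G z = (\<Sum>q<\<mu>. (z $ y) ^ q * H q (upd z y ((z $ y) ^ \<mu>)))"
      using residue_class_splitting[OF G(1), of \<mu>] \<mu>(2) by auto
    have 1: "flat_pullback f (\<lambda>z. (z $ y) ^ b * ((partial_deriv y ^^ b) \<theta> (upd z y 0) / fact b))" if b: "b < c" for b
    proof -
      have "\<exists>K. (\<forall>j\<in>J. hol_germ (K j)) \<and> (\<forall>\<^sub>F z in nhds 0.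
          (partial_deriv y ^^ b) \<theta> (?r z) = (\<Sum>j\<in>J. (z $ j) ^ L j * K j z))"
      proof (rule vanishing_jet_ideal)
        show "hol_germ ((partial_deriv y ^^ b) \<theta>)"
          by (rule hol_germ_funpow_partial_deriv[OF \<theta>])
        show "(\<Sum>j\<in>J. L j) \<le> (\<Sum>j\<in>J. L j)" ..
        show "foldr partial_deriv is ((partial_deriv y ^^ b) \<theta>) 0 = 0"
          if "length is \<le> (\<Sum>j\<in>J. L j)" for "is"
        proof -
          have "foldr partial_deriv (is @ replicate b y) \<theta> 0 = 0"
            using that b by (intro van) (auto simp: R_def)
          then show ?thesis by (simp only: foldr_append foldr_replicate comp_apply)
        qed
      qed
      then obtain K where K: "\<And>j. j \<in> J \<Longrightarrow> hol_germ (K j)" "\<forall>\<^sub>F z in nhds 0.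
          (partial_deriv y ^^ b) \<theta> (?r z) = (\<Sum>j\<in>J. (z $ j) ^ L j * K j z)"
        by blast
      have "\<forall>\<^sub>F z in nhds 0. (partial_deriv y ^^ b) \<theta> (?r (?r z)) = (\<Sum>j\<in>J. (?r z $ j) ^ L j * K j (?r z))"
        using map_germ_filterlim[OF map_germ_restrict_coords] K(2) unfolding filterlim_iff by blast
      \<comment> \<open>The cofactors \<open>K j\<close> may involve y. As the left side depends on
        x only, they may be evaluated at \<open>?r z\<close>, which makes them pullbacks.\<close>
      then have K': "\<forall>\<^sub>F z in nhds 0. (partial_deriv y ^^ b) \<theta> (?r z) = (\<Sum>j\<in>J. (z $ j) ^ L j * K j (?r z))"
        unfolding r_idem by (rule eventually_mono) simp
      define T where "T j z = (z $ j) ^ 2 *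
        ((((z $ j) ^ l j * z $ y) ^ b * (z $ j) ^ (l j * (c - b))) * (K j (?r z) * (1 / fact b)))" for j z
      have "flat_pullback f (\<lambda>z. \<Sum>j\<in>J. T j z)"
      proof (rule flat_pullback_sum)
        fix j assume "j \<in> J"
        then have j: "j \<noteq> y" by (simp add: J_def)
        show "flat_pullback f (T j)"
          unfolding T_def
        proof (rule flat_pullback_square[OF pX[OF j] _ _ f0])
          show "pullback f (\<lambda>z. (((z $ j) ^ l j * z $ y) ^ b * (z $ j) ^ (l j * (c - b))) *
              (K j (?r z) * (1 / fact b)))"
            by (intro pullback_mult pullback_power pullback_const pX[OF j] pW[OF j] pr[OF K(1)[OF \<open>j \<in> J\<close>]])
        qed simp
      qed
      moreover have "\<forall>\<^sub>F z in nhds 0. (z $ y) ^ b * ((partial_deriv y ^^ b) \<theta> (upd z y 0) / fact b) = (\<Sum>j\<in>J. T j z)"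
        using K'
      proof (rule eventually_mono)
        fix z assume eq: "(partial_deriv y ^^ b) \<theta> (?r z) = (\<Sum>j\<in>J. (z $ j) ^ L j * K j (?r z))"
        have "(z $ y) ^ b * ((z $ j) ^ L j * K j (?r z) / fact b) = T j z" for j
        proof -
          have "l j * b + l j * (c - b) = l j * c"
            using b by (metis add_mult_distrib2 le_add_diff_inverse less_imp_le)
          then have "(z $ j) ^ L j = (z $ j) ^ 2 * (((z $ j) ^ l j) ^ b * (z $ j) ^ (l j * (c - b)))"
            unfolding L_def by (metis add.commute power_add power_mult)
          then show ?thesis
            unfolding T_def power_mult_distrib by simp
        qed
        then show "(z $ y) ^ b * ((partial_deriv y ^^ b) \<theta> (upd z y 0) / fact b) = (\<Sum>j\<in>J. T j z)"
          unfolding upd0 eq by (simp only: sum_divide_distrib sum_distrib_left)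
      qed
      ultimately show ?thesis by (rule flat_pullback_cong)
    qed
    define S where "S q z = ((z $ y) ^ \<mu>) ^ 2 * ((z $ y) ^ (c0 + q) * H q (upd z y ((z $ y) ^ \<mu>)))" for q z
    have 2: "flat_pullback f (\<lambda>z. \<Sum>q<\<mu>. S q z)"
    proof (rule flat_pullback_sum)
      show "flat_pullback f (S q)" for q
        unfolding S_def
      proof (rule flat_pullback_square[OF pY[OF \<mu>(1)] _ _ f0])
        show "pullback f (\<lambda>z. (z $ y) ^ (c0 + q) * H q (upd z y ((z $ y) ^ \<mu>)))"
          by (intro pullback_mult pYb pu H) simp
      qed (use \<mu> in simp)
    qed
    have "flat_pullback f (\<lambda>z. (\<Sum>b<c. (z $ y) ^ b * ((partial_deriv y ^^ b) \<theta> (upd z y 0) / fact b)) + (\<Sum>q<\<mu>. S q z))"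
      by (intro flat_pullback_add flat_pullback_sum 1 2) auto
    moreover have "\<forall>\<^sub>F z in nhds 0. \<theta> z =
        (\<Sum>b<c. (z $ y) ^ b * ((partial_deriv y ^^ b) \<theta> (upd z y 0) / fact b)) + (\<Sum>q<\<mu>. S q z)"
      using G(2) H(2)
    proof eventually_elim
      case (elim z)
      have "(z $ y) ^ c * ((z $ y) ^ q * h) = ((z $ y) ^ \<mu>) ^ 2 * ((z $ y) ^ (c0 + q) * h)" for q h
      proof -
        have "(z $ y) ^ c = (z $ y) ^ c0 * ((z $ y) ^ \<mu>) ^ 2"
          unfolding c_def power_add by (simp only: power_mult[symmetric] mult.commute)
        then show ?thesis by (simp add: power_add)
      qed
      then have "(z $ y) ^ c * G z = (\<Sum>q<\<mu>. S q z)"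
        unfolding elim(2) S_def by (simp only: sum_distrib_left)
      with elim(1) show ?case by simp
    qed
    ultimately show ?thesis by (rule flat_pullback_cong)
  qed
  show ?thesis
    unfolding A_finite_def
  proof (intro exI allI impI, elim conjE)
    fix g :: "complex^'n \<Rightarrow> complex^'p" assume g: "map_germ g" "same_jet R f g"
    have "flat_pullback f (\<lambda>z. g z $ j - f z $ j)" for j
    proof (rule key)
      show "hol_germ (\<lambda>z. g z $ j - f z $ j)"
        using f g(1) by (auto simp: map_germ_iff)
    qed (rule same_jet_diff_vanishes[OF g(2) f g(1)])
    then have "\<forall>j. \<exists>\<Theta>. flat_germ \<Theta> \<and> (\<forall>\<^sub>F z in nhds 0. g z $ j - f z $ j = \<Theta> (f z))"
      unfolding flat_pullback_def by blast
    from choice[OF this] obtain \<Theta> where \<Theta>: "\<And>j. flat_germ (\<Theta> j)"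
      "\<And>j. \<forall>\<^sub>F z in nhds 0. g z $ j - f z $ j = \<Theta> j (f z)"
      by blast
    have "\<forall>\<^sub>F z in nhds 0. \<forall>j. g z $ j - f z $ j = \<Theta> j (f z)"
      using \<Theta>(2) by (simp add: eventually_all_finite)
    then have "\<forall>\<^sub>F z in nhds 0. g z = (\<lambda>w. \<chi> j. w $ j + \<Theta> j w) (f ((\<lambda>z. z) z))"
      by (rule eventually_mono) (auto simp: vec_eq_iff algebra_simps)
    then show "A_equivalent f g"
      unfolding A_equivalent_def
      by (intro exI conjI) (rule inverse_germs_id, rule biholomorphism_germ_add_flat[OF \<Theta>(1)])
  qed
qed


subsection \<open>Generic perturbations\<close>

text \<open>The origin is left out because a singular germ is never immersive there.
  \<open>V\<close> confines both points of a pair, as an equivalence of germs controls nothing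
  outside a neighbourhood.\<close>

definition bad_point :: "(complex^'n) set \<Rightarrow> (complex^'n \<Rightarrow> complex^'p) \<Rightarrow> complex^'n \<Rightarrow> bool" where
  "bad_point V g z \<longleftrightarrow> z \<in> V \<and> z \<noteq> 0 \<and> ((\<exists>w\<in>V. w \<noteq> z \<and> g w = g z) \<or>
     (\<exists>D u. (g has_derivative D) (at z) \<and> u \<noteq> 0 \<and> D u = 0))"

text \<open>The value \<open>\<zeta> = 0\<close> is allowed; it expresses that f is constant along
  the axis.\<close>

definition bad_axis :: "(complex^'n \<Rightarrow> complex^'p) \<Rightarrow> 'n \<Rightarrow> bool" where
  "bad_axis f i \<longleftrightarrow>
     (\<exists>\<zeta>. \<zeta> \<noteq> 1 \<and> (\<forall>\<^sub>F s in nhds 0. f (axis i (\<zeta> * s)) = f (axis i s))) \<or>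
     (\<exists>u. u \<noteq> 0 \<and> (\<forall>\<^sub>F s in nhds 0. \<exists>D. (f has_derivative D) (at (axis i s)) \<and> D u = 0))"

lemma filterlim_axis: "filterlim (\<lambda>s. axis i (c * s) :: complex^'n) (nhds 0) (nhds 0)"
proof -
  have "filterlim (\<lambda>s. 0 + s *s axis i c :: complex^'n) (nhds 0) (nhds 0)"
    by (rule filterlim_line)
  moreover have "0 + s *s axis i c = (axis i (c * s) :: complex^'n)" for s
    by (simp add: vec_eq_iff axis_def)
  ultimately show ?thesis by simp
qed

lemma map_germ_differentiable:
  "map_germ f \<Longrightarrow> \<forall>\<^sub>F z in nhds 0. \<exists>D. (f has_derivative D) (at z)"
  unfolding map_germ_def by (auto elim: eventually_mono)

text \<open>The curve is the image under rho of a real segment in the axis. Since g composed with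
  rho is psi composed with f, rho carries double points to double points, and its derivative carries
  u to a kernel vector of dg.\<close>

lemma bad_points_along_curve:
  fixes f g :: "complex^'n \<Rightarrow> complex^'p"
  assumes equiv: "A_equivalent f g" and f: "map_germ f" and bad: "bad_axis f i"
    and V: "\<forall>\<^sub>F z in nhds 0. z \<in> V"
  obtains \<gamma> \<epsilon> where "\<epsilon> > (0::real)" "continuous_on {0..\<epsilon>} \<gamma>" "\<gamma> 0 = 0"
    "\<And>s. 0 < s \<Longrightarrow> s \<le> \<epsilon> \<Longrightarrow> bad_point V g (\<gamma> s)"
proof -
  obtain \<rho> \<sigma> \<psi> where inv: "inverse_germs \<rho> \<sigma>" and \<psi>: "biholomorphism_germ \<psi>"
      and g: "\<forall>\<^sub>F z in nhds 0. g z = \<psi> (f (\<sigma> z))"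
    using equiv unfolding A_equivalent_def by blast
  have \<rho>: "map_germ \<rho>" and \<sigma>: "map_germ \<sigma>" and \<sigma>\<rho>: "\<forall>\<^sub>F z in nhds 0. \<sigma> (\<rho> z) = z"
    using inv unfolding inverse_germs_def by auto
  have "map_germ \<psi>" using \<psi> unfolding biholomorphism_germ_def inverse_germs_def by blast
  have \<rho>0: "\<rho> 0 = 0" and \<sigma>0: "\<sigma> 0 = 0" using \<rho> \<sigma> by (auto simp: map_germ_def)
  note lim_\<rho> = map_germ_filterlim[OF \<rho>]
  note lim_f = map_germ_filterlim[OF f]
  have ev_\<rho>: "\<forall>\<^sub>F x in nhds 0. P (\<rho> x)" if "\<forall>\<^sub>F z in nhds 0. P z" for P
    using that lim_\<rho> by (rule eventually_compose_filterlim)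
  have ev_f: "\<forall>\<^sub>F x in nhds 0. P (f x)" if "\<forall>\<^sub>F z in nhds 0. P z" for P
    using that lim_f by (rule eventually_compose_filterlim)
  have ev_axis: "\<forall>\<^sub>F s in nhds 0. P (axis i (c * s))" if "\<forall>\<^sub>F z in nhds 0. P z" for P :: "complex^'n \<Rightarrow> bool" and c
    using that filterlim_axis by (rule eventually_compose_filterlim)
  define good where "good x \<longleftrightarrow> \<sigma> (\<rho> x) = x \<and> \<rho> x \<in> V \<and> g (\<rho> x) = \<psi> (f x) \<and> (\<exists>D. (\<rho> has_derivative D) (at x))" for x
  have good: "\<forall>\<^sub>F x in nhds 0. good x"
    using \<sigma>\<rho> ev_\<rho>[OF V] ev_\<rho>[OF g] map_germ_differentiable[OF \<rho>]
    unfolding good_def by eventually_elim auto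
  have nonzero: "\<rho> x \<noteq> 0" if "good x" "x \<noteq> 0" for x
    using that \<sigma>0 unfolding good_def by metis
  have "\<forall>\<^sub>F s in nhds 0. s \<noteq> 0 \<longrightarrow> bad_point V g (\<rho> (axis i s))"
    using bad unfolding bad_axis_def
  proof
    assume "\<exists>\<zeta>. \<zeta> \<noteq> 1 \<and> (\<forall>\<^sub>F s in nhds 0. f (axis i (\<zeta> * s)) = f (axis i s))"
    then obtain \<zeta> where \<zeta>: "\<zeta> \<noteq> 1" "\<forall>\<^sub>F s in nhds 0. f (axis i (\<zeta> * s)) = f (axis i s)"
      by blast
    show ?thesis
      using ev_axis[OF good, of 1] ev_axis[OF good, of \<zeta>] \<zeta>(2)
    proof eventually_elim
      case (elim s)
      show ?case
      proof
        assume "s \<noteq> 0"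
        then have "axis i (\<zeta> * s) \<noteq> axis i s" "axis i s \<noteq> 0"
          using \<zeta>(1) by (auto simp: axis_eq_axis)
        moreover have "\<rho> (axis i (\<zeta> * s)) \<noteq> \<rho> (axis i s)" if "axis i (\<zeta> * s) \<noteq> axis i s"
          using elim(1,2) that unfolding good_def by (metis mult_1)
        ultimately show "bad_point V g (\<rho> (axis i s))"
          unfolding bad_point_def using elim nonzero[of "axis i s"] unfolding good_def
          by (metis mult_1)
      qed
    qed
  next
    assume "\<exists>u. u \<noteq> 0 \<and> (\<forall>\<^sub>F s in nhds 0. \<exists>D. (f has_derivative D) (at (axis i s)) \<and> D u = 0)"
    then obtain u where u: "u \<noteq> 0" "\<forall>\<^sub>F s in nhds 0. \<exists>D. (f has_derivative D) (at (axis i s)) \<and> D u = 0"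
      by blast
    have 1: "\<forall>\<^sub>F x in nhds 0. \<forall>\<^sub>F z in nhds x. \<sigma> (\<rho> z) = z"
      using \<sigma>\<rho> by (simp add: eventually_eventually)
    have 2: "\<forall>\<^sub>F x in nhds 0. \<forall>\<^sub>F z in nhds (\<rho> x). g z = \<psi> (f (\<sigma> z))"
      using g by (intro ev_\<rho>) (simp add: eventually_eventually)
    have "\<forall>\<^sub>F x in nhds 0. (\<forall>\<^sub>F z in nhds x. \<sigma> (\<rho> z) = z) \<and> (\<forall>\<^sub>F z in nhds (\<rho> x). g z = \<psi> (f (\<sigma> z))) \<and>
        (\<exists>D. (\<sigma> has_derivative D) (at (\<rho> x))) \<and> (\<exists>D. (\<psi> has_derivative D) (at (f x))) \<and> good x"
      using 1 2 ev_\<rho>[OF map_germ_differentiable[OF \<sigma>]] ev_f[OF map_germ_differentiable[OF \<open>map_germ \<psi>\<close>]] good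
      by eventually_elim blast
    from ev_axis[OF this, of 1] u(2) show ?thesis
    proof eventually_elim
      case (elim s)
      let ?x = "axis i s"
      show ?case
      proof
        assume "s \<noteq> 0"
        then have x: "?x \<noteq> 0" by (simp add: axis_eq_0_iff)
        have gx: "good ?x" using elim by simp
        obtain D\<rho> D\<sigma> D\<psi> Df where D: "(\<rho> has_derivative D\<rho>) (at ?x)" "(\<sigma> has_derivative D\<sigma>) (at (\<rho> ?x))"
            "(\<psi> has_derivative D\<psi>) (at (f ?x))" "(f has_derivative Df) (at ?x)" "Df u = 0"
          using elim unfolding good_def by auto
        have \<sigma>x: "\<sigma> (\<rho> ?x) = ?x" using gx by (simp add: good_def)
        have "((\<lambda>z. \<sigma> (\<rho> z)) has_derivative (\<lambda>v. D\<sigma> (D\<rho> v))) (at ?x)"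
          by (rule has_derivative_compose[OF D(1,2)])
        moreover have "((\<lambda>z. \<sigma> (\<rho> z)) has_derivative (\<lambda>v. v)) (at ?x)"
        proof (rule has_derivative_transform_eventually[OF has_derivative_ident])
          show "\<forall>\<^sub>F z in at ?x. z = \<sigma> (\<rho> z)"
            using elim(1) by (auto simp: eventually_at_filter elim: eventually_mono)
        qed (simp_all add: \<sigma>x)
        \<comment> \<open>This shows both that \<open>D\<rho> u\<close> is nonzero and that the
          derivative of g at the image point sends it back through \<open>Df u\<close>.\<close>
        ultimately have id: "D\<sigma> (D\<rho> u) = u"
          using has_derivative_unique by metis
        have "((\<lambda>z. f (\<sigma> z)) has_derivative (\<lambda>v. Df (D\<sigma> v))) (at (\<rho> ?x))"
          using D(2,4) \<sigma>x by (auto intro: has_derivative_compose[where g = f])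
        then have "((\<lambda>z. \<psi> (f (\<sigma> z))) has_derivative (\<lambda>v. D\<psi> (Df (D\<sigma> v)))) (at (\<rho> ?x))"
          using D(3) \<sigma>x by (auto intro: has_derivative_compose[where g = \<psi>])
        then have "(g has_derivative (\<lambda>v. D\<psi> (Df (D\<sigma> v)))) (at (\<rho> ?x))"
        proof (rule has_derivative_transform_eventually)
          have ev: "\<forall>\<^sub>F z in nhds (\<rho> ?x). g z = \<psi> (f (\<sigma> z))" using elim(1) by simp
          then show "\<forall>\<^sub>F z in at (\<rho> ?x). \<psi> (f (\<sigma> z)) = g z"
            by (auto simp: eventually_at_filter elim: eventually_mono)
          show "\<psi> (f (\<sigma> (\<rho> ?x))) = g (\<rho> ?x)"
            using eventually_nhds_x_imp_x[OF ev] by simp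
        qed simp
        moreover have "D\<psi> (Df (D\<sigma> (D\<rho> u))) = 0"
          using id D(5) linear_0[OF has_derivative_linear[OF D(3)]] by simp
        moreover have "D\<rho> u \<noteq> 0"
          using id u(1) linear_0[OF has_derivative_linear[OF D(2)]] by auto
        moreover have "\<rho> ?x \<in> V" "\<rho> ?x \<noteq> 0"
          using gx nonzero x by (auto simp: good_def)
        ultimately show "bad_point V g (\<rho> ?x)"
          unfolding bad_point_def by blast
      qed
    qed
  qed
  with ev_axis[OF good, of 1] have "\<forall>\<^sub>F s in nhds 0. good (axis i s) \<and> (s \<noteq> 0 \<longrightarrow> bad_point V g (\<rho> (axis i s)))"
    by eventually_elim simp
  then obtain d where d: "d > 0"
      "\<And>s. dist s 0 < d \<Longrightarrow> good (axis i s) \<and> (s \<noteq> 0 \<longrightarrow> bad_point V g (\<rho> (axis i s)))"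
    unfolding eventually_nhds_metric by blast
  show thesis
  proof
    show "d / 2 > 0" using d by simp
    have "axis i (0::complex) = (0 :: complex^'n)" by (simp add: axis_eq_0_iff)
    then show "\<rho> (axis i (of_real 0)) = 0" using \<rho>0 by (metis of_real_0)
    show "bad_point V g (\<rho> (axis i (of_real s)))" if "0 < s" "s \<le> d / 2" for s
      using d(2)[of "of_real s"] that d(1) by simp
    have axis: "axis i (complex_of_real s) = complex_of_real s *s axis i 1" for s :: real
      by (rule axis_eq_scalar)
    show "continuous_on {0..d / 2} (\<lambda>s. \<rho> (axis i (complex_of_real s)))"
    proof (rule continuous_on_compose2[of "(\<lambda>s. axis i (complex_of_real s)) ` {0..d / 2}" \<rho>])
      show "continuous_on ((\<lambda>s. axis i (complex_of_real s)) ` {0..d / 2}) \<rho>"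
      proof (rule continuous_at_imp_continuous_on, safe)
        fix s assume "s \<in> {0..d / 2}"
        then have "good (axis i (complex_of_real s))" using d(2)[of "of_real s"] d(1) by auto
        then show "isCont \<rho> (axis i (complex_of_real s))"
          unfolding good_def using has_derivative_continuous by blast
      qed
      show "continuous_on {0..d / 2} (\<lambda>s. axis i (complex_of_real s) :: complex^'n)"
        unfolding axis by (intro continuous_intros)
    qed simp
  qed
qed

text \<open>Some coordinate moves from 0 to a nonzero value, so the intermediate value theorem gives
  it a rational value on the way.\<close>

lemma continuous_curve_rational_coordinate:
  fixes \<gamma> :: "real \<Rightarrow> 'a::euclidean_space"
  assumes \<epsilon>: "\<epsilon> > 0" and cont: "continuous_on {0..\<epsilon>} \<gamma>" and \<gamma>: "\<gamma> 0 = 0" "\<gamma> \<epsilon> \<noteq> 0"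
  obtains s b where "0 < s" "s \<le> \<epsilon>" "b \<in> Basis" "\<gamma> s \<bullet> b \<in> \<rat>"
proof -
  obtain b where b: "b \<in> Basis" "\<gamma> \<epsilon> \<bullet> b \<noteq> 0"
    using \<gamma>(2) euclidean_all_zero_iff by blast
  define h where "h s = \<gamma> s \<bullet> b" for s
  have h: "continuous_on {0..\<epsilon>} h" "h 0 = 0" "h \<epsilon> \<noteq> 0"
    unfolding h_def using cont \<gamma> b by (auto intro!: continuous_intros)
  \<comment> \<open>The rational value 0 is of no use: it might be attained at \<open>s = 0\<close>
    alone.\<close>
  have "\<exists>r\<in>\<rat>. r \<noteq> 0 \<and> (\<exists>s. 0 \<le> s \<and> s \<le> \<epsilon> \<and> h s = r)"
  proof (cases "h \<epsilon> > 0")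
    case True
    obtain r where r: "r \<in> \<rat>" "0 < r" "r < h \<epsilon>" using Rats_dense_in_real[OF True] by blast
    then show ?thesis
      using IVT'[of h 0 r \<epsilon>] h \<epsilon> by (intro bexI[of _ r]) auto
  next
    case False
    then have "h \<epsilon> < 0" using h(3) by simp
    then obtain r where r: "r \<in> \<rat>" "h \<epsilon> < r" "r < 0" using Rats_dense_in_real by blast
    then show ?thesis
      using IVT2'[of h \<epsilon> r 0] h \<epsilon> by (intro bexI[of _ r]) auto
  qed
  then obtain r s where rs: "r \<in> \<rat>" "r \<noteq> 0" "0 \<le> s" "s \<le> \<epsilon>" "h s = r" by blast
  then have "s \<noteq> 0" using h(2) by auto
  then show thesis
    using that[of s b] rs b(1) by (simp add: h_def)
qed

section \<open>Null sets of parameters\<close>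

lemma differentiable_vec_lambda:
  fixes f :: "'a::real_normed_vector \<Rightarrow> 'b::euclidean_space^'n"
  assumes "\<And>i. (\<lambda>x. f x $ i) differentiable (at x within S)"
  shows "f differentiable (at x within S)"
proof -
  obtain D where D: "\<And>i. ((\<lambda>x. f x $ i) has_derivative D i) (at x within S)"
    using assms unfolding differentiable_def by metis
  have "(f has_derivative (\<lambda>v. \<chi> i. D i v)) (at x within S)"
    using D by (intro has_derivative_vec_lambda) simp
  then show ?thesis unfolding differentiable_def by blast
qed

lemma differentiable_vec_nth:
  fixes f :: "'a::real_normed_vector \<Rightarrow> 'b::real_normed_vector^'n"
  shows "f differentiable F \<Longrightarrow> (\<lambda>x. f x $ i) differentiable F"
  unfolding differentiable_def using has_derivative_vec_nth by blast

lemma negligible_linear_level_set: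
  fixes \<phi> :: "'a::euclidean_space \<Rightarrow> real"
  assumes "linear \<phi>" "\<phi> x0 \<noteq> 0"
  shows "negligible {x. \<phi> x = r}"
proof -
  have *: "x \<bullet> adjoint \<phi> 1 = \<phi> x" for x
    using adjoint_works[OF assms(1), of x 1] by simp
  have "adjoint \<phi> 1 \<noteq> 0"
    using *[of x0] assms(2) by auto
  then have "negligible {x. adjoint \<phi> 1 \<bullet> x = r}"
    by (intro negligible_hyperplane) simp
  then show ?thesis
    by (simp add: inner_commute *)
qed

text \<open>Pairs of points are stored inside a target vector. This pads the parametrisation of the
  bad parameters to a map between spaces of equal dimension, where differentiable images of null
  sets are null.\<close>

lemma linear_embedding_exists:
  assumes "2 * CARD('n) \<le> CARD('p)"
  obtains R :: "(complex^'n) \<times> (complex^'n) \<Rightarrow> complex^'p" and L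
  where "linear L" "\<And>x. L (R x) = x"
proof -
  have "dim (UNIV :: ((complex^'n) \<times> (complex^'n)) set) \<le> dim (UNIV :: (complex^'p) set)"
    using assms by simp
  then obtain R :: "(complex^'n) \<times> (complex^'n) \<Rightarrow> complex^'p" where R: "linear R" "\<And>x. norm (R x) = norm x"
    using isometry_subset_subspace[OF subspace_UNIV subspace_UNIV] by (metis UNIV_I)
  have "inj R"
    using linear_injective_0[OF R(1)] R(2) by (metis norm_eq_zero)
  then obtain L where "linear L" "L \<circ> R = id"
    using linear_injective_left_inverse[OF R(1)] by blast
  then show thesis
    using that[of L R] by (auto simp: fun_eq_iff)
qed

text \<open>
  Near a point where \<open>B c x \<noteq> 0\<close> the equation \<open>A x + \<Sum>c. B c x *s t $ c = 0\<close> can be solved for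
  \<open>t $ c\<close>. So the bad parameters \<open>t\<close> are images, under differentiable maps between spaces of
  equal dimension, of hyperplanes.
\<close>

lemma negligible_parameters:
  fixes A :: "(complex^'n) \<times> (complex^'n) \<Rightarrow> complex^'p" and B :: "'c::finite \<Rightarrow> (complex^'n) \<times> (complex^'n) \<Rightarrow> complex"
  assumes card: "2 * CARD('n) \<le> CARD('p)"
    and A: "\<And>x. A differentiable (at x)" and B: "\<And>c x. B c differentiable (at x)"
  shows "negligible {t :: complex^'p^'c. \<exists>x. (\<exists>c. B c x \<noteq> 0) \<and> (\<exists>b\<in>Basis. fst x \<bullet> b \<in> \<rat>) \<and>
    A x + (\<Sum>c\<in>UNIV. B c x *s t $ c) = 0}" (is "negligible ?Z")
proof -
  obtain R :: "(complex^'n) \<times> (complex^'n) \<Rightarrow> complex^'p" and L where L: "linear L" "\<And>x. L (R x) = x"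
    by (rule linear_embedding_exists[OF card]) (rule that)
  \<comment> \<open>Slot c of \<open>u\<close> encodes the pair x through \<open>L\<close>, and the
    other slots hold the corresponding \<open>t $ c'\<close>. \<open>G c\<close> overwrites slot c
    with the value that solves the equation for \<open>t $ c\<close>.\<close>
  define G where "G c u = (\<chi> c'. if c' = c then
      (- inverse (B c (L (u $ c)))) *s (A (L (u $ c)) + (\<Sum>c'\<in>UNIV - {c}. B c' (L (u $ c)) *s u $ c'))
      else u $ c')" for c and u :: "complex^'p^'c"
  \<comment> \<open>A hyperplane, cut down to where the division in \<open>G c\<close> is
    legitimate.\<close>
  define S where "S c b r = {u :: complex^'p^'c. fst (L (u $ c)) \<bullet> b = r} \<inter> {u. B c (L (u $ c)) \<noteq> 0}" for c b r
  have blL: "bounded_linear (\<lambda>u :: complex^'p^'c. L (u $ c))" for c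
    by (rule bounded_linear_compose[OF _ bounded_linear_vec_nth]) (rule L(1)[unfolded linear_conv_bounded_linear])
  have "negligible (S c b r)" if "b \<in> Basis" for c b r
  proof -
    have "linear (\<lambda>u :: complex^'p^'c. fst (L (u $ c)) \<bullet> b)"
      unfolding linear_conv_bounded_linear
      by (rule bounded_linear_compose[OF bounded_linear_inner_left bounded_linear_compose[OF bounded_linear_fst blL]])
    moreover have "fst (L ((\<chi> _. R (b, 0)) $ c)) \<bullet> b \<noteq> 0"
      using that by (simp add: L(2))
    ultimately have "negligible {u :: complex^'p^'c. fst (L (u $ c)) \<bullet> b = r}"
      by (rule negligible_linear_level_set[where \<phi> = "\<lambda>u. fst (L (u $ c)) \<bullet> b"])
    then show ?thesis unfolding S_def by (rule negligible_subset) auto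
  qed
  moreover have "G c differentiable_on S c b r" for c b r
    unfolding differentiable_on_def
  proof (rule ballI, rule differentiable_at_withinI, rule differentiable_vec_lambda, rule differentiable_vec_lambda)
    fix u i j assume u: "u \<in> S c b r"
    have dL: "(\<lambda>u :: complex^'p^'c. h (L (u $ c))) differentiable (at u)"
      if "\<And>x. h differentiable (at x)" for h :: "(complex^'n) \<times> (complex^'n) \<Rightarrow> complex"
      by (rule differentiable_compose[OF that bounded_linear_imp_differentiable[OF blL]])
    have du: "(\<lambda>u :: complex^'p^'c. u $ c' $ j) differentiable (at u)" for c'
      by (rule differentiable_vec_nth, rule differentiable_vec_nth, rule differentiable_ident)
    have dA: "(\<lambda>u :: complex^'p^'c. A (L (u $ c)) $ j) differentiable (at u)"
      by (rule dL) (rule differentiable_vec_nth, rule A)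
    have dB: "(\<lambda>u :: complex^'p^'c. B c' (L (u $ c))) differentiable (at u)" for c'
      by (rule dL) (rule B)
    show "(\<lambda>u. G c u $ i $ j) differentiable (at u)"
    proof (cases "i = c")
      case True
      have "(\<lambda>u. (- inverse (B c (L (u $ c)))) * (A (L (u $ c)) $ j +
          (\<Sum>c'\<in>UNIV - {c}. B c' (L (u $ c)) * u $ c' $ j))) differentiable (at u)"
        using u unfolding S_def
        by (intro differentiable_mult differentiable_minus differentiable_inverse differentiable_add
            differentiable_sum ballI dA dB du) auto
      then show ?thesis
        unfolding True by (simp only: G_def vec_lambda_beta if_True simp_thms vector_smult_component
            vector_add_component sum_component)
    qed (simp add: G_def du)
  qed
  ultimately have "negligible (G c ` S c b r)" if "b \<in> Basis" for c b r
    using that by (intro negligible_differentiable_image_negligible) auto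
  \<comment> \<open>There are finitely many c and b, and countably many rational r.\<close>
  then have "negligible (\<Union>(c, b, r)\<in>UNIV \<times> Basis \<times> \<rat>. G c ` S c b r)"
    by (intro negligible_countable_Union countable_image countable_SIGMA countable_rat)
      (auto intro: countable_finite)
  then show ?thesis
  proof (rule negligible_subset, safe)
    fix t x c and b :: "complex^'n"
    assume c: "B c x \<noteq> 0" and b: "b \<in> Basis" "fst x \<bullet> b \<in> \<rat>" and eq: "A x + (\<Sum>c\<in>UNIV. B c x *s t $ c) = 0"
    \<comment> \<open>A preimage of t: the same vector with slot c overwritten by the encoded
      x.\<close>
    define u where "u = (\<chi> c'. if c' = c then R x else t $ c')"
    have u: "L (u $ c) = x" by (simp add: u_def L(2))
    have "A x + (\<Sum>c'\<in>UNIV - {c}. B c' x *s u $ c') = A x + (\<Sum>c'\<in>UNIV - {c}. B c' x *s t $ c')"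
      by (simp add: u_def)
    also have "\<dots> = - (B c x *s t $ c)"
      using eq unfolding sum.remove[OF finite UNIV_I, of _ c] eq_neg_iff_add_eq_0 by (simp add: add_ac)
    finally have solved: "A x + (\<Sum>c'\<in>UNIV - {c}. B c' x *s u $ c') = - (B c x *s t $ c)" .
    have "G c u $ c = (- inverse (B c x)) *s (A x + (\<Sum>c'\<in>UNIV - {c}. B c' x *s u $ c'))"
      by (simp only: G_def u vec_lambda_beta if_True simp_thms)
    also have "\<dots> = t $ c"
      unfolding solved using c by (simp add: vec_eq_iff)
    finally have "G c u $ c' = t $ c'" for c'
      by (cases "c' = c") (auto simp: G_def u_def)
    then have "G c u = t"
      by (simp add: vec_eq_iff[of "G c u"])
    moreover have "u \<in> S c b (fst x \<bullet> b)"
      using c by (simp add: S_def u)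
    ultimately have "t \<in> G c ` S c b (fst x \<bullet> b)" by blast
    then show "t \<in> (\<Union>(c, b, r)\<in>UNIV \<times> Basis \<times> \<rat>. G c ` S c b r)"
      using b by blast
  qed
qed

text \<open>
  The exponents \<open>N\<close> and \<open>N + 1\<close> together separate points, and the sums \<open>z $ a + z $ b\<close> make a
  single \<open>pert N c\<close> have a nonzero derivative at \<open>z\<close> in the direction \<open>u\<close>.
\<close>

definition pert :: "nat \<Rightarrow> 'n \<times> 'n \<times> bool \<Rightarrow> complex^'n \<Rightarrow> complex" where
  "pert N = (\<lambda>(a, b, e) z. (z $ a + z $ b) ^ (N + of_bool e))"

definition pert' :: "nat \<Rightarrow> 'n \<times> 'n \<times> bool \<Rightarrow> complex^'n \<Rightarrow> complex^'n \<Rightarrow> complex" where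
  "pert' N = (\<lambda>(a, b, e) z u. of_nat (N + of_bool e) * (u $ a + u $ b) * (z $ a + z $ b) ^ (N + of_bool e - 1))"

lemma has_derivative_pert: "(pert N c has_derivative pert' N c z) (at z)"
proof (cases c)
  case (fields a b e)
  have "((\<lambda>z. z $ a + z $ b) has_derivative (\<lambda>u. u $ a + u $ b)) (at z)" for z :: "complex^'a"
    by (intro has_derivative_add bounded_linear_imp_has_derivative bounded_linear_vec_nth)
  then show ?thesis
    unfolding pert_def pert'_def fields prod.case by (rule has_derivative_power)
qed

lemma power_eq_consecutive:
  fixes x y :: "'a::field"
  assumes "x ^ N = y ^ N" "x ^ (N + 1) = y ^ (N + 1)" "N \<ge> 1"
  shows "x = y"
proof -
  have "x ^ N * (x - y) = 0"
    using assms by (simp add: algebra_simps)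
  then consider "x = y" | "x ^ N = 0" "y ^ N = 0"
    using assms(1) by auto
  then show ?thesis
    by cases auto
qed

lemma pert_separates:
  assumes "w \<noteq> z" "N \<ge> 1"
  shows "\<exists>c. pert N c w - pert N c z \<noteq> 0"
proof (rule ccontr)
  assume neg: "\<not> ?thesis"
  obtain a where a: "w $ a \<noteq> z $ a" using assms(1) by (auto simp: vec_eq_iff)
  define x y where "x = w $ a + w $ a" and "y = z $ a + z $ a"
  have "\<forall>c. pert N c w - pert N c z = 0" using neg by blast
  then have eq: "pert N c w = pert N c z" for c by (metis eq_iff_diff_eq_0)
  have 1: "x ^ N = y ^ N"
    using eq[of "(a, a, False)"] unfolding pert_def x_def y_def by simp
  have 2: "x ^ (N + 1) = y ^ (N + 1)"
    using eq[of "(a, a, True)"] unfolding pert_def x_def y_def by simp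
  have "x = y" using power_eq_consecutive[OF 1 2 assms(2)] .
  then show False using a by (simp add: x_def y_def)
qed

text \<open>z and u may be supported on different coordinates, where powers of a single coordinate
  have zero derivative along u. Suppose all products of z_a + z_b with u_a + u_b vanish. An a with
  z_a nonzero then has u_a = 0, and a b with u_b nonzero has z_b = 0, so the mixed product is z_a
  u_b, a contradiction.\<close>

lemma pert'_nonzero:
  assumes "z \<noteq> 0" "u \<noteq> 0" "N \<ge> 1"
  shows "\<exists>c. pert' N c z u \<noteq> 0"
proof -
  obtain a b where a: "z $ a \<noteq> 0" and b: "u $ b \<noteq> 0" using assms(1,2) by (auto simp: vec_eq_iff)
  have "\<exists>a b. z $ a + z $ b \<noteq> 0 \<and> u $ a + u $ b \<noteq> 0"
  proof (rule ccontr)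
    assume neg: "\<not> ?thesis"
    have "u $ a = 0" using neg a by (metis double_zero_sym mult_2 mult_eq_0_iff zero_neq_numeral)
    moreover have "z $ b = 0" using neg b by (metis double_zero_sym mult_2 mult_eq_0_iff zero_neq_numeral)
    ultimately show False using neg a b by (metis add.left_neutral add.right_neutral)
  qed
  then obtain a b where "z $ a + z $ b \<noteq> 0" "u $ a + u $ b \<noteq> 0" by blast
  then show ?thesis
    using assms(3) by (intro exI[of _ "(a, b, False)"]) (simp add: pert'_def)
qed

text \<open>Double points, as pairs (z, w), and kernel vectors, as pairs (z, u), satisfy equations
  affine in t over the same space of pairs. So \<open>negligible_parameters\<close> handles both,
  and some t avoids the union of the two null sets. The joint differentiability of \<open>F'\<close>
  is assumed because \<open>F'\<close> is the constant term of the second equation.\<close>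

lemma generic_perturbation:
  fixes F :: "complex^'n \<Rightarrow> complex^'p"
  assumes card: "2 * CARD('n) \<le> CARD('p)" and N: "N \<ge> 1"
    and F: "\<And>z. (F has_derivative F' z) (at z)"
    and F': "\<And>x. (\<lambda>x. F' (fst x) (snd x)) differentiable (at x)"
  obtains t :: "complex^'p^('n \<times> 'n \<times> bool)" where
    "\<And>z b. b \<in> Basis \<Longrightarrow> z \<bullet> b \<in> \<rat> \<Longrightarrow> \<not> bad_point UNIV (\<lambda>z. F z + (\<Sum>c\<in>UNIV. pert N c z *s t $ c)) z"
proof -
  define Z1 where "Z1 = {t :: complex^'p^('n \<times> 'n \<times> bool). \<exists>x. (\<exists>c. pert N c (snd x) - pert N c (fst x) \<noteq> 0) \<and>
      (\<exists>b\<in>Basis. fst x \<bullet> b \<in> \<rat>) \<and>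
      (F (snd x) - F (fst x)) + (\<Sum>c\<in>UNIV. (pert N c (snd x) - pert N c (fst x)) *s t $ c) = 0}"
  define Z2 where "Z2 = {t :: complex^'p^('n \<times> 'n \<times> bool). \<exists>x. (\<exists>c. pert' N c (fst x) (snd x) \<noteq> 0) \<and>
      (\<exists>b\<in>Basis. fst x \<bullet> b \<in> \<rat>) \<and>
      F' (fst x) (snd x) + (\<Sum>c\<in>UNIV. pert' N c (fst x) (snd x) *s t $ c) = 0}"
  have dfst: "(\<lambda>x. h (fst x)) differentiable (at x)"
    if "\<And>z. h differentiable (at z)" for h :: "complex^'n \<Rightarrow> 'z::real_normed_vector" and x :: "(complex^'n) \<times> (complex^'n)"
    by (rule differentiable_compose[OF that bounded_linear_imp_differentiable[OF bounded_linear_fst]])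
  have dsnd: "(\<lambda>x. h (snd x)) differentiable (at x)"
    if "\<And>z. h differentiable (at z)" for h :: "complex^'n \<Rightarrow> 'z::real_normed_vector" and x :: "(complex^'n) \<times> (complex^'n)"
    by (rule differentiable_compose[OF that bounded_linear_imp_differentiable[OF bounded_linear_snd]])
  have dF: "F differentiable (at z)" for z using F unfolding differentiable_def by blast
  have dp: "pert N c differentiable (at z)" for c z using has_derivative_pert unfolding differentiable_def by blast
  have dp': "(\<lambda>x. pert' N c (fst x) (snd x)) differentiable (at x)" for c :: "'n \<times> 'n \<times> bool" and x
  proof -
    obtain a b e where c: "c = (a, b, e)" by (cases c)
    have d: "(\<lambda>z :: complex^'n. z $ a + z $ b) differentiable (at z)" for a b z
      by (intro differentiable_add differentiable_vec_nth) simp_all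
    show ?thesis
      unfolding c pert'_def prod.case
      by (intro differentiable_mult differentiable_power differentiable_const dfst[OF d] dsnd[OF d])
  qed
  have "negligible Z1"
    unfolding Z1_def by (rule negligible_parameters[OF card]) (intro differentiable_diff dfst dsnd dF dp)+
  moreover have "negligible Z2"
    unfolding Z2_def by (rule negligible_parameters[OF card]) (intro F' dp')+
  ultimately have "negligible (Z1 \<union> Z2)" by (rule negligible_Un)
  then have "Z1 \<union> Z2 \<noteq> UNIV"
    using non_negligible_UNIV by (intro notI) simp
  then obtain t where t: "t \<notin> Z1" "t \<notin> Z2" by auto
  show thesis
  proof
    fix z b :: "complex^'n" assume b: "b \<in> Basis" "z \<bullet> b \<in> \<rat>"
    let ?g = "\<lambda>z. F z + (\<Sum>c\<in>UNIV. pert N c z *s t $ c)"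
    have 1: "?g w \<noteq> ?g z" if "w \<noteq> z" for w
    proof
      assume eq: "?g w = ?g z"
      have "F w - F z + (\<Sum>c\<in>UNIV. (pert N c w - pert N c z) *s t $ c) = ?g w - ?g z"
        by (simp add: sum_subtractf vector_sub_rdistrib)
      then have "F w - F z + (\<Sum>c\<in>UNIV. (pert N c w - pert N c z) *s t $ c) = 0"
        unfolding eq by simp
      then have "t \<in> Z1"
        unfolding Z1_def using pert_separates[OF that N] b
        by (intro CollectI exI[of _ "(z, w)"]) auto
      with t show False by blast
    qed
    have 2: "D u \<noteq> 0" if D: "(?g has_derivative D) (at z)" and zu: "z \<noteq> 0" "u \<noteq> 0" for D u
    proof
      assume "D u = 0"
      have blv: "bounded_linear (\<lambda>c :: complex. c *s v)" for v :: "complex^'p"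
        unfolding linear_conv_bounded_linear[symmetric]
        by (intro linearI) (auto simp: vec_eq_iff algebra_simps scaleR_conv_of_real[where 'a = complex])
      have "(?g has_derivative (\<lambda>u. F' z u + (\<Sum>c\<in>UNIV. pert' N c z u *s t $ c))) (at z)"
        by (intro has_derivative_add has_derivative_sum F
            bounded_linear.has_derivative[OF blv] has_derivative_pert)
      then have "D = (\<lambda>u. F' z u + (\<Sum>c\<in>UNIV. pert' N c z u *s t $ c))"
        by (rule has_derivative_unique[OF D])
      then have "F' z u + (\<Sum>c\<in>UNIV. pert' N c z u *s t $ c) = 0"
        using \<open>D u = 0\<close> by simp
      then have "t \<in> Z2"
        unfolding Z2_def using pert'_nonzero[OF zu N] b
        by (intro CollectI exI[of _ "(z, u)"]) auto
      with t show False by blast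
    qed
    show "\<not> bad_point UNIV ?g z"
    proof
      assume "bad_point UNIV ?g z"
      then show False
        unfolding bad_point_def by (elim conjE disjE bexE exE) (use 1 2 in blast)+
    qed
  qed
qed

section \<open>Jets of the perturbation\<close>

lemma partial_deriv_eq:
  fixes F :: "complex^'n \<Rightarrow> complex"
  assumes "(F has_derivative D) (at z)" "\<And>c v. D (c *s v) = c * D v"
  shows "partial_deriv i F z = D (axis i 1)"
proof -
  have "(F has_derivative D) (at (z + 0 *s axis i 1))" using assms(1) by simp
  from has_field_derivative_line[OF this assms(2)] show ?thesis
    unfolding partial_deriv_def by (rule DERIV_imp_deriv)
qed

lemma pert'_axis: "M \<ge> 1 \<Longrightarrow> \<exists>\<kappa>. \<forall>z. pert' M c z (axis i 1) = \<kappa> * pert (M - 1) c z"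
proof (cases c)
  case (fields a b e)
  assume "M \<ge> 1"
  then have "M + of_bool e - 1 = M - 1 + of_bool e" by simp
  then show ?thesis
    unfolding fields pert_def pert'_def prod.case
    by (intro exI[of _ "of_nat (M + of_bool e) * (axis i 1 $ a + axis i 1 $ b)"] allI) (simp only:)
qed

text \<open>Each partial derivative carries the span of the \<open>pert N\<close> into the span of
  the \<open>pert (N - 1)\<close>. Only the surviving exponent matters, so the new coefficients stay
  existential.\<close>

lemma foldr_partial_deriv_pert:
  fixes u :: "complex^'n \<Rightarrow> complex"
  assumes u: "hol_germ u" and "length is \<le> N"
  shows "\<exists>\<tau>'. \<forall>\<^sub>F z in nhds 0. foldr partial_deriv is (\<lambda>z. u z + (\<Sum>c\<in>UNIV. \<tau> c * pert N c z)) z =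
    foldr partial_deriv is u z + (\<Sum>c\<in>UNIV. \<tau>' c * pert (N - length is) c z)"
  using assms(2)
proof (induction "is")
  case Nil
  show ?case by (intro exI[of _ \<tau>]) simp
next
  case (Cons i "is")
  define v where "v = foldr partial_deriv is (\<lambda>z. u z + (\<Sum>c\<in>UNIV. \<tau> c * pert N c z))"
  define U where "U = foldr partial_deriv is u"
  define M where "M = N - length is"
  have M: "M \<ge> 1" "N - length (i # is) = M - 1" using Cons.prems by (auto simp: M_def)
  obtain \<tau>' where \<tau>': "\<forall>\<^sub>F z in nhds 0. v z = U z + (\<Sum>c\<in>UNIV. \<tau>' c * pert M c z)"
    using Cons unfolding v_def U_def M_def by auto
  have "\<forall>c. \<exists>\<kappa>. \<forall>z. pert' M c z (axis i 1) = \<kappa> * pert (M - 1) c z"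
    using pert'_axis[OF M(1)] by blast
  from choice[OF this] obtain \<kappa> where \<kappa>: "\<And>c z. pert' M c z (axis i 1) = \<kappa> c * pert (M - 1) c z"
    by blast
  have U: "\<forall>\<^sub>F z in nhds 0. cdiff_at U z"
    using hol_germ_foldr_partial_deriv[OF u] unfolding U_def hol_germ_def by blast
  have "\<forall>\<^sub>F w in nhds 0. \<forall>\<^sub>F z in nhds w. v z = U z + (\<Sum>c\<in>UNIV. \<tau>' c * pert M c z)"
    using \<tau>' by (simp add: eventually_eventually)
  then have "\<forall>\<^sub>F z in nhds 0. partial_deriv i v z =
      partial_deriv i U z + (\<Sum>c\<in>UNIV. \<tau>' c * \<kappa> c * pert (M - 1) c z)"
    using U
  proof eventually_elim
    case (elim w)
    obtain D where D: "(U has_derivative D) (at w)" "\<And>c v. D (c *s v) = c * D v"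
      using elim(2) unfolding cdiff_at_def by blast
    have "partial_deriv i v w = partial_deriv i (\<lambda>z. U z + (\<Sum>c\<in>UNIV. \<tau>' c * pert M c z)) w"
      using elim(1) by (rule partial_deriv_cong)
    also have "\<dots> = D (axis i 1) + (\<Sum>c\<in>UNIV. \<tau>' c * pert' M c w (axis i 1))"
    proof (rule partial_deriv_eq)
      show "((\<lambda>z. U z + (\<Sum>c\<in>UNIV. \<tau>' c * pert M c z)) has_derivative
          (\<lambda>v. D v + (\<Sum>c\<in>UNIV. \<tau>' c * pert' M c w v))) (at w)"
        by (intro has_derivative_add has_derivative_sum has_derivative_mult_right has_derivative_pert D)
      have "pert' M c w (s *s v) = s * pert' M c w v" for c s v
        by (cases c) (simp add: pert'_def algebra_simps)
      then show "D (s *s v) + (\<Sum>c\<in>UNIV. \<tau>' c * pert' M c w (s *s v)) =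
          s * (D v + (\<Sum>c\<in>UNIV. \<tau>' c * pert' M c w v))" for s v
        by (simp add: D(2) distrib_left sum_distrib_left mult.left_commute)
    qed
    also have "D (axis i 1) = partial_deriv i U w"
      using partial_deriv_eq[OF D] by simp
    finally show ?case by (simp add: \<kappa> mult.assoc)
  qed
  then show ?case
    unfolding M(2) by (intro exI[of _ "\<lambda>c. \<tau>' c * \<kappa> c"]) (simp add: v_def U_def)
qed

lemma hol_germ_pert: "hol_germ (pert N c)"
  unfolding pert_def by (cases c) (simp add: hol_germ_power hol_germ_add)

text \<open>After at most r derivatives of \<open>pert (Suc r)\<close> the remaining exponent is at
  least 1, so the contribution at 0 vanishes.\<close>

lemma same_jet_pert:
  fixes f :: "complex^'n \<Rightarrow> complex^'p" and t :: "complex^'p^('n \<times> 'n \<times> bool)"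
  assumes f: "map_germ f"
  shows "same_jet r f (\<lambda>z. f z + (\<Sum>c\<in>UNIV. pert (Suc r) c z *s t $ c))"
    and "map_germ (\<lambda>z. f z + (\<Sum>c\<in>UNIV. pert (Suc r) c z *s t $ c))"
proof -
  have comp: "(f z + (\<Sum>c\<in>UNIV. pert (Suc r) c z *s t $ c)) $ j =
      f z $ j + (\<Sum>c\<in>UNIV. t $ c $ j * pert (Suc r) c z)" for z j
    by (simp add: mult.commute)
  have pert0: "pert k c 0 = 0" if "k \<ge> 1" for k and c :: "'n \<times> 'n \<times> bool"
    using that by (cases c) (simp add: pert_def)
  have hol: "hol_germ (\<lambda>z. f z $ j)" for j using f by (simp add: map_germ_iff)
  show "map_germ (\<lambda>z. f z + (\<Sum>c\<in>UNIV. pert (Suc r) c z *s t $ c))"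
    unfolding map_germ_iff comp
  proof (intro conjI allI)
    show "f 0 + (\<Sum>c\<in>UNIV. pert (Suc r) c 0 *s t $ c) = 0"
      using f by (simp add: pert0 map_germ_def)
    show "hol_germ (\<lambda>z. f z $ j + (\<Sum>c\<in>UNIV. t $ c $ j * pert (Suc r) c z))" for j
      by (intro hol_germ_add hol hol_germ_sum hol_germ_mult hol_germ_const hol_germ_pert)
  qed
  show "same_jet r f (\<lambda>z. f z + (\<Sum>c\<in>UNIV. pert (Suc r) c z *s t $ c))"
    unfolding same_jet_def comp
  proof (intro allI impI)
    fix "is" :: "'n list" and j assume len: "length is \<le> r"
    then have "length is \<le> Suc r" by simp
    from foldr_partial_deriv_pert[OF hol this, of j "\<lambda>c. t $ c $ j"] obtain \<tau>' where
      "\<forall>\<^sub>F z in nhds 0. foldr partial_deriv is (\<lambda>z. f z $ j + (\<Sum>c\<in>UNIV. t $ c $ j * pert (Suc r) c z)) z =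
        foldr partial_deriv is (\<lambda>z. f z $ j) z + (\<Sum>c\<in>UNIV. \<tau>' c * pert (Suc r - length is) c z)"
      by blast
    from eventually_nhds_x_imp_x[OF this]
    show "foldr partial_deriv is (\<lambda>z. f z $ j) 0 =
        foldr partial_deriv is (\<lambda>z. f z $ j + (\<Sum>c\<in>UNIV. t $ c $ j * pert (Suc r) c z)) 0"
      using len by (simp add: pert0)
  qed
qed

text \<open>A polynomial representative of f on the whole space: \<open>generic_perturbation\<close>
  asks for differentiability at every point, while f is controlled only near 0.\<close>

definition monomial_map :: "('p \<Rightarrow> complex) \<Rightarrow> ('p \<Rightarrow> 'n \<Rightarrow> nat) \<Rightarrow> complex^'n \<Rightarrow> complex^'p" where
  "monomial_map C a z = (\<chi> j. C j * (\<Prod>i\<in>UNIV. (z $ i) ^ a j i))"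

definition monomial_deriv :: "('p \<Rightarrow> complex) \<Rightarrow> ('p \<Rightarrow> 'n \<Rightarrow> nat) \<Rightarrow> complex^'n \<Rightarrow> complex^'n \<Rightarrow> complex^'p" where
  "monomial_deriv C a z u = (\<chi> j. C j * (\<Sum>i\<in>UNIV. (of_nat (a j i) * u $ i * (z $ i) ^ (a j i - 1)) *
     (\<Prod>l\<in>UNIV - {i}. (z $ l) ^ a j l)))"

lemma has_derivative_monomial_map:
  fixes C :: "'p::finite \<Rightarrow> complex" and a :: "'p \<Rightarrow> 'n::finite \<Rightarrow> nat"
  shows "(monomial_map C a has_derivative monomial_deriv C a z) (at z)"
proof (rule has_derivative_vec_lambda)
  fix j
  have 1: "((\<lambda>z. (z $ i) ^ k) has_derivative (\<lambda>u. of_nat k * u $ i * (z $ i) ^ (k - 1))) (at z)"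
    for i k and z :: "complex^'n"
    by (rule has_derivative_power, rule bounded_linear_imp_has_derivative, rule bounded_linear_vec_nth)
  have "((\<lambda>z. \<Prod>i\<in>UNIV. (z $ i) ^ a j i) has_derivative
      (\<lambda>u. \<Sum>i\<in>UNIV. (of_nat (a j i) * u $ i * (z $ i) ^ (a j i - 1)) * (\<Prod>l\<in>UNIV - {i}. (z $ l) ^ a j l))) (at z)"
    by (rule has_derivative_prod, rule 1)
  then show "((\<lambda>z. monomial_map C a z $ j) has_derivative (\<lambda>u. monomial_deriv C a z u $ j)) (at z)"
    unfolding monomial_map_def monomial_deriv_def vec_lambda_beta by (rule has_derivative_mult_right)
qed

lemma differentiable_prod:
  fixes f :: "'i \<Rightarrow> 'a::real_normed_vector \<Rightarrow> 'b::real_normed_field"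
  assumes "\<And>i. i \<in> I \<Longrightarrow> f i differentiable (at x within S)"
  shows "(\<lambda>x. \<Prod>i\<in>I. f i x) differentiable (at x within S)"
proof -
  have "\<forall>i\<in>I. \<exists>D. (f i has_derivative D) (at x within S)"
    using assms unfolding differentiable_def by blast
  from bchoice[OF this] obtain D where "\<And>i. i \<in> I \<Longrightarrow> (f i has_derivative D i) (at x within S)"
    by blast
  then have "((\<lambda>x. \<Prod>i\<in>I. f i x) has_derivative (\<lambda>y. \<Sum>i\<in>I. D i y * (\<Prod>j\<in>I - {i}. f j x))) (at x within S)"
    by (rule has_derivative_prod)
  then show ?thesis
    unfolding differentiable_def by blast
qed

lemma differentiable_monomial_deriv:
  fixes C :: "'p::finite \<Rightarrow> complex" and a :: "'p \<Rightarrow> 'n::finite \<Rightarrow> nat"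
  shows "(\<lambda>x. monomial_deriv C a (fst x) (snd x)) differentiable (at x)"
proof (rule differentiable_vec_lambda)
  have f: "(\<lambda>x :: (complex^'n) \<times> (complex^'n). fst x $ l) differentiable (at x)" for l x
    by (rule differentiable_vec_nth, rule bounded_linear_imp_differentiable, rule bounded_linear_fst)
  have s: "(\<lambda>x :: (complex^'n) \<times> (complex^'n). snd x $ l) differentiable (at x)" for l x
    by (rule differentiable_vec_nth, rule bounded_linear_imp_differentiable, rule bounded_linear_snd)
  show "(\<lambda>x. monomial_deriv C a (fst x) (snd x) $ j) differentiable (at x)" for j
    unfolding monomial_deriv_def vec_lambda_beta
    by (intro differentiable_mult differentiable_const differentiable_sum ballI finite differentiable_prod
        differentiable_power f s)
qed

lemma A_finite_imp_not_bad_axis: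
  fixes f :: "complex^'n \<Rightarrow> complex^'p"
  assumes card: "2 * CARD('n) \<le> CARD('p)" and f: "map_germ f" "A_finite f"
    and mono: "\<forall>\<^sub>F z in nhds 0. f z = monomial_map C a z"
  shows "\<not> bad_axis f i"
proof
  assume bad: "bad_axis f i"
  obtain r where r: "\<forall>g. map_germ g \<and> same_jet r f g \<longrightarrow> A_equivalent f g"
    using f(2) unfolding A_finite_def by (elim exE)
  have "Suc r \<ge> 1" by simp
  obtain t :: "complex^'p^('n \<times> 'n \<times> bool)" where
    t: "\<And>z b. b \<in> Basis \<Longrightarrow> z \<bullet> b \<in> \<rat> \<Longrightarrow>
      \<not> bad_point UNIV (\<lambda>z. monomial_map C a z + (\<Sum>c\<in>UNIV. pert (Suc r) c z *s t $ c)) z"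
    by (rule generic_perturbation[OF card \<open>Suc r \<ge> 1\<close> has_derivative_monomial_map differentiable_monomial_deriv])
      (rule that)
  let ?g = "\<lambda>z. f z + (\<Sum>c\<in>UNIV. pert (Suc r) c z *s t $ c)"
  let ?G = "\<lambda>z. monomial_map C a z + (\<Sum>c\<in>UNIV. pert (Suc r) c z *s t $ c)"
  have "A_equivalent f ?g"
    by (rule r[rule_format, OF conjI[OF same_jet_pert(2) same_jet_pert(1)]]) (rule f(1))+
  \<comment> \<open>On \<open>V\<close> the germ agrees with its polynomial representative. Both
    points of a double pair lie in \<open>V\<close>, so bad points of \<open>?g\<close> are bad for
    \<open>?G\<close>.\<close>
  obtain V where V: "open V" "0 \<in> V" "\<And>z. z \<in> V \<Longrightarrow> f z = monomial_map C a z"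
    using mono unfolding eventually_nhds by blast
  have evV: "\<forall>\<^sub>F z in nhds 0. z \<in> V"
    using V by (intro eventually_nhds_in_open)
  obtain \<gamma> \<epsilon> where \<gamma>: "\<epsilon> > (0::real)" "continuous_on {0..\<epsilon>} \<gamma>" "\<gamma> 0 = 0"
    "\<And>s. 0 < s \<Longrightarrow> s \<le> \<epsilon> \<Longrightarrow> bad_point V ?g (\<gamma> s)"
    by (rule bad_points_along_curve[OF \<open>A_equivalent f ?g\<close> f(1) bad evV]) (rule that)
  have "\<gamma> \<epsilon> \<noteq> 0" using \<gamma>(4)[of \<epsilon>] \<gamma>(1) by (simp add: bad_point_def)
  obtain s b where s: "0 < s" "s \<le> \<epsilon>" "b \<in> Basis" "\<gamma> s \<bullet> b \<in> \<rat>"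
    by (rule continuous_curve_rational_coordinate[OF \<gamma>(1-3) \<open>\<gamma> \<epsilon> \<noteq> 0\<close>]) (rule that)
  let ?z = "\<gamma> s"
  have bp: "bad_point V ?g ?z" using \<gamma>(4) s by blast
  then have z: "?z \<in> V" "?z \<noteq> 0" by (auto simp: bad_point_def)
  have eq: "?g w = ?G w" if "w \<in> V" for w using V(3)[OF that] by simp
  have "(\<exists>w\<in>V. w \<noteq> ?z \<and> ?g w = ?g ?z) \<or> (\<exists>D u. (?g has_derivative D) (at ?z) \<and> u \<noteq> 0 \<and> D u = 0)"
    using bp unfolding bad_point_def by blast
  then have "bad_point UNIV ?G ?z"
  proof
    assume "\<exists>w\<in>V. w \<noteq> ?z \<and> ?g w = ?g ?z"
    then obtain w where "w \<in> V" "w \<noteq> ?z" "?g w = ?g ?z" by blast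
    then have "?G w = ?G ?z" using eq z(1) by simp
    with z(2) \<open>w \<noteq> ?z\<close> show ?thesis unfolding bad_point_def by blast
  next
    assume "\<exists>D u. (?g has_derivative D) (at ?z) \<and> u \<noteq> 0 \<and> D u = 0"
    then obtain D u where D: "(?g has_derivative D) (at ?z)" "u \<noteq> 0" "D u = 0" by blast
    have "(?G has_derivative D) (at ?z)"
      by (rule has_derivative_transform_within_open[OF D(1) V(1) z(1) eq])
    with z(2) D(2,3) show ?thesis unfolding bad_point_def by blast
  qed
  with t[OF s(3,4)] show False by blast
qed


subsection \<open>Monomial germs\<close>

lemma pos_inv_pos:
  assumes "1 \<le> j" "j \<le> CARD('i)"
  shows "pos (inv pos j :: 'i::{finite,linorder}) = j"
proof -
  have "j \<in> range (pos :: 'i \<Rightarrow> nat)"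
    using assms bij_betw_pos[where 'i = 'i] by (auto simp: bij_betw_def)
  then show ?thesis by (rule f_inv_into_f)
qed

lemma inv_pos_pos [simp]: "inv pos (pos i) = i"
  using bij_betw_pos by (intro inv_f_f) (auto simp: bij_betw_def)

lemma pos_bounds: "1 \<le> pos i" "pos (i :: 'i) \<le> CARD('i::{finite,linorder})"
  using bij_betw_pos[where 'i = 'i] by (auto simp: bij_betw_def)

lemma coord_pos: "coord z (pos i) = z $ i"
  by (simp add: coord_def)

lemma vec_eq_coordI:
  fixes z w :: "complex^'n::{finite,linorder}"
  assumes "\<And>j. 1 \<le> j \<Longrightarrow> j \<le> CARD('n) \<Longrightarrow> coord z j = coord w j"
  shows "z = w"
  unfolding vec_eq_iff by (metis assms coord_pos pos_bounds)

lemma has_derivative_coord: "((\<lambda>z. coord z j) has_derivative (\<lambda>u. coord u j)) (at z)"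
  unfolding coord_def by (rule bounded_linear_imp_has_derivative[OF bounded_linear_vec_nth])

lemma coord_0 [simp]: "coord 0 j = 0"
  by (simp add: coord_def)

text \<open>All powers beyond the conductor agree, in particular two consecutive ones, and those
  determine the base.\<close>

lemma power_eq_imp_eq_Gcd:
  fixes x y :: complex
  assumes M: "finite M" "Gcd M = 1" and eq: "\<And>e. e \<in> M \<Longrightarrow> x ^ e = y ^ e"
  shows "x = y"
proof -
  obtain c where c: "\<And>b. b \<ge> c \<Longrightarrow> \<exists>e. b = (\<Sum>m\<in>M. e m * m)"
    using numerical_semigroup_conductor[OF M] by blast
  have "x ^ b = y ^ b" if b: "b \<ge> c" for b
  proof -
    obtain e where "b = (\<Sum>m\<in>M. e m * m)" using c[OF b] by blast
    then show ?thesis using eq by (simp add: nat_semigroup_power_sum)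
  qed
  then have "x ^ (c + 1) = y ^ (c + 1)" "x ^ (c + 1 + 1) = y ^ (c + 1 + 1)"
    by (simp_all only: le_add1 add.assoc)
  then show ?thesis
    by (rule power_eq_consecutive) simp
qed

lemma coord_I_phi_H:
  fixes z :: "complex^'n::{finite,linorder}"
  assumes "CARD('n) = n" "1 \<le> j" "j \<le> CARD('p)"
  shows "coord (I_phi_H k m l z :: complex^'p::{finite,linorder}) j =
    (if j \<le> n - 1 then coord z j
     else if j \<le> n - 1 + k then coord z n ^ m (j - (n - 1))
     else coord z (j - (n - 1 + k)) ^ l (j - (n - 1 + k)) * coord z n)"
  unfolding I_phi_H_def Let_def coord_of_coords[OF assms(2,3)] assms(1) ..

text \<open>The first block recovers x and the coprime powers recover y, so there are no double
  points. A kernel vector has no x part, so its y part is nonzero. As m 1 > 1, the component y^(m 1)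
  then forces y = 0, and the components x_i^(l i) y force every x_i to vanish. Only the origin is
  left.\<close>

lemma not_bad_point_I_phi_H:
  fixes z :: "complex^'n::{finite,linorder}"
  assumes n: "n \<ge> 2" "CARD('n) = n" and k: "k \<ge> 1" and p: "CARD('p) = 2 * n + k - 2"
    and m: "1 < m 1" "Gcd (m ` {1..k}) = 1" and l: "\<And>i. i \<in> {1..n - 1} \<Longrightarrow> l i \<ge> 1"
  shows "\<not> bad_point UNIV (I_phi_H k m l :: complex^'n::{finite,linorder} \<Rightarrow> complex^'p::{finite,linorder}) z"
proof
  let ?h = "I_phi_H k m l :: complex^'n::{finite,linorder} \<Rightarrow> complex^'p::{finite,linorder}"
  note h = coord_I_phi_H[OF n(2), where 'p = 'p and k = k and m = m and l = l]
  have hx: "coord (?h z) j = coord z j" if "1 \<le> j" "j \<le> n - 1" for j z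
    using h[of j z] that n p by simp
  have hy: "coord (?h z) (n - 1 + e) = coord z n ^ m e" if "1 \<le> e" "e \<le> k" for e z
  proof -
    have "1 \<le> n - 1 + e" "n - 1 + e \<le> CARD('p)" "\<not> n - 1 + e \<le> n - 1" "n - 1 + e \<le> n - 1 + k"
      "n - 1 + e - (n - 1) = e"
      using that n p by linarith+
    with h[of "n - 1 + e" z] show ?thesis by (simp only: if_True if_False)
  qed
  have hw: "coord (?h z) (n - 1 + k + i) = coord z i ^ l i * coord z n" if "1 \<le> i" "i \<le> n - 1" for i z
  proof -
    have "1 \<le> n - 1 + k + i" "n - 1 + k + i \<le> CARD('p)" "\<not> n - 1 + k + i \<le> n - 1"
      "\<not> n - 1 + k + i \<le> n - 1 + k" "n - 1 + k + i - (n - 1 + k) = i"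
      using that n p k by linarith+
    with h[of "n - 1 + k + i" z] show ?thesis by (simp only: if_True if_False)
  qed
  assume "bad_point UNIV ?h z"
  then have z: "z \<noteq> 0" and bad: "(\<exists>w\<in>UNIV. w \<noteq> z \<and> ?h w = ?h z) \<or>
      (\<exists>D u. (?h has_derivative D) (at z) \<and> u \<noteq> 0 \<and> D u = 0)"
    unfolding bad_point_def by blast+
  from bad show False
  proof
    assume "\<exists>w\<in>UNIV. w \<noteq> z \<and> ?h w = ?h z"
    then obtain w where w: "w \<noteq> z" "?h w = ?h z" by blast
    have 1: "coord w j = coord z j" if "1 \<le> j" "j \<le> n - 1" for j
      using hx[OF that, of w] hx[OF that, of z] w(2) by simp
    have "coord w n = coord z n"
    proof (rule power_eq_imp_eq_Gcd[OF _ m(2)])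
      fix e assume "e \<in> m ` {1..k}"
      then obtain e' where e': "1 \<le> e'" "e' \<le> k" "e = m e'" by auto
      then show "coord w n ^ e = coord z n ^ e"
        using hy[OF e'(1,2), of w] hy[OF e'(1,2), of z] w(2) by simp
    qed simp
    then have "w = z"
    proof (intro vec_eq_coordI)
      fix j assume "coord w n = coord z n" "1 \<le> j" "j \<le> CARD('n)"
      then show "coord w j = coord z j"
        using 1[of j] n by (cases "j = n") auto
    qed
    with w show False by simp
  next
    assume "\<exists>D u. (?h has_derivative D) (at z) \<and> u \<noteq> 0 \<and> D u = 0"
    then obtain D u where D: "(?h has_derivative D) (at z)" "u \<noteq> 0" "D u = 0" by blast
    have comp: "((\<lambda>z. coord (?h z) j) has_derivative (\<lambda>v. coord (D v) j)) (at z)" for j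
      unfolding coord_def by (rule has_derivative_vec_nth[OF D(1)])
    have unique: "E u = 0" if "((\<lambda>z. coord (?h z) j) has_derivative E) (at z)" for E j
    proof -
      have "E = (\<lambda>v. coord (D v) j)" by (rule has_derivative_unique[OF that comp])
      then show ?thesis using D(3) by simp
    qed
    have ux: "coord u j = 0" if "1 \<le> j" "j \<le> n - 1" for j
      by (rule unique[of j "\<lambda>u. coord u j"]) (simp only: hx[OF that] has_derivative_coord)
    have uy: "coord u n \<noteq> 0"
    proof
      assume "coord u n = 0"
      have "u = 0"
      proof (rule vec_eq_coordI)
        fix j assume "1 \<le> j" "j \<le> CARD('n)"
        then show "coord u j = coord 0 j"
          using ux[of j] \<open>coord u n = 0\<close> n by (cases "j = n") auto
      qed
      with D(2) show False ..
    qed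
    have "of_nat (m 1) * coord u n * coord z n ^ (m 1 - 1) = 0"
    proof (rule unique[of "n - 1 + 1" "\<lambda>u. of_nat (m 1) * coord u n * coord z n ^ (m 1 - 1)"])
      show "((\<lambda>z. coord (?h z) (n - 1 + 1)) has_derivative
          (\<lambda>u. of_nat (m 1) * coord u n * coord z n ^ (m 1 - 1))) (at z)"
        unfolding hy[OF order_refl k] by (rule has_derivative_power[OF has_derivative_coord])
    qed
    then have zy: "coord z n = 0" using uy m(1) by auto
    have zx: "coord z i = 0" if i: "1 \<le> i" "i \<le> n - 1" for i
    proof -
      have "coord z i ^ l i * coord u n + of_nat (l i) * coord u i * coord z i ^ (l i - 1) * coord z n = 0"
      proof (rule unique[of "n - 1 + k + i" "\<lambda>u. coord z i ^ l i * coord u n +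
          of_nat (l i) * coord u i * coord z i ^ (l i - 1) * coord z n"])
        show "((\<lambda>z. coord (?h z) (n - 1 + k + i)) has_derivative (\<lambda>u. coord z i ^ l i * coord u n +
          of_nat (l i) * coord u i * coord z i ^ (l i - 1) * coord z n)) (at z)"
          unfolding hw[OF i]
          by (rule has_derivative_mult[OF has_derivative_power[OF has_derivative_coord] has_derivative_coord])
      qed
      then show ?thesis using zy uy by simp
    qed
    have "z = 0"
    proof (rule vec_eq_coordI)
      fix j assume "1 \<le> j" "j \<le> CARD('n)"
      then show "coord z j = coord 0 j"
        using zx[of j] zy n by (cases "j = n") auto
    qed
    with z show False ..
  qed
qed

section \<open>Bad axes of monomial germs\<close>

lemma prod_axis_power:
  "(\<Prod>l\<in>UNIV. (axis i s $ l) ^ e l) = (if \<forall>l. l \<noteq> i \<longrightarrow> e l = 0 then (s :: complex) ^ e i else 0)"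
proof -
  have "(\<Prod>l\<in>UNIV. (axis i s $ l) ^ e l) = s ^ e i * (\<Prod>l\<in>UNIV - {i}. (0 :: complex) ^ e l)"
    by (subst prod.remove[of _ i]) (auto simp: axis_def intro!: prod.cong)
  also have "(\<Prod>l\<in>UNIV - {i}. (0 :: complex) ^ e l) = (if \<forall>l. l \<noteq> i \<longrightarrow> e l = 0 then 1 else 0)"
    by (auto simp: power_0_left)
  finally show ?thesis by auto
qed

text \<open>Two sample points with ratio 2 suffice to compare the exponents of two
  monomials.\<close>

lemma eventually_nhds_0_real:
  assumes "\<forall>\<^sub>F s in nhds (0::complex). P s"
  obtains x where "x \<noteq> 0" "P x" "P (x / 2)"
proof -
  obtain d where "d > 0" "\<And>s. dist s 0 < d \<Longrightarrow> P s"
    using assms unfolding eventually_nhds_metric by blast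
  then show thesis
    by (intro that[of "of_real (d / 2)"]) auto
qed

lemma monomial_germ_eq_power:
  fixes C :: complex
  assumes "\<forall>\<^sub>F s in nhds 0. C * s ^ a = s ^ b"
  shows "C = 1" "a = b"
proof -
  obtain x where x: "x \<noteq> 0" "C * x ^ a = x ^ b" "C * (x / 2) ^ a = (x / 2) ^ b"
    using eventually_nhds_0_real[OF assms] by blast
  have "x ^ b * 2 ^ b = x ^ b * 2 ^ a"
    using x by (auto simp: power_divide field_simps)
  then have "(2::complex) ^ b = 2 ^ a" using x(1) by simp
  then have "norm ((2::complex) ^ b) = norm ((2::complex) ^ a)" by simp
  then have "(2::real) ^ b = 2 ^ a" by (simp add: norm_power)
  then show "a = b" by simp
  with x show "C = 1" by simp
qed

lemma nontrivial_root_of_unity: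
  assumes "b \<noteq> 1"
  obtains \<zeta> :: complex where "\<zeta> \<noteq> 1" "\<zeta> ^ b = 1"
proof (cases "b = 0")
  case True
  \<comment> \<open>Since \<open>0 ^ 0 = 1\<close>, the value 0 serves here.\<close>
  then show thesis using that[of 0] by simp
next
  case False
  then have "card {z::complex. z ^ b = 1} = b" "b \<ge> 2"
    using assms by (auto intro: card_roots_unity_eq)
  then have "\<not> {z::complex. z ^ b = 1} \<subseteq> {1}"
    by (metis card_mono card.empty card.insert empty_iff finite.intros One_nat_def not_numeral_le_zero
        numeral_2_eq_2 le_trans Suc_n_not_le_n)
  then show thesis using that by blast
qed

text \<open>Along the axis every monomial that involves another variable vanishes, so only the pure
  powers have to be invariant under scaling by \<open>\<zeta>\<close>.\<close>

lemma bad_axisI_root: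
  fixes f :: "complex^'n \<Rightarrow> complex^'p" and \<zeta> :: complex
  assumes mono: "\<forall>\<^sub>F z in nhds 0. f z = monomial_map C a z"
    and \<zeta>: "\<zeta> \<noteq> 1" "\<And>j. C j \<noteq> 0 \<Longrightarrow> \<forall>l. l \<noteq> i \<longrightarrow> a j l = 0 \<Longrightarrow> \<zeta> ^ a j i = 1"
  shows "bad_axis f i"
  unfolding bad_axis_def
proof (intro disjI1 exI conjI)
  have eq: "monomial_map C a (axis i (\<zeta> * s)) = monomial_map C a (axis i s)" for s :: complex
    unfolding monomial_map_def prod_axis_power using \<zeta>(2) by (auto simp: vec_eq_iff power_mult_distrib)
  have "\<forall>\<^sub>F s in nhds 0. f (axis i (\<zeta> * s)) = monomial_map C a (axis i (\<zeta> * s))"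
    using mono filterlim_axis by (rule eventually_compose_filterlim)
  moreover have "\<forall>\<^sub>F s in nhds 0. f (axis i (1 * s)) = monomial_map C a (axis i (1 * s))"
    using mono filterlim_axis by (rule eventually_compose_filterlim)
  ultimately show "\<forall>\<^sub>F s in nhds 0. f (axis i (\<zeta> * s)) = f (axis i s)"
    by eventually_elim (simp add: eq)
qed (rule \<zeta>)

text \<open>The kernel vector is the y direction. Along the i-axis a y-derivative survives only for
  a monomial that is linear in y and otherwise involves just the i-th coordinate.\<close>

lemma bad_axisI_derivative:
  fixes f :: "complex^'n \<Rightarrow> complex^'p"
  assumes mono: "\<forall>\<^sub>F z in nhds 0. f z = monomial_map C a z" and "i \<noteq> y"
    and no: "\<And>j. C j \<noteq> 0 \<Longrightarrow> a j y = 1 \<Longrightarrow> \<exists>l. l \<noteq> i \<and> l \<noteq> y \<and> a j l \<noteq> 0"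
  shows "bad_axis f i"
  unfolding bad_axis_def
proof (intro disjI2 exI conjI)
  show "(axis y 1 :: complex^'n) \<noteq> 0" by (simp add: axis_eq_0_iff)
  have zero: "monomial_deriv C a (axis i s) (axis y 1) = 0" for s
  proof -
    have "C j * (\<Sum>i'\<in>UNIV. (of_nat (a j i') * axis y 1 $ i' * (axis i s $ i') ^ (a j i' - 1)) *
        (\<Prod>l\<in>UNIV - {i'}. (axis i s $ l) ^ a j l)) = 0" for j
    proof -
      have "(\<Sum>i'\<in>UNIV. (of_nat (a j i') * axis y 1 $ i' * (axis i s $ i') ^ (a j i' - 1)) *
          (\<Prod>l\<in>UNIV - {i'}. (axis i s $ l) ^ a j l)) =
          of_nat (a j y) * 0 ^ (a j y - 1) * (\<Prod>l\<in>UNIV - {y}. (axis i s $ l) ^ a j l)"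
        using \<open>i \<noteq> y\<close> by (subst sum.remove[of _ y]) (auto simp: axis_def)
      moreover have "(\<Prod>l\<in>UNIV - {y}. (axis i s $ l) ^ a j l) = 0" if "C j \<noteq> 0" "a j y = 1"
      proof -
        obtain l where "l \<noteq> i" "l \<noteq> y" "a j l \<noteq> 0" using no[OF \<open>C j \<noteq> 0\<close> \<open>a j y = 1\<close>] by blast
        then show ?thesis
          by (intro prod_zero) (auto simp: axis_def intro!: bexI[of _ l])
      qed
      \<comment> \<open>Exponent 0 kills the derivative through the factor \<open>of_nat\<close>, an
        exponent above 1 through the value y = 0 on the axis.\<close>
      moreover have "a j y = 0 \<or> a j y = 1 \<or> (0::complex) ^ (a j y - 1) = 0"
        by (auto simp: power_0_left)
      ultimately show ?thesis by (cases "C j = 0"; cases "a j y = 1") auto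
    qed
    then show ?thesis
      unfolding monomial_deriv_def by (simp only: vec_eq_iff vec_lambda_beta zero_index simp_thms)
  qed
  have "\<forall>\<^sub>F z in nhds 0. \<forall>\<^sub>F w in nhds z. f w = monomial_map C a w"
    using mono by (simp add: eventually_eventually)
  from eventually_compose_filterlim[OF this filterlim_axis[of i 1]]
  show "\<forall>\<^sub>F s in nhds 0. \<exists>D. (f has_derivative D) (at (axis i s)) \<and> D (axis y 1) = 0"
  proof eventually_elim
    case (elim s)
    have ev: "\<forall>\<^sub>F w in nhds (axis i s). f w = monomial_map C a w" using elim by simp
    have "(f has_derivative monomial_deriv C a (axis i s)) (at (axis i s))"
    proof (rule has_derivative_transform_eventually[OF has_derivative_monomial_map])
      show "\<forall>\<^sub>F w in at (axis i s). monomial_map C a w = f w"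
        using ev by (auto simp: eventually_at_filter elim: eventually_mono)
    qed (simp_all add: eventually_nhds_x_imp_x[OF ev])
    with zero show ?case by blast
  qed
qed

text \<open>A counting argument. For each i other than y, the lack of a bad axis yields a slot
  \<open>jx i\<close> with a pure power of the i-th coordinate and a slot \<open>jw i\<close> with
  such a power times y. All these slots are distinct and lie in \<open>P\<close>, because the slots
  outside \<open>P\<close> carry powers of y alone; as \<open>P\<close> has exactly twice as many
  elements as there are i, they exhaust it.\<close>

lemma monomial_components_of_not_bad_axis:
  fixes f :: "complex^'n \<Rightarrow> complex^'p" and y :: 'n
  assumes mono: "\<forall>\<^sub>F z in nhds 0. f z = monomial_map C a z" and f0: "f 0 = 0"
    and yaxis: "\<And>j. \<forall>\<^sub>F s in nhds 0. f (axis y s) $ j = (if j \<in> P then 0 else s ^ \<mu> j)"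
    and \<mu>: "\<And>j. j \<notin> P \<Longrightarrow> \<mu> j \<noteq> 1"
    and P: "card P = 2 * card {i. i \<noteq> y}"
    and good: "\<And>i. i \<noteq> y \<Longrightarrow> \<not> bad_axis f i"
  obtains jx jw where
    "\<And>i. i \<noteq> y \<Longrightarrow> C (jx i) \<noteq> 0 \<and> a (jx i) i = 1 \<and> (\<forall>l. l \<noteq> i \<longrightarrow> a (jx i) l = 0)"
    "\<And>i. i \<noteq> y \<Longrightarrow> C (jw i) \<noteq> 0 \<and> a (jw i) y = 1 \<and> a (jw i) i \<ge> 1 \<and>
      (\<forall>l. l \<noteq> i \<and> l \<noteq> y \<longrightarrow> a (jw i) l = 0)"
    "P = jx ` {i. i \<noteq> y} \<union> jw ` {i. i \<noteq> y}"
    "\<And>j. j \<notin> P \<Longrightarrow> C j = 1 \<and> a j y = \<mu> j \<and> (\<forall>l. l \<noteq> y \<longrightarrow> a j l = 0)"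
proof -
  let ?I = "{i. i \<noteq> y}"
  have ycomp: "\<forall>\<^sub>F s in nhds 0. C j * (if \<forall>l. l \<noteq> y \<longrightarrow> a j l = 0 then s ^ a j y else 0) =
      (if j \<in> P then 0 else s ^ \<mu> j)" for j
  proof -
    have "\<forall>\<^sub>F s in nhds 0. f (axis y (1 * s)) = monomial_map C a (axis y (1 * s))"
      using mono filterlim_axis by (rule eventually_compose_filterlim)
    with yaxis[of j] show ?thesis
    proof eventually_elim
      case (elim s)
      have "f (axis y s) $ j = C j * (if \<forall>l. l \<noteq> y \<longrightarrow> a j l = 0 then s ^ a j y else 0)"
        using elim(2) by (simp only: mult_1 monomial_map_def prod_axis_power vec_lambda_beta)
      with elim(1) show ?case by simp
    qed
  qed
  have notP: "C j = 1 \<and> a j y = \<mu> j \<and> (\<forall>l. l \<noteq> y \<longrightarrow> a j l = 0)" if j: "j \<notin> P" for j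
  proof -
    obtain s where s: "s \<noteq> 0"
      "C j * (if \<forall>l. l \<noteq> y \<longrightarrow> a j l = 0 then s ^ a j y else 0) = (if j \<in> P then 0 else s ^ \<mu> j)"
      by (rule eventually_nhds_0_real[OF ycomp[of j]])
    have pure: "\<forall>l. l \<noteq> y \<longrightarrow> a j l = 0"
    proof (rule ccontr)
      assume neg: "\<not> ?thesis"
      have "0 = s ^ \<mu> j" using s(2) j by (simp only: neg if_False mult_zero_right)
      with s(1) show False by simp
    qed
    have "\<forall>\<^sub>F s in nhds 0. C j * s ^ a j y = s ^ \<mu> j"
      using ycomp[of j] pure j by simp
    from monomial_germ_eq_power[OF this] pure show ?thesis by simp
  qed
  have inP: "\<not> (\<forall>l. l \<noteq> y \<longrightarrow> a j l = 0)" if j: "j \<in> P" "C j \<noteq> 0" for j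
  proof
    assume pure: "\<forall>l. l \<noteq> y \<longrightarrow> a j l = 0"
    have "\<forall>\<^sub>F s in nhds 0. C j * s ^ a j y = 0"
      using ycomp[of j] pure j(1) by simp
    then obtain s where "s \<noteq> 0" "C j * s ^ a j y = 0"
      by (rule eventually_nhds_0_real)
    with j(2) show False by simp
  qed
  have nonconst: "\<exists>l. a j l \<noteq> 0" if "C j \<noteq> 0" for j
  proof (rule ccontr)
    assume "\<nexists>l. a j l \<noteq> 0"
    then have "monomial_map C a 0 $ j = C j" by (simp add: monomial_map_def)
    moreover have "monomial_map C a 0 = 0"
      using eventually_nhds_x_imp_x[OF mono] f0 by simp
    ultimately show False using that by simp
  qed
  have X: "\<exists>j. C j \<noteq> 0 \<and> a j i \<ge> 1 \<and> (\<forall>l. l \<noteq> i \<longrightarrow> a j l = 0)" if i: "i \<in> ?I" for i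
  proof -
    have "\<exists>j. C j \<noteq> 0 \<and> (\<forall>l. l \<noteq> i \<longrightarrow> a j l = 0)"
    proof (rule ccontr)
      assume "\<not> ?thesis"
      \<comment> \<open>Without a pure power of the i-th coordinate f vanishes along that axis, and
        any \<open>\<zeta>\<close> other than 1 works.\<close>
      then have "bad_axis f i"
        by (intro bad_axisI_root[OF mono, of "-1"]) auto
      with good i show False by simp
    qed
    then obtain j where j: "C j \<noteq> 0" "\<forall>l. l \<noteq> i \<longrightarrow> a j l = 0" by blast
    then have "a j i \<noteq> 0" using nonconst[of j] by metis
    with j show ?thesis by (intro exI[of _ j]) simp
  qed
  have W: "\<exists>j. C j \<noteq> 0 \<and> a j y = 1 \<and> a j i \<ge> 1 \<and> (\<forall>l. l \<noteq> i \<and> l \<noteq> y \<longrightarrow> a j l = 0)" if i: "i \<in> ?I" for i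
  proof -
    have "\<exists>j. C j \<noteq> 0 \<and> a j y = 1 \<and> (\<forall>l. l \<noteq> i \<and> l \<noteq> y \<longrightarrow> a j l = 0)"
    proof (rule ccontr)
      assume "\<not> ?thesis"
      then have "bad_axis f i"
        using i by (intro bad_axisI_derivative[OF mono, of i y]) auto
      with good i show False by simp
    qed
    then obtain j where j: "C j \<noteq> 0" "a j y = 1" "\<forall>l. l \<noteq> i \<and> l \<noteq> y \<longrightarrow> a j l = 0" by blast
    \<comment> \<open>Otherwise the component would be a multiple of y, which the prescribed
      restriction to the y-axis excludes because no \<open>\<mu> j\<close> with j outside
      \<open>P\<close> equals 1.\<close>
    have "a j i \<noteq> 0"
    proof
      assume "a j i = 0"
      then have "\<forall>l. l \<noteq> y \<longrightarrow> a j l = 0" using j(3) by metis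
      then have "j \<notin> P" using inP[of j] j(1) by blast
      then show False using notP[of j] \<mu>[of j] j(2) by simp
    qed
    with j show ?thesis by (intro exI[of _ j]) simp
  qed
  from X have "\<forall>i\<in>?I. \<exists>j. C j \<noteq> 0 \<and> a j i \<ge> 1 \<and> (\<forall>l. l \<noteq> i \<longrightarrow> a j l = 0)" by (rule ballI)
  from bchoice[OF this] obtain jx where
    jx: "\<forall>i\<in>?I. C (jx i) \<noteq> 0 \<and> a (jx i) i \<ge> 1 \<and> (\<forall>l. l \<noteq> i \<longrightarrow> a (jx i) l = 0)" by (elim exE)
  from W have "\<forall>i\<in>?I. \<exists>j. C j \<noteq> 0 \<and> a j y = 1 \<and> a j i \<ge> 1 \<and> (\<forall>l. l \<noteq> i \<and> l \<noteq> y \<longrightarrow> a j l = 0)"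
    by (rule ballI)
  from bchoice[OF this] obtain jw where
    jw: "\<forall>i\<in>?I. C (jw i) \<noteq> 0 \<and> a (jw i) y = 1 \<and> a (jw i) i \<ge> 1 \<and>
      (\<forall>l. l \<noteq> i \<and> l \<noteq> y \<longrightarrow> a (jw i) l = 0)" by (elim exE)
  have jxP: "jx i \<in> P" if "i \<in> ?I" for i
  proof (rule ccontr)
    assume "jx i \<notin> P"
    then have "a (jx i) i = 0" using notP that by simp
    with bspec[OF jx that] show False by simp
  qed
  have jwP: "jw i \<in> P" if "i \<in> ?I" for i
  proof (rule ccontr)
    assume "jw i \<notin> P"
    then have "a (jw i) i = 0" using notP that by simp
    with bspec[OF jw that] show False by simp
  qed
  have jx_eq: "i = i'" if "i \<in> ?I" "i' \<in> ?I" "jx i = jx i'" for i i'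
  proof (rule ccontr)
    assume "i \<noteq> i'"
    then have "a (jx i) i' = 0" using bspec[OF jx that(1)] by simp
    with bspec[OF jx that(2)] that(3) show False by simp
  qed
  have jw_eq: "i = i'" if "i \<in> ?I" "i' \<in> ?I" "jw i = jw i'" for i i'
  proof (rule ccontr)
    assume "i \<noteq> i'"
    then have "a (jw i) i' = 0" using bspec[OF jw that(1)] that(2) by simp
    with bspec[OF jw that(2)] that(3) show False by simp
  qed
  have jxw: "jx i \<noteq> jw i'" if "i \<in> ?I" "i' \<in> ?I" for i i'
  proof
    assume "jx i = jw i'"
    moreover have "a (jx i) y = 0" using bspec[OF jx that(1)] that(1) by simp
    ultimately show False using bspec[OF jw that(2)] by simp
  qed
  have "card (jx ` ?I \<union> jw ` ?I) = card (jx ` ?I) + card (jw ` ?I)"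
    using jxw by (intro card_Un_disjoint) auto
  also have "card (jx ` ?I) = card ?I"
    by (intro card_image inj_onI) (rule jx_eq)
  also have "card (jw ` ?I) = card ?I"
    by (intro card_image inj_onI) (rule jw_eq)
  finally have "card (jx ` ?I \<union> jw ` ?I) = card P" using P by simp
  then have Peq: "jx ` ?I \<union> jw ` ?I = P"
    using jxP jwP by (intro card_subset_eq) auto
  \<comment> \<open>The count leaves no slot for a second pure power of the same coordinate. So a
    root of unity of that single exponent would make the axis bad, unless the exponent is 1.\<close>
  have unique: "j = jx i" if i: "i \<in> ?I" and j: "C j \<noteq> 0" "\<forall>l. l \<noteq> i \<longrightarrow> a j l = 0" for i j
  proof -
    have ji: "a j i \<noteq> 0" using nonconst[OF j(1)] j(2) by metis
    have "j \<in> P"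
    proof (rule ccontr)
      assume "j \<notin> P"
      then have "a j i = 0" using notP i by simp
      with ji show False ..
    qed
    then consider i' where "i' \<in> ?I" "j = jx i'" | i' where "i' \<in> ?I" "j = jw i'"
      using Peq by blast
    then show ?thesis
    proof cases
      case 1
      then have "i' = i" using bspec[OF jx 1(1)] ji by metis
      with 1 show ?thesis by simp
    next
      case 2
      then have "a j y = 1" using bspec[OF jw 2(1)] by simp
      then show ?thesis using j(2) i by auto
    qed
  qed
  have one: "a (jx i) i = 1" if i: "i \<in> ?I" for i
  proof (rule ccontr)
    assume "a (jx i) i \<noteq> 1"
    then obtain \<zeta> :: complex where \<zeta>: "\<zeta> \<noteq> 1" "\<zeta> ^ a (jx i) i = 1"
      by (rule nontrivial_root_of_unity)
    have "bad_axis f i"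
    proof (rule bad_axisI_root[OF mono \<zeta>(1)])
      fix j assume "C j \<noteq> 0" "\<forall>l. l \<noteq> i \<longrightarrow> a j l = 0"
      then have "j = jx i" by (rule unique[OF i])
      then show "\<zeta> ^ a j i = 1" using \<zeta>(2) by simp
    qed
    with good i show False by simp
  qed
  show thesis
  proof (rule that)
    show "C (jx i) \<noteq> 0 \<and> a (jx i) i = 1 \<and> (\<forall>l. l \<noteq> i \<longrightarrow> a (jx i) l = 0)" if "i \<noteq> y" for i
      using bspec[OF jx, of i] one[of i] that by simp
    show "C (jw i) \<noteq> 0 \<and> a (jw i) y = 1 \<and> a (jw i) i \<ge> 1 \<and>
      (\<forall>l. l \<noteq> i \<and> l \<noteq> y \<longrightarrow> a (jw i) l = 0)" if "i \<noteq> y" for i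
      using bspec[OF jw, of i] that by simp
    show "P = jx ` ?I \<union> jw ` ?I" using Peq by simp
  qed (rule notP)
qed

section \<open>From components to the normal form\<close>

lemma prod_power_single:
  "\<forall>l. l \<noteq> i \<longrightarrow> e l = 0 \<Longrightarrow> (\<Prod>l\<in>UNIV. (z $ l) ^ e l) = ((z :: complex^'n) $ i) ^ e i"
  by (subst prod.remove[of _ i]) auto

lemma prod_power_pair:
  assumes "i \<noteq> y" "\<forall>l. l \<noteq> i \<and> l \<noteq> y \<longrightarrow> e l = 0"
  shows "(\<Prod>l\<in>UNIV. (z $ l) ^ e l) = ((z :: complex^'n) $ i) ^ e i * (z $ y) ^ e y"
proof -
  have "(\<Prod>l\<in>UNIV - {i}. (z $ l) ^ e l) = (z $ y) ^ e y * (\<Prod>l\<in>UNIV - {i} - {y}. (z $ l) ^ e l)"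
    using assms(1) by (intro prod.remove) auto
  also have "(\<Prod>l\<in>UNIV - {i} - {y}. (z $ l) ^ e l) = 1"
    using assms(2) by (intro prod.neutral) auto
  finally show ?thesis
    by (subst prod.remove[of _ i]) auto
qed

lemma A_equivalent_permute_scale:
  fixes f g :: "complex^'n \<Rightarrow> complex^'p" and \<pi> :: "'p \<Rightarrow> 'p"
  assumes "surj \<pi>" and \<kappa>: "\<And>q. \<kappa> q \<noteq> 0"
    and ev: "\<forall>\<^sub>F z in nhds 0. \<forall>q. f z $ \<pi> q = \<kappa> q * g z $ q"
  shows "A_equivalent f g"
proof -
  have bij: "bij \<pi>" using assms(1) finite_UNIV_surj_inj[of \<pi>] by (simp add: bij_def)
  define \<psi> :: "complex^'p \<Rightarrow> complex^'p" where "\<psi> w = (\<chi> q. inverse (\<kappa> q) * w $ \<pi> q)" for w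
  define \<psi>' :: "complex^'p \<Rightarrow> complex^'p" where "\<psi>' w = (\<chi> j. \<kappa> (inv \<pi> j) * w $ inv \<pi> j)" for w
  have "map_germ \<psi>" "map_germ \<psi>'"
    by (auto simp: map_germ_iff \<psi>_def \<psi>'_def vec_eq_iff)
  moreover have "\<psi>' (\<psi> w) = w" "\<psi> (\<psi>' w) = w" for w
    using bij \<kappa> by (auto simp: \<psi>_def \<psi>'_def vec_eq_iff bij_is_surj surj_f_inv_f bij_is_inj)
  ultimately have "inverse_germs \<psi> \<psi>'"
    by (simp add: inverse_germs_def)
  moreover have "\<forall>\<^sub>F z in nhds 0. g z = \<psi> (f ((\<lambda>z. z) z))"
    using ev by (rule eventually_mono) (use \<kappa> in \<open>simp add: \<psi>_def vec_eq_iff\<close>)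
  ultimately show ?thesis
    unfolding A_equivalent_def biholomorphism_germ_def
    by (intro exI[of _ "\<lambda>z. z"] exI[of _ \<psi>] exI[of _ \<psi>'] conjI inverse_germs_id)
qed

theorem theorem4p2:
  fixes n k :: nat
    and m :: "nat \<Rightarrow> nat"
    and f :: "complex^'n::{finite,linorder} \<Rightarrow> complex^'p::{finite,linorder}"
  assumes "n \<ge> 2" and "k \<ge> 2"
    and "CARD('n) = n" and "CARD('p) = 2 * n + k - 2"
    and "1 < m 1" and "strict_mono_on {1..k} m" and "Gcd (m ` {1..k}) = 1"
    and "map_germ f" and "singular_germ f" and "monomial_germ f"
    and "\<forall>\<^sub>F y in nhds 0.
           f (of_coords (\<lambda>j. if j = n then y else 0)) =
             of_coords (\<lambda>j. if j \<le> 2 * n - 2 then 0 else y ^ m (j - (2 * n - 2)))"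
  shows "A_finite f \<longleftrightarrow>
           (\<exists>l :: nat \<Rightarrow> nat. (\<forall>i\<in>{1..n - 1}. l i \<ge> 1) \<and> A_equivalent f (I_phi_H k m l))"
proof -
  define y :: 'n where "y = inv pos n"
  \<comment> \<open>The slots in which f vanishes along the y-axis; the remaining k slots carry the
    curve.\<close>
  define P :: "'p set" where "P = {j. pos j \<le> 2 * n - 2}"
  define \<mu> where "\<mu> j = m (pos j - (2 * n - 2))" for j :: 'p
  have pos_y: "pos y = n"
    unfolding y_def using assms(1,3) by (intro pos_inv_pos) auto
  have pos_less: "pos i \<le> n - 1" "1 \<le> pos i" if "i \<noteq> y" for i :: 'n
  proof -
    have "pos i \<noteq> n" using that unfolding y_def by (metis inv_pos_pos)
    then show "pos i \<le> n - 1" "1 \<le> pos i"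
      using pos_bounds[of i] assms(3) by simp_all
  qed
  have m_gt: "m e > 1" if "e \<in> {1..k}" for e
  proof (cases "e = 1")
    case False
    then have "m 1 < m e"
      using that strict_mono_onD[OF assms(6), of 1 e] by simp
    with assms(5) show ?thesis by simp
  qed (use assms(5) in simp)
  have "\<forall>j. \<exists>c a. \<forall>\<^sub>F z in nhds 0. f z $ j = c * (\<Prod>i\<in>UNIV. (z $ i) ^ a i)"
    using assms(10) unfolding monomial_germ_def .
  from choice[OF this] obtain C
    where "\<forall>j. \<exists>a. \<forall>\<^sub>F z in nhds 0. f z $ j = C j * (\<Prod>i\<in>UNIV. (z $ i) ^ a i)"
    by (elim exE)
  from choice[OF this] obtain a
    where "\<forall>j. \<forall>\<^sub>F z in nhds 0. f z $ j = C j * (\<Prod>i\<in>UNIV. (z $ i) ^ a j i)"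
    by (elim exE)
  then have "\<forall>\<^sub>F z in nhds 0. \<forall>j. f z $ j = C j * (\<Prod>i\<in>UNIV. (z $ i) ^ a j i)"
    by (simp add: eventually_all_finite)
  then have mono: "\<forall>\<^sub>F z in nhds 0. f z = monomial_map C a z"
    by (rule eventually_mono) (simp add: vec_eq_iff monomial_map_def)
  have f0: "f 0 = 0" using assms(8) by (simp add: map_germ_def)
  have pos_eq: "pos i = n \<longleftrightarrow> i = y" for i :: 'n
    using pos_less(1)[of i] pos_y assms(1) by (cases "i = y") auto
  have axis: "of_coords (\<lambda>j. if j = n then s else 0) = axis y s" for s :: complex
    unfolding of_coords_def axis_def pos_eq by simp
  have yaxis: "\<forall>\<^sub>F s in nhds 0. f (axis y s) $ j = (if j \<in> P then 0 else s ^ \<mu> j)" for j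
    using assms(11) unfolding axis by (rule eventually_mono) (simp add: of_coords_def P_def \<mu>_def)
  have notP_range: "pos j - (2 * n - 2) \<in> {1..k}" if "j \<notin> P" for j
    using that pos_bounds[of j] assms(1,4) by (auto simp: P_def)
  have \<mu>: "\<mu> j \<noteq> 1" if "j \<notin> P" for j
    using m_gt[OF notP_range[OF that]] by (simp add: \<mu>_def)
  have bij: "bij_betw pos P {1..2 * n - 2}"
  proof (rule bij_betw_subset[OF bij_betw_pos])
    show "pos ` P = {1..2 * n - 2}"
    proof (intro equalityI subsetI)
      fix j assume "j \<in> {1..2 * n - 2}"
      then have "pos (inv pos j :: 'p) = j"
        using assms(1,4) by (intro pos_inv_pos) auto
      with \<open>j \<in> {1..2 * n - 2}\<close> show "j \<in> pos ` P"
        by (intro image_eqI[of _ _ "inv pos j"]) (auto simp: P_def)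
    next
      fix j assume "j \<in> pos ` P"
      then obtain q where "q \<in> P" "j = pos q" by blast
      with pos_bounds(1)[of q] show "j \<in> {1..2 * n - 2}" by (simp add: P_def)
    qed
  qed simp
  have "card P = 2 * n - 2"
    using bij_betw_same_card[OF bij] by simp
  moreover have "{i. i \<noteq> y} = UNIV - {y}" by blast
  then have "card {i. i \<noteq> y} = n - 1"
    using card_Diff_singleton[of y "UNIV :: 'n set"] assms(3) by simp
  ultimately have cardP: "card P = 2 * card {i. i \<noteq> y}" by simp
  have comp: "\<forall>\<^sub>F z in nhds 0. f z $ j = C j * (\<Prod>i\<in>UNIV. (z $ i) ^ a j i)" for j
    using mono by (rule eventually_mono) (simp add: monomial_map_def)
  have inv_pos_y: "pos (inv pos (2 * n - 2 + e) :: 'p) = 2 * n - 2 + e" if "e \<in> {1..k}" for e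
    using that assms(1,4) by (intro pos_inv_pos) auto
  show ?thesis
  proof
    assume fin: "A_finite f"
    \<comment> \<open>In terms of n and k this reads 2n <= 2n + k - 2, that is k >= 2.\<close>
    have "2 * CARD('n) \<le> CARD('p)" using assms(2-4) by simp
    then have good: "\<not> bad_axis f i" for i
      using assms(8) fin mono by (rule A_finite_imp_not_bad_axis)
    obtain jx jw where
      jx: "\<And>i. i \<noteq> y \<Longrightarrow> C (jx i) \<noteq> 0 \<and> a (jx i) i = 1 \<and> (\<forall>l. l \<noteq> i \<longrightarrow> a (jx i) l = 0)" and
      jw: "\<And>i. i \<noteq> y \<Longrightarrow> C (jw i) \<noteq> 0 \<and> a (jw i) y = 1 \<and> a (jw i) i \<ge> 1 \<and>
        (\<forall>l. l \<noteq> i \<and> l \<noteq> y \<longrightarrow> a (jw i) l = 0)" and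
      Peq: "P = jx ` {i. i \<noteq> y} \<union> jw ` {i. i \<noteq> y}" and
      notP: "\<And>j. j \<notin> P \<Longrightarrow> C j = 1 \<and> a j y = \<mu> j \<and> (\<forall>l. l \<noteq> y \<longrightarrow> a j l = 0)"
      by (rule monomial_components_of_not_bad_axis[OF mono f0 yaxis \<mu> cardP good]) (assumption, rule that)
    define l where "l i = a (jw (inv pos i)) (inv pos i)" for i
    \<comment> \<open>The normal form has the powers of y in its middle block, f has them last.
      \<open>\<pi>\<close> sends a slot of the normal form to the slot of f with the same monomial
      up to a constant; the middle block is shifted by n - 1.\<close>
    define \<pi> :: "'p \<Rightarrow> 'p" where "\<pi> q =
      (if pos q \<le> n - 1 then jx (inv pos (pos q))
       else if pos q \<le> n - 1 + k then inv pos (2 * n - 2 + (pos q - (n - 1)))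
       else jw (inv pos (pos q - (n - 1 + k))))" for q
    have idx: "inv pos j \<noteq> y" "pos (inv pos j :: 'n) = j" if "1 \<le> j" "j \<le> n - 1" for j
    proof -
      show "pos (inv pos j :: 'n) = j" using that assms(3) by (intro pos_inv_pos) auto
      with pos_y that assms(1) show "inv pos j \<noteq> y" by auto
    qed
    have target: "pos (inv pos j :: 'p) = j" if "1 \<le> j" "j \<le> 2 * n + k - 2" for j
      using that assms(4) by (intro pos_inv_pos) auto
    \<comment> \<open>Here \<open>Peq\<close> matters: every slot of \<open>P\<close> is some
      \<open>jx i\<close> or \<open>jw i\<close>.\<close>
    have "j \<in> range \<pi>" for j
    proof (cases "j \<in> P")
      case True
      then consider i where "i \<noteq> y" "j = jx i" | i where "i \<noteq> y" "j = jw i"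
        using Peq by blast
      then show ?thesis
      proof cases
        case 1
        have "pos (inv pos (pos i) :: 'p) = pos i"
          using pos_less[OF 1(1)] assms(1) by (intro target) auto
        then have "\<pi> (inv pos (pos i)) = jx i"
          using pos_less[OF 1(1)] by (simp only: \<pi>_def if_True inv_pos_pos)
        then have "\<pi> (inv pos (pos i)) = j" using 1(2) by simp
        then show ?thesis by (rule range_eqI[OF sym])
      next
        case 2
        have "pos (inv pos (n - 1 + k + pos i) :: 'p) = n - 1 + k + pos i"
          using pos_less[OF 2(1)] assms(1) by (intro target) auto
        moreover have "\<not> n - 1 + k + pos i \<le> n - 1" "\<not> n - 1 + k + pos i \<le> n - 1 + k"
          "n - 1 + k + pos i - (n - 1 + k) = pos i"
          using pos_less(2)[OF 2(1)] assms(2) by linarith+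
        ultimately have "\<pi> (inv pos (n - 1 + k + pos i)) = jw i"
          by (simp only: \<pi>_def if_False inv_pos_pos)
        then have "\<pi> (inv pos (n - 1 + k + pos i)) = j" using 2(2) by simp
        then show ?thesis by (rule range_eqI[OF sym])
      qed
    next
      case False
      let ?e = "pos j - (2 * n - 2)"
      have e: "1 \<le> ?e" "?e \<le> k" "2 * n - 2 + ?e = pos j"
        using notP_range[OF False] False by (auto simp: P_def)
      have "pos (inv pos (n - 1 + ?e) :: 'p) = n - 1 + ?e"
        using e assms(1) by (intro target) linarith+
      moreover have "\<not> n - 1 + ?e \<le> n - 1" "n - 1 + ?e \<le> n - 1 + k" "n - 1 + ?e - (n - 1) = ?e"
        using e by linarith+
      ultimately have "\<pi> (inv pos (n - 1 + ?e)) = j"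
        by (simp only: \<pi>_def if_True if_False e(3) inv_pos_pos)
      then show ?thesis by (rule range_eqI[OF sym])
    qed
    then have "surj \<pi>" by (rule UNIV_eq_I[symmetric])
    have monom: "C (\<pi> q) \<noteq> 0 \<and> (\<Prod>i\<in>UNIV. (z $ i) ^ a (\<pi> q) i) = I_phi_H k m l z $ q" for q and z :: "complex^'n::{finite,linorder}"
    proof -
      let ?j = "pos q"
      have h: "(I_phi_H k m l z :: complex^'p::{finite,linorder}) $ q =
          (if ?j \<le> n - 1 then coord z ?j
           else if ?j \<le> n - 1 + k then coord z n ^ m (?j - (n - 1))
           else coord z (?j - (n - 1 + k)) ^ l (?j - (n - 1 + k)) * coord z n)"
        unfolding coord_pos[symmetric] using pos_bounds[of q] assms(3) by (intro coord_I_phi_H)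
      have zy: "coord z n = z $ y" by (simp add: coord_def y_def)
      consider (x) "?j \<le> n - 1" | (y) "\<not> ?j \<le> n - 1" "?j \<le> n - 1 + k" | (w) "\<not> ?j \<le> n - 1" "\<not> ?j \<le> n - 1 + k"
        by blast
      then show ?thesis
      proof cases
        case x
        let ?i = "inv pos ?j :: 'n"
        have i: "?i \<noteq> y" using idx(1)[OF pos_bounds(1) x] .
        have "\<pi> q = jx ?i" using x by (simp only: \<pi>_def if_True)
        then show ?thesis
          using jx[OF i] x prod_power_single[of ?i "a (jx ?i)" z] by (simp add: h coord_def)
      next
        case y
        let ?e = "?j - (n - 1)"
        have e: "?e \<in> {1..k}" using y by auto
        have \<pi>q: "\<pi> q = inv pos (2 * n - 2 + ?e)" using y by (simp only: \<pi>_def if_True if_False)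
        have pq: "pos (\<pi> q) = 2 * n - 2 + ?e" unfolding \<pi>q by (rule inv_pos_y[OF e])
        have "1 \<le> ?e" using e by simp
        with pq have "\<not> pos (\<pi> q) \<le> 2 * n - 2" by linarith
        then have "\<pi> q \<notin> P" by (simp add: P_def)
        moreover have "\<mu> (\<pi> q) = m ?e" unfolding \<mu>_def pq by simp
        ultimately show ?thesis
          using notP[of "\<pi> q"] y prod_power_single[of "y" "a (\<pi> q)" z] by (simp add: h zy)
      next
        case w
        let ?i = "inv pos (?j - (n - 1 + k)) :: 'n"
        have "1 \<le> ?j - (n - 1 + k)" "?j - (n - 1 + k) \<le> n - 1"
          using w pos_bounds[of q] assms(1,4) by linarith+
        then have i: "?i \<noteq> y" by (rule idx(1))
        have \<pi>q: "\<pi> q = jw ?i" using w by (simp only: \<pi>_def if_False)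
        show ?thesis
          unfolding \<pi>q using jw[OF i] w prod_power_pair[OF i, of "a (jw ?i)" z]
          by (simp add: h zy) (simp add: coord_def l_def)
      qed
    qed
    have "A_equivalent f (I_phi_H k m l)"
    proof (rule A_equivalent_permute_scale[OF \<open>surj \<pi>\<close>, of "\<lambda>q. C (\<pi> q)"])
      show "C (\<pi> q) \<noteq> 0" for q by (rule conjunct1[OF monom])
      show "\<forall>\<^sub>F z in nhds 0. \<forall>q. f z $ \<pi> q = C (\<pi> q) * I_phi_H k m l z $ q"
        using mono by (rule eventually_mono) (simp only: monomial_map_def vec_lambda_beta conjunct2[OF monom] simp_thms)
    qed
    moreover have "l i \<ge> 1" if "i \<in> {1..n - 1}" for i
    proof -
      have "inv pos i \<noteq> y" using idx(1) that by simp
      from jw[OF this] show ?thesis by (simp only: l_def)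
    qed
    ultimately show "\<exists>l. (\<forall>i\<in>{1..n - 1}. l i \<ge> 1) \<and> A_equivalent f (I_phi_H k m l)"
      by (intro exI[of _ l] conjI ballI)
  next
    assume "\<exists>l. (\<forall>i\<in>{1..n - 1}. l i \<ge> 1) \<and> A_equivalent f (I_phi_H k m l)"
    then obtain l where l: "\<And>i. i \<in> {1..n - 1} \<Longrightarrow> l i \<ge> 1" and equiv: "A_equivalent f (I_phi_H k m l)"
      by blast
    have k1: "k \<ge> 1" using assms(2) by simp
    have good: "\<not> bad_axis f i" for i
    proof
      assume bad: "bad_axis f i"
      have ev: "\<forall>\<^sub>F z :: complex^'n::{finite,linorder} in nhds 0. z \<in> UNIV" by simp
      obtain \<gamma> \<epsilon> where \<gamma>: "\<epsilon> > (0::real)" "continuous_on {0..\<epsilon>} \<gamma>" "\<gamma> 0 = 0"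
        "\<And>s. 0 < s \<Longrightarrow> s \<le> \<epsilon> \<Longrightarrow>
          bad_point UNIV (I_phi_H k m l :: complex^'n::{finite,linorder} \<Rightarrow> complex^'p::{finite,linorder}) (\<gamma> s)"
        by (rule bad_points_along_curve[OF equiv assms(8) bad ev]) (rule that)
      \<comment> \<open>The normal form has no bad point at all, so the endpoint of the curve is
        already a contradiction.\<close>
      show False
        by (rule notE[OF not_bad_point_I_phi_H[OF assms(1,3) k1 assms(4,5,7) l] \<gamma>(4)[OF \<gamma>(1) order_refl]])
    qed
    \<comment> \<open>From here on the equivalence with the normal form is no longer consulted: the
      absence of bad axes describes the components of f itself, and determinacy is read off from
      them.\<close>
    obtain jx jw where
      jx: "\<And>i. i \<noteq> y \<Longrightarrow> C (jx i) \<noteq> 0 \<and> a (jx i) i = 1 \<and> (\<forall>l. l \<noteq> i \<longrightarrow> a (jx i) l = 0)" and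
      jw: "\<And>i. i \<noteq> y \<Longrightarrow> C (jw i) \<noteq> 0 \<and> a (jw i) y = 1 \<and> a (jw i) i \<ge> 1 \<and>
        (\<forall>l. l \<noteq> i \<and> l \<noteq> y \<longrightarrow> a (jw i) l = 0)" and
      "P = jx ` {i. i \<noteq> y} \<union> jw ` {i. i \<noteq> y}" and
      notP: "\<And>j. j \<notin> P \<Longrightarrow> C j = 1 \<and> a j y = \<mu> j \<and> (\<forall>l. l \<noteq> y \<longrightarrow> a j l = 0)"
      by (rule monomial_components_of_not_bad_axis[OF mono f0 yaxis \<mu> cardP good]) (assumption, rule that)
    show "A_finite f"
    proof (rule A_finite_of_monomial_components[OF assms(8) _ assms(7), where y = y])
      fix i assume i: "i \<noteq> y"
      have "(\<Prod>l\<in>UNIV. (z $ l) ^ a (jx i) l) = z $ i" for z :: "complex^'n::{finite,linorder}"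
        using jx[OF i] by (subst prod_power_single[of i]) auto
      then have "\<forall>\<^sub>F z in nhds 0. f z $ jx i = C (jx i) * z $ i"
        using comp[of "jx i"] by simp
      then show "\<exists>j c. c \<noteq> 0 \<and> (\<forall>\<^sub>F z in nhds 0. f z $ j = c * z $ i)"
        by (intro exI conjI) (rule conjunct1[OF jx[OF i]])
      have "(\<Prod>l\<in>UNIV. (z $ l) ^ a (jw i) l) = (z $ i) ^ a (jw i) i * z $ y" for z :: "complex^'n::{finite,linorder}"
        using jw[OF i] by (subst prod_power_pair[OF i]) auto
      then have "\<forall>\<^sub>F z in nhds 0. f z $ jw i = C (jw i) * ((z $ i) ^ a (jw i) i * z $ y)"
        using comp[of "jw i"] by simp
      then show "\<exists>j c l. c \<noteq> 0 \<and> (\<forall>\<^sub>F z in nhds 0. f z $ j = c * ((z $ i) ^ l * z $ y))"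
        by (intro exI conjI) (rule conjunct1[OF jw[OF i]])
    next
      fix e assume "e \<in> m ` {1..k}"
      then obtain e' where e': "e' \<in> {1..k}" "e = m e'" by blast
      let ?j = "inv pos (2 * n - 2 + e') :: 'p"
      have "?j \<notin> P" using inv_pos_y[OF e'(1)] e'(1) by (simp add: P_def)
      moreover have "\<mu> ?j = e" unfolding \<mu>_def inv_pos_y[OF e'(1)] e'(2) by simp
      ultimately have j: "C ?j = 1" "a ?j y = e" "\<forall>l. l \<noteq> y \<longrightarrow> a ?j l = 0"
        using notP[of ?j] by simp_all
      have "\<forall>\<^sub>F z in nhds 0. f z $ ?j = 1 * (z $ y) ^ e"
        using comp[of ?j] unfolding prod_power_single[OF j(3)] j(1,2) .
      then show "\<exists>j c. c \<noteq> 0 \<and> (\<forall>\<^sub>F z in nhds 0. f z $ j = c * (z $ y) ^ e)"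
        by (intro exI conjI) (rule one_neq_zero)
    qed simp
  qed
qed

end
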